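(* Let $\Lambda,\mathrm{M}:[0,1]\to\mathbb{R}$ be functions of class $C^1$, and let $u_0,v_0$ be cumulative distribution functions of probability measures on $\mathbb{R}$. Denote $\lambda:=\Lambda'$ and $\mu:=\mathrm{M}'$, and let $u$ and $v$ be the entropy solutions of the scalar conservation laws $\partial_tu+\partial_x(\Lambda(u))=0$ and $\partial_tv+\partial_x(\mathrm{M}(v))=0$ with respective initial data $u_0$ and $v_0$. Then, for all $0\le s\le t$, $$\|u(t,\cdot)-v(t,\cdot)\|_{L^1(\mathbb{R})}\le\|u(s,\cdot)-v(s,\cdot)\|_{L^1(\mathbb{R})}+(t-s)\int_0^1|\lambda(w)-\mu(w)|\,dw.$$
   Context: Entropy solution: for a $C^1$ flux $\Lambda:[0,1]\to\mathbb{R}$ and a cumulative distribution function (CDF) $u_0$, the unique weak solution $u:[0,+\infty)\times\mathbb{R}\to[0,1]$ of $\partial_t u+\partial_x(\Lambda(u))=0$ with initial condition $u_0$ satisfying Kruzkov's entropy condition: for all $c\in[0,1]$, $\partial_t|u-c|+\partial_x(\mathrm{sgn}(u-c)(\Lambda(u)-\Lambda(c)))\le0$ in the distributional sense (with initial datum $u_0$). For all $t\ge0$, $u(t,\cdot)$ coincides almost everywhere with the CDF of a probability measure (Kruzkov's theorem; the solution is taken continuous in time with values in $L^1_{\mathrm{loc}}(\mathbb{R})$). The $L^1$ norms may be equal to $+\infty$. *)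

theory Defs
  imports "HOL-Probability.Probability"
begin

text \<open>Points of the time-space plane are pairs \<open>(t, x)\<close>.\<close>

definition time_deriv :: "(real \<times> real \<Rightarrow> real) \<Rightarrow> real \<times> real \<Rightarrow> real" where
  "time_deriv \<phi> z = deriv (\<lambda>s. \<phi> (s, snd z)) (fst z)"

definition space_deriv :: "(real \<times> real \<Rightarrow> real) \<Rightarrow> real \<times> real \<Rightarrow> real" where
  "space_deriv \<phi> z = deriv (\<lambda>y. \<phi> (fst z, y)) (snd z)"

primrec C_k :: "nat \<Rightarrow> (real \<times> real \<Rightarrow> real) \<Rightarrow> bool" where
  "C_k 0 \<phi> \<longleftrightarrow> continuous_on UNIV \<phi>"
| "C_k (Suc k) \<phi> \<longleftrightarrow>
     \<phi> differentiable_on UNIV \<and> C_k k (time_deriv \<phi>) \<and> C_k k (space_deriv \<phi>)"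

text \<open>
  Smooth functions with compact support in the whole plane. They are only evaluated on
  \<open>[0, \<infinity>) \<times> \<real>\<close>, and need not vanish at time \<open>0\<close>: their restrictions are the test functions in
  \<open>C\<^sub>c\<^sup>\<infinity>([0, \<infinity>) \<times> \<real>)\<close>.
\<close>

definition test_function :: "(real \<times> real \<Rightarrow> real) \<Rightarrow> bool" where
  "test_function \<phi> \<longleftrightarrow> (\<forall>k. C_k k \<phi>) \<and> compact (closure {z. \<phi> z \<noteq> 0})"

definition weak_solution ::
  "(real \<Rightarrow> real) \<Rightarrow> (real \<Rightarrow> real) \<Rightarrow> (real \<Rightarrow> real \<Rightarrow> real) \<Rightarrow> bool" where
  "weak_solution \<Lambda> u\<^sub>0 u \<longleftrightarrow>
    (\<forall>\<phi>. test_function \<phi> \<longrightarrow>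
      (LINT (t, x):{0..} \<times> UNIV|lebesgue.
          u t x * time_deriv \<phi> (t, x) + \<Lambda> (u t x) * space_deriv \<phi> (t, x))
      + (LINT x|lebesgue. u\<^sub>0 x * \<phi> (0, x)) = 0)"

text \<open>
  The distributional inequality
  \<open>\<partial>\<^sub>t \<bar>u - c\<bar> + \<partial>\<^sub>x (sgn (u - c) (\<Lambda> u - \<Lambda> c)) \<le> 0\<close> with initial datum \<open>u\<^sub>0\<close>, for all \<open>c \<in> [0, 1]\<close>.
  Moving the derivatives onto a nonnegative test function reverses the sign.
\<close>

definition kruzkov_entropy_condition ::
  "(real \<Rightarrow> real) \<Rightarrow> (real \<Rightarrow> real) \<Rightarrow> (real \<Rightarrow> real \<Rightarrow> real) \<Rightarrow> bool" where
  "kruzkov_entropy_condition \<Lambda> u\<^sub>0 u \<longleftrightarrow>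
    (\<forall>c\<in>{0..1}. \<forall>\<phi>. test_function \<phi> \<and> (\<forall>z. 0 \<le> \<phi> z) \<longrightarrow>
      0 \<le> (LINT (t, x):{0..} \<times> UNIV|lebesgue.
              \<bar>u t x - c\<bar> * time_deriv \<phi> (t, x)
              + sgn (u t x - c) * (\<Lambda> (u t x) - \<Lambda> c) * space_deriv \<phi> (t, x))
          + (LINT x|lebesgue. \<bar>u\<^sub>0 x - c\<bar> * \<phi> (0, x)))"

definition continuous_in_L1_loc :: "(real \<Rightarrow> real \<Rightarrow> real) \<Rightarrow> bool" where
  "continuous_in_L1_loc u \<longleftrightarrow>
    (\<forall>t\<ge>0. \<forall>R. ((\<lambda>s. LINT x:{-R..R}|lebesgue. \<bar>u s x - u t x\<bar>) \<longlongrightarrow> 0) (at t within {0..}))"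

text \<open>
  Only times \<open>t \<ge> 0\<close> matter. Measurability of every time slice is required separately,
  since joint Lebesgue measurability gives it for almost every \<open>t\<close> only.
  The initial condition is carried by the boundary terms of the two integral conditions.
\<close>

definition entropy_solution ::
  "(real \<Rightarrow> real) \<Rightarrow> (real \<Rightarrow> real) \<Rightarrow> (real \<Rightarrow> real \<Rightarrow> real) \<Rightarrow> bool" where
  "entropy_solution \<Lambda> u\<^sub>0 u \<longleftrightarrow>
    (\<forall>t\<ge>0. \<forall>x. u t x \<in> {0..1})
    \<and> (\<lambda>(t, x). u t x) \<in> borel_measurable (lebesgue_on ({0..} \<times> UNIV))
    \<and> (\<forall>t\<ge>0. u t \<in> borel_measurable lebesgue)
    \<and> continuous_in_L1_loc u
    \<and> weak_solution \<Lambda> u\<^sub>0 u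
    \<and> kruzkov_entropy_condition \<Lambda> u\<^sub>0 u"

definition L1_norm :: "(real \<Rightarrow> real) \<Rightarrow> ennreal" where
  "L1_norm f = (\<integral>\<^sup>+x. ennreal \<bar>f x\<bar> \<partial>lebesgue)"

end

theory Submission
  imports Defs "HOL-Real_Asymp.Real_Asymp"
begin

text \<open>
  Kruzkov's doubling of variables, arranged so that the constant comes out sharp. Put
  \<open>G = \<Lambda> - M\<close> and \<open>H w = \<integral>\<^sub>0\<^sup>w \<bar>G'\<bar>\<close>. The solution \<open>u\<close> is nondecreasing in \<open>x\<close>. As \<open>G\<close> varies at most
  as much as \<open>H\<close>, the function \<open>a \<mapsto> H a + sgn (a - c) (G a - G c)\<close> is nondecreasing, so its composition
  with \<open>u\<close> is nondecreasing in \<open>x\<close> and has a nonnegative distributional derivative. Subtracting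
  that function from the Kruzkov flux \<open>sgn (u - c) (\<Lambda> u - \<Lambda> c)\<close> therefore keeps the entropy
  inequality of \<open>u\<close> true, and turns the flux into \<open>F u c\<close> with
  \<open>F a b = sgn (a - b) (M a - M b) - H a\<close>. In the entropy inequality of \<open>v\<close> the first argument of
  \<open>F\<close> is a constant, so that the term \<open>- H c\<close> is harmless there. Hence \<open>u\<close> and \<open>v\<close> satisfy
  entropy inequalities for one and the same pair \<open>(\<bar>a - b\<bar>, F a b)\<close>, and doubling
  (\<open>dissipates_doubling\<close>) yields \<open>\<partial>\<^sub>t \<bar>u - v\<bar> + \<partial>\<^sub>x (F u v) \<le> 0\<close>.

  This inequality is tested with a smooth weight that lives on a shrinking cone
  \<open>\<bar>x\<bar> < R - L t\<close>, where \<open>L\<close> is a Lipschitz constant of \<open>M\<close>. The decay of the weight in time absorbs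
  the Kruzkov part of \<open>F\<close>. The part \<open>- H u\<close> contributes only through the right flank of the weight,
  on which the weight drops by at most \<open>1\<close>; this costs at most \<open>H 1 = \<integral>\<^sub>0\<^sup>1 \<bar>\<Lambda>' - M'\<bar>\<close> per unit of time
  (\<open>cone_estimate\<close>). Exhausting the line by cones gives the theorem; as the energies in the
  cones are finite, infinite norms cause no trouble.

  That \<open>u\<close> is nondecreasing in \<open>x\<close> (\<open>entropy_solution_increasing\<close>) follows from the same two tools,
  applied to \<open>u\<close> and its translate \<open>u (t, x + h)\<close> with the pair that belongs to \<open>(a - b)\<^sup>+\<close>; that
  pair arises by adding the weak formulation to the entropy inequality. The energy vanishes
  initially because the initial datum is nondecreasing and is attained almost everywhere
  (\<open>entropy_solution_initial_trace\<close>).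

  All test functions are products of \<open>exp (- 1 / x)\<close>, extended by \<open>0\<close>, at affine arguments, so that
  smoothness has to be established only once.
\<close>

section \<open>A flat function\<close>

text \<open>
  The function \<open>p (1 / x) exp (- 1 / x)\<close>, extended by \<open>0\<close>. The polynomial is a parameter because
  this family is closed under differentiation, which makes smoothness a plain induction.
\<close>

definition flat_exp :: "real poly \<Rightarrow> real \<Rightarrow> real" where
  "flat_exp p x = (if x \<le> 0 then 0 else poly p (1 / x) * exp (- (1 / x)))"

text \<open>
  In terms of \<open>y = 1 / x\<close> the derivative of \<open>p y exp (- y)\<close> in \<open>x\<close> is \<open>y\<^sup>2 (p y - p' y) exp (- y)\<close>.
\<close>

definition flat_deriv :: "real poly \<Rightarrow> real poly" where
  "flat_deriv p = [:0, 0, 1:] * (p - pderiv p)"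

abbreviation "ramp \<equiv> flat_exp 1"

abbreviation "ramp' \<equiv> flat_exp (flat_deriv 1)"

lemma poly_times_exp_minus_tendsto_0:
  fixes p :: "real poly"
  shows "((\<lambda>y. poly p y * exp (- y)) \<longlongrightarrow> 0) at_top"
proof -
  have "((\<lambda>y. \<Sum>i\<le>degree p. coeff p i * (y ^ i / exp y)) \<longlongrightarrow> (\<Sum>i\<le>degree p. coeff p i * 0)) at_top"
    by (intro tendsto_sum tendsto_mult tendsto_const tendsto_power_div_exp_0)
  then show ?thesis
    by (simp add: poly_altdef sum_distrib_right exp_minus divide_inverse mult.assoc)
qed

text \<open>
  Away from \<open>0\<close> this is the chain rule. At \<open>0\<close> the difference quotient is \<open>y p y exp (- y)\<close> with
  \<open>y = 1 / x \<rightarrow> \<infinity>\<close>, which the exponential sends to \<open>0\<close>.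
\<close>

lemma flat_exp_has_derivative:
  "(flat_exp p has_real_derivative flat_exp (flat_deriv p) x) (at x)"
proof -
  consider "x < 0" | "x = 0" | "x > 0" by linarith
  then show ?thesis
  proof cases
    case 1
    have "(flat_exp p has_real_derivative 0) (at x)"
      by (rule has_field_derivative_transform_within_open[of "\<lambda>_. 0" _ _ "{..<0}"])
        (use 1 in \<open>auto simp: flat_exp_def\<close>)
    then show ?thesis using 1 by (simp add: flat_exp_def)
  next
    case 2
    have "((\<lambda>h. (flat_exp p h) / h) \<longlongrightarrow> 0) (at 0)"
    proof (rule filterlim_split_at)
      show "((\<lambda>h. (flat_exp p h) / h) \<longlongrightarrow> 0) (at_left 0)"
        by (rule tendsto_eventually)
          (auto simp: flat_exp_def eventually_at_filter)
      have "((\<lambda>h. poly ([:0,1:] * p) (inverse h) * exp (- inverse h)) \<longlongrightarrow> 0) (at_right (0::real))"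
        by (rule filterlim_compose[OF poly_times_exp_minus_tendsto_0 filterlim_inverse_at_top_right])
      then show "((\<lambda>h. (flat_exp p h) / h) \<longlongrightarrow> 0) (at_right 0)"
        by (rule Lim_transform_eventually)
          (auto simp: flat_exp_def eventually_at_filter field_simps)
    qed
    then show ?thesis using 2 by (simp add: DERIV_def flat_exp_def)
  next
    case 3
    have "((\<lambda>x. poly p (1 / x) * exp (- (1 / x))) has_real_derivative flat_exp (flat_deriv p) x) (at x)"
      using 3
      by (auto intro!: derivative_eq_intros simp: flat_exp_def flat_deriv_def power2_eq_square field_simps)
    then show ?thesis
      by (rule has_field_derivative_transform_within_open[of _ _ _ "{0<..}"])
        (use 3 in \<open>auto simp: flat_exp_def\<close>)
  qed
qed

lemma flat_exp_DERIV [derivative_intros]: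
  assumes "(f has_real_derivative D) (at x within S)"
  shows "((\<lambda>x. flat_exp p (f x)) has_real_derivative flat_exp (flat_deriv p) (f x) * D) (at x within S)"
  using DERIV_chain2[OF flat_exp_has_derivative assms] .

lemma continuous_on_flat_exp [continuous_intros]:
  assumes "continuous_on S f"
  shows "continuous_on S (\<lambda>x. flat_exp p (f x))"
proof -
  have "continuous_on UNIV (flat_exp p)"
    by (intro continuous_at_imp_continuous_on ballI DERIV_isCont[OF flat_exp_has_derivative])
  then show ?thesis using assms by (rule continuous_on_compose2) auto
qed

lemma borel_measurable_flat_exp [measurable]: "flat_exp p \<in> borel_measurable borel"
  by (intro borel_measurable_continuous_onI continuous_intros)

lemma ramp_mono: "x \<le> y \<Longrightarrow> ramp x \<le> ramp y"
  by (auto simp: flat_exp_def frac_le)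

lemma ramp_nonneg [simp]: "0 \<le> ramp x"
  and ramp_le_1 [simp]: "ramp x \<le> 1"
  and ramp_pos_iff [simp]: "0 < ramp x \<longleftrightarrow> 0 < x"
  by (auto simp: flat_exp_def)

lemma flat_exp_nonpos [simp]: "x \<le> 0 \<Longrightarrow> flat_exp p x = 0"
  by (simp add: flat_exp_def)

lemma ramp'_nonneg [simp]: "0 \<le> ramp' x"
  by (auto simp: flat_exp_def flat_deriv_def)

text \<open>
  With \<open>y = 1 / x\<close> the claim is \<open>y\<^sup>2 \<le> exp y\<close>, the square of \<open>y \<le> 1 + y / 2 + y\<^sup>2 / 8 \<le> exp (y / 2)\<close>.
\<close>

lemma ramp'_le_1: "ramp' x \<le> 1"
proof (cases "x \<le> 0")
  case False
  define y where "y = 1 / x"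
  have y: "0 < y" using False by (simp add: y_def)
  have "y \<le> 1 + y / 2 + (y / 2)\<^sup>2 / 2"
    using zero_le_power2[of "y - 2"] by (simp add: power2_eq_square field_simps)
  also have "\<dots> \<le> exp (y / 2)" using exp_lower_Taylor_quadratic[of "y / 2"] y by simp
  finally have "y\<^sup>2 \<le> (exp (y / 2))\<^sup>2" using y by (intro power_mono) auto
  also have "(exp (y / 2))\<^sup>2 = exp y" by (simp add: exp_double[symmetric])
  finally have "y\<^sup>2 * exp (- y) \<le> 1" by (simp add: exp_minus field_simps)
  then show ?thesis using False by (simp add: flat_exp_def flat_deriv_def y_def power2_eq_square mult.assoc)
qed simp

lemma ramp_Lipschitz: "\<bar>ramp x - ramp y\<bar> \<le> \<bar>x - y\<bar>"
proof -
  have *: "\<bar>ramp b - ramp a\<bar> \<le> \<bar>b - a\<bar>" if ab: "a < b" for a b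
  proof -
    obtain z where "ramp b - ramp a = (b - a) * ramp' z"
      using MVT2[OF ab, of ramp ramp'] flat_exp_has_derivative[of 1] by blast
    moreover have "(b - a) * ramp' z \<le> (b - a) * 1"
      using ab by (intro mult_left_mono ramp'_le_1) auto
    ultimately show ?thesis using ab ramp_mono[of a b] by simp
  qed
  show ?thesis using *[of x y] *[of y x] by (cases x y rule: linorder_cases) auto
qed

lemma ramp_tendsto_1: "(ramp \<longlongrightarrow> 1) at_top"
proof -
  have "((\<lambda>x::real. exp (- (1 / x))) \<longlongrightarrow> exp (- 0)) at_top"
    by (intro tendsto_exp tendsto_minus tendsto_divide_0[OF tendsto_const] filterlim_at_top_imp_at_infinity filterlim_ident)
  then have "((\<lambda>x::real. exp (- (1 / x))) \<longlongrightarrow> 1) at_top" by simp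
  then show ?thesis
    by (rule Lim_transform_eventually) (auto simp: flat_exp_def intro!: eventually_at_top_linorderI[of 1])
qed

text \<open>
  The ramp climbs from \<open>0\<close> to \<open>1\<close>, so its derivative is a probability density: rescaled, it
  concentrates at a point and serves as a one-sided mollifier.
\<close>

lemma has_bochner_integral_ramp':
  "has_bochner_integral lborel (ramp') 1"
proof -
  have [measurable]: "ramp' \<in> borel_measurable borel"
    by (intro borel_measurable_continuous_onI continuous_intros)
  have "(\<integral>\<^sup>+x. ennreal (ramp' x) * indicator {0..} x \<partial>lborel) = 1 - ramp 0"
    by (rule nn_integral_FTC_atLeast) (auto intro: flat_exp_has_derivative ramp_tendsto_1)
  also have "(\<integral>\<^sup>+x. ennreal (ramp' x) * indicator {0..} x \<partial>lborel)
      = (\<integral>\<^sup>+x. ennreal (ramp' x) \<partial>lborel)"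
    by (intro nn_integral_cong) (auto simp: indicator_def)
  finally show ?thesis
    by (intro has_bochner_integral_nn_integral) auto
qed

section \<open>Smooth functions of two variables and test functions\<close>

lemma time_deriv_eqI:
  "((\<lambda>s. \<phi> (s, snd z)) has_real_derivative D) (at (fst z)) \<Longrightarrow> time_deriv \<phi> z = D"
  unfolding time_deriv_def by (rule DERIV_imp_deriv)

lemma space_deriv_eqI:
  "((\<lambda>y. \<phi> (fst z, y)) has_real_derivative D) (at (snd z)) \<Longrightarrow> space_deriv \<phi> z = D"
  unfolding space_deriv_def by (rule DERIV_imp_deriv)

lemma
  assumes "\<phi> differentiable at z"
  shows has_time_deriv: "((\<lambda>s. \<phi> (s, snd z)) has_real_derivative time_deriv \<phi> z) (at (fst z))"
    and has_space_deriv: "((\<lambda>y. \<phi> (fst z, y)) has_real_derivative space_deriv \<phi> z) (at (snd z))"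
proof -
  have "(\<lambda>s. \<phi> (s, snd z)) differentiable at (fst z)"
    using assms
    by (intro differentiable_compose[of \<phi> "\<lambda>s. (s, snd z)"] differentiable_Pair) simp_all
  then show "((\<lambda>s. \<phi> (s, snd z)) has_real_derivative time_deriv \<phi> z) (at (fst z))"
    unfolding time_deriv_def using DERIV_deriv_iff_real_differentiable by blast
  have "(\<lambda>y. \<phi> (fst z, y)) differentiable at (snd z)"
    using assms
    by (intro differentiable_compose[of \<phi> "\<lambda>y. (fst z, y)"] differentiable_Pair) simp_all
  then show "((\<lambda>y. \<phi> (fst z, y)) has_real_derivative space_deriv \<phi> z) (at (snd z))"
    unfolding space_deriv_def using DERIV_deriv_iff_real_differentiable by blast
qed

lemma C_k_Suc_imp_C_k: "C_k (Suc k) \<phi> \<Longrightarrow> C_k k \<phi>"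
proof (induction k arbitrary: \<phi>)
  case 0 then show ?case by (simp add: differentiable_imp_continuous_on)
next
  case (Suc k) then show ?case by (metis C_k.simps(2))
qed

lemma C_k_const: "C_k k (\<lambda>_. c)"
proof (induction k arbitrary: c)
  case 0 then show ?case by simp
next
  case (Suc k)
  have "time_deriv (\<lambda>_. c) = (\<lambda>_. 0)" "space_deriv (\<lambda>_. c) = (\<lambda>_. 0)"
    by (auto intro!: ext time_deriv_eqI space_deriv_eqI)
  then show ?case using Suc by simp
qed

lemma C_k_add: "C_k k \<phi> \<Longrightarrow> C_k k \<psi> \<Longrightarrow> C_k k (\<lambda>z. \<phi> z + \<psi> z)"
proof (induction k arbitrary: \<phi> \<psi>)
  case 0 then show ?case by (simp add: continuous_on_add)
next
  case (Suc k)
  have d: "\<phi> differentiable at z" "\<psi> differentiable at z" for z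
    using Suc.prems by (metis C_k.simps(2) UNIV_I differentiable_on_def)+
  have "time_deriv (\<lambda>z. \<phi> z + \<psi> z) = (\<lambda>z. time_deriv \<phi> z + time_deriv \<psi> z)"
    using d by (intro ext time_deriv_eqI DERIV_add has_time_deriv)
  moreover have "space_deriv (\<lambda>z. \<phi> z + \<psi> z) = (\<lambda>z. space_deriv \<phi> z + space_deriv \<psi> z)"
    using d by (intro ext space_deriv_eqI DERIV_add has_space_deriv)
  ultimately show ?case
    using Suc by (simp add: differentiable_on_def)
qed

lemma
  assumes "\<phi> differentiable at z" "\<psi> differentiable at z"
  shows time_deriv_mult: "time_deriv (\<lambda>z. \<phi> z * \<psi> z) z = time_deriv \<phi> z * \<psi> z + \<phi> z * time_deriv \<psi> z"
    and space_deriv_mult: "space_deriv (\<lambda>z. \<phi> z * \<psi> z) z = space_deriv \<phi> z * \<psi> z + \<phi> z * space_deriv \<psi> z"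
proof -
  show "time_deriv (\<lambda>z. \<phi> z * \<psi> z) z = time_deriv \<phi> z * \<psi> z + \<phi> z * time_deriv \<psi> z"
    using DERIV_mult[OF has_time_deriv has_time_deriv, OF assms]
    by (intro time_deriv_eqI) (simp add: algebra_simps)
  show "space_deriv (\<lambda>z. \<phi> z * \<psi> z) z = space_deriv \<phi> z * \<psi> z + \<phi> z * space_deriv \<psi> z"
    using DERIV_mult[OF has_space_deriv has_space_deriv, OF assms]
    by (intro space_deriv_eqI) (simp add: algebra_simps)
qed

lemma C_k_mult: "C_k k \<phi> \<Longrightarrow> C_k k \<psi> \<Longrightarrow> C_k k (\<lambda>z. \<phi> z * \<psi> z)"
proof (induction k arbitrary: \<phi> \<psi>)
  case 0 then show ?case by (simp add: continuous_on_mult)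
next
  case (Suc k)
  have d: "\<phi> differentiable at z" "\<psi> differentiable at z" for z
    using Suc.prems by (metis C_k.simps(2) UNIV_I differentiable_on_def)+
  have "time_deriv (\<lambda>z. \<phi> z * \<psi> z) = (\<lambda>z. time_deriv \<phi> z * \<psi> z + \<phi> z * time_deriv \<psi> z)"
    using d by (intro ext time_deriv_mult)
  moreover have "space_deriv (\<lambda>z. \<phi> z * \<psi> z) = (\<lambda>z. space_deriv \<phi> z * \<psi> z + \<phi> z * space_deriv \<psi> z)"
    using d by (intro ext space_deriv_mult)
  ultimately show ?case
    using Suc.prems Suc.prems[THEN C_k_Suc_imp_C_k]
    by (auto simp: differentiable_on_def intro!: C_k_add Suc.IH)
qed

text \<open>
  Partial derivatives only change the polynomial and the scalar factor; the factor is there to close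
  the induction.
\<close>

lemma C_k_scaled_flat_exp_affine: "C_k k (\<lambda>z. d * flat_exp p (a + b * fst z + c * snd z))"
proof (induction k arbitrary: d p)
  case 0 show ?case by (auto intro!: continuous_intros)
next
  case (Suc k)
  have "time_deriv (\<lambda>z. d * flat_exp p (a + b * fst z + c * snd z))
      = (\<lambda>z. (d * b) * flat_exp (flat_deriv p) (a + b * fst z + c * snd z))"
    by (intro ext time_deriv_eqI) (auto intro!: derivative_eq_intros)
  moreover have "space_deriv (\<lambda>z. d * flat_exp p (a + b * fst z + c * snd z))
      = (\<lambda>z. (d * c) * flat_exp (flat_deriv p) (a + b * fst z + c * snd z))"
    by (intro ext space_deriv_eqI) (auto intro!: derivative_eq_intros)
  moreover have "(\<lambda>z. d * flat_exp p (a + b * fst z + c * snd z)) differentiable at z" for z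
  proof -
    have "((\<lambda>z. a + b * fst z + c * snd z) has_derivative (\<lambda>h. b * fst h + c * snd h)) (at z)"
      by (auto intro!: derivative_eq_intros)
    then have "((\<lambda>z. flat_exp p (a + b * fst z + c * snd z)) has_derivative
       (\<lambda>h. flat_exp (flat_deriv p) (a + b * fst z + c * snd z) * (b * fst h + c * snd h))) (at z)"
      using has_derivative_compose[OF _ flat_exp_has_derivative[unfolded has_field_derivative_def]] by blast
    then show ?thesis
      by (intro differentiable_mult) (auto simp: differentiable_def)
  qed
  ultimately show ?case
    using Suc.IH by (simp add: differentiable_on_def)
qed

lemma C_k_flat_exp_affine: "C_k k (\<lambda>z. flat_exp p (a + b * fst z + c * snd z))"
  using C_k_scaled_flat_exp_affine[of k 1 p a b c] by simp

lemma
  assumes "\<phi> differentiable at (a + c *\<^sub>R z)"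
  shows time_deriv_affine: "time_deriv (\<lambda>z. \<phi> (a + c *\<^sub>R z)) z = c * time_deriv \<phi> (a + c *\<^sub>R z)"
    and space_deriv_affine: "space_deriv (\<lambda>z. \<phi> (a + c *\<^sub>R z)) z = c * space_deriv \<phi> (a + c *\<^sub>R z)"
proof -
  have a: "((\<lambda>s. b + c * s) has_real_derivative c) (at x)" for b x :: real
    by (auto intro!: derivative_eq_intros)
  have "((\<lambda>s. \<phi> (a + c *\<^sub>R (s, snd z))) has_real_derivative time_deriv \<phi> (a + c *\<^sub>R z) * c) (at (fst z))"
    using DERIV_chain2[OF _ a, of "\<lambda>s. \<phi> (s, snd a + c * snd z)" _ "fst a" "fst z"] has_time_deriv[OF assms]
    by (cases a, cases z) simp
  then show "time_deriv (\<lambda>z. \<phi> (a + c *\<^sub>R z)) z = c * time_deriv \<phi> (a + c *\<^sub>R z)"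
    by (intro time_deriv_eqI) (simp add: mult.commute)
  have "((\<lambda>y. \<phi> (a + c *\<^sub>R (fst z, y))) has_real_derivative space_deriv \<phi> (a + c *\<^sub>R z) * c) (at (snd z))"
    using DERIV_chain2[OF _ a, of "\<lambda>y. \<phi> (fst a + c * fst z, y)" _ "snd a" "snd z"] has_space_deriv[OF assms]
    by (cases a, cases z) simp
  then show "space_deriv (\<lambda>z. \<phi> (a + c *\<^sub>R z)) z = c * space_deriv \<phi> (a + c *\<^sub>R z)"
    by (intro space_deriv_eqI) (simp add: mult.commute)
qed

lemma C_k_affine: "C_k k \<phi> \<Longrightarrow> C_k k (\<lambda>z. \<phi> (a + c *\<^sub>R z))"
proof (induction k arbitrary: \<phi>)
  case 0
  then have "continuous_on UNIV \<phi>" by simp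
  then have "continuous_on UNIV (\<lambda>z. \<phi> (a + c *\<^sub>R z))"
    by (rule continuous_on_compose2) (auto intro!: continuous_intros)
  then show ?case by simp
next
  case (Suc k)
  have d: "\<phi> differentiable at z" for z
    using Suc.prems by (metis C_k.simps(2) UNIV_I differentiable_on_def)
  have "(\<lambda>z. \<phi> (a + c *\<^sub>R z)) differentiable at z" for z
    by (rule differentiable_compose[OF d]) simp
  moreover have "time_deriv (\<lambda>z. \<phi> (a + c *\<^sub>R z)) = (\<lambda>z. c * time_deriv \<phi> (a + c *\<^sub>R z))"
    by (intro ext time_deriv_affine d)
  moreover have "space_deriv (\<lambda>z. \<phi> (a + c *\<^sub>R z)) = (\<lambda>z. c * space_deriv \<phi> (a + c *\<^sub>R z))"
    by (intro ext space_deriv_affine d)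
  ultimately show ?case
    using Suc by (simp add: differentiable_on_def C_k_mult C_k_const)
qed

lemma test_functionI:
  assumes "\<And>k. C_k k \<phi>" and "\<And>z. \<phi> z \<noteq> 0 \<Longrightarrow> z \<in> S" and "bounded S"
  shows "test_function \<phi>"
proof -
  have "bounded {z. \<phi> z \<noteq> 0}" using assms(2,3) by (auto intro: bounded_subset)
  then show ?thesis unfolding test_function_def using assms(1) by auto
qed

lemma test_function_mult:
  assumes "test_function \<phi>" "\<And>k. C_k k \<psi>"
  shows "test_function (\<lambda>z. \<phi> z * \<psi> z)"
proof (rule test_functionI)
  show "C_k k (\<lambda>z. \<phi> z * \<psi> z)" for k
    using assms by (intro C_k_mult) (simp_all add: test_function_def)
  show "z \<in> closure {z. \<phi> z \<noteq> 0}" if "\<phi> z * \<psi> z \<noteq> 0" for z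
    using that closure_subset[of "{z. \<phi> z \<noteq> 0}"] by auto
  show "bounded (closure {z. \<phi> z \<noteq> 0})"
    using assms(1) by (simp add: test_function_def compact_imp_bounded)
qed

lemma test_function_differentiable: "test_function \<phi> \<Longrightarrow> \<phi> differentiable at z"
  unfolding test_function_def by (metis C_k.simps(2) UNIV_I differentiable_on_def)

lemma
  assumes "test_function \<phi>"
  shows continuous_test_function: "continuous_on UNIV \<phi>"
    and continuous_time_deriv: "continuous_on UNIV (time_deriv \<phi>)"
    and continuous_space_deriv: "continuous_on UNIV (space_deriv \<phi>)"
proof -
  have "C_k 0 \<phi>" "C_k (Suc 0) \<phi>" using assms unfolding test_function_def by blast+
  then show "continuous_on UNIV \<phi>" "continuous_on UNIV (time_deriv \<phi>)" "continuous_on UNIV (space_deriv \<phi>)"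
    by simp_all
qed

lemma
  assumes "test_function \<phi>"
  shows borel_measurable_test_function: "\<phi> \<in> borel_measurable borel"
    and borel_measurable_time_deriv: "time_deriv \<phi> \<in> borel_measurable borel"
    and borel_measurable_space_deriv: "space_deriv \<phi> \<in> borel_measurable borel"
  using assms by (auto intro!: borel_measurable_continuous_onI continuous_test_function
     continuous_time_deriv continuous_space_deriv)

lemma 
  assumes "open S" "\<And>z. z \<in> S \<Longrightarrow> \<phi> z = 0" "z \<in> S"
  shows time_deriv_locally_zero: "time_deriv \<phi> z = 0"
    and space_deriv_locally_zero: "space_deriv \<phi> z = 0"
proof -
  have 1: "open ((\<lambda>s. (s, snd z)) -` S)" "open ((\<lambda>y. (fst z, y)) -` S)"
    using assms(1) by (auto intro!: open_vimage continuous_intros)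
  have "((\<lambda>s. \<phi> (s, snd z)) has_real_derivative 0) (at (fst z))"
    by (rule has_field_derivative_transform_within_open[of "\<lambda>_. 0", OF _ 1(1)]) (use assms in auto)
  then show "time_deriv \<phi> z = 0" by (rule time_deriv_eqI)
  have "((\<lambda>y. \<phi> (fst z, y)) has_real_derivative 0) (at (snd z))"
    by (rule has_field_derivative_transform_within_open[of "\<lambda>_. 0", OF _ 1(2)]) (use assms in auto)
  then show "space_deriv \<phi> z = 0" by (rule space_deriv_eqI)
qed

lemma
  assumes "\<And>z. fst z \<le> 0 \<Longrightarrow> \<phi> z = 0" "fst z < 0"
  shows time_deriv_past: "time_deriv \<phi> z = 0" and space_deriv_past: "space_deriv \<phi> z = 0"
proof -
  have o: "open {z :: real \<times> real. fst z < 0}" by (intro open_Collect_less continuous_intros)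
  show "time_deriv \<phi> z = 0" by (rule time_deriv_locally_zero[OF o]) (use assms in auto)
  show "space_deriv \<phi> z = 0" by (rule space_deriv_locally_zero[OF o]) (use assms in auto)
qed

text \<open>
  The derivatives vanish off the support because its complement is open, and all three functions are
  continuous, hence bounded on the support.
\<close>

lemma test_function_bounds:
  assumes "test_function \<phi>"
  obtains K B where "compact K" "B > 0"
    "\<And>z. \<bar>\<phi> z\<bar> \<le> B" "\<And>z. \<bar>time_deriv \<phi> z\<bar> \<le> B" "\<And>z. \<bar>space_deriv \<phi> z\<bar> \<le> B"
    "\<And>z. z \<notin> K \<Longrightarrow> \<phi> z = 0" "\<And>z. z \<notin> K \<Longrightarrow> time_deriv \<phi> z = 0" "\<And>z. z \<notin> K \<Longrightarrow> space_deriv \<phi> z = 0"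
proof -
  define K where "K = closure {z. \<phi> z \<noteq> 0}"
  have K: "compact K" using assms by (simp add: test_function_def K_def)
  have out: "\<phi> z = 0" if "z \<notin> K" for z 
    using that closure_subset[of "{z. \<phi> z \<noteq> 0}"] unfolding K_def by blast
  have op: "open (- K)" using K by (simp add: compact_imp_closed open_Compl)
  have out': "time_deriv \<phi> z = 0" "space_deriv \<phi> z = 0" if "z \<notin> K" for z
    using time_deriv_locally_zero[OF op, of \<phi> z] space_deriv_locally_zero[OF op, of \<phi> z] out that by auto
  have bdd: "\<exists>B. \<forall>z\<in>K. \<bar>f z\<bar> \<le> B" if "continuous_on UNIV f" for f :: "real \<times> real \<Rightarrow> real"
  proof -
    have "bounded (f ` K)"
      using that K by (intro compact_imp_bounded compact_continuous_image) (auto intro: continuous_on_subset)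
    then show ?thesis by (auto simp: bounded_iff)
  qed
  obtain B1 where B1: "\<And>z. z \<in> K \<Longrightarrow> \<bar>\<phi> z\<bar> \<le> B1"
    using bdd[OF continuous_test_function[OF assms]] by blast
  obtain B2 where B2: "\<And>z. z \<in> K \<Longrightarrow> \<bar>time_deriv \<phi> z\<bar> \<le> B2"
    using bdd[OF continuous_time_deriv[OF assms]] by blast
  obtain B3 where B3: "\<And>z. z \<in> K \<Longrightarrow> \<bar>space_deriv \<phi> z\<bar> \<le> B3"
    using bdd[OF continuous_space_deriv[OF assms]] by blast
  define B where "B = 1 + \<bar>B1\<bar> + \<bar>B2\<bar> + \<bar>B3\<bar>"
  show thesis
  proof (rule that[OF K])
    show "B > 0" by (simp add: B_def)
    show "\<bar>\<phi> z\<bar> \<le> B" for z using B1[of z] out[of z] by (cases "z \<in> K") (auto simp: B_def)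
    show "\<bar>time_deriv \<phi> z\<bar> \<le> B" for z using B2[of z] out'[of z] by (cases "z \<in> K") (auto simp: B_def)
    show "\<bar>space_deriv \<phi> z\<bar> \<le> B" for z using B3[of z] out'[of z] by (cases "z \<in> K") (auto simp: B_def)
  qed (simp_all add: out out')
qed

lemma test_function_affine:
  assumes "test_function \<phi>" "c \<noteq> 0"
  shows "test_function (\<lambda>z. \<phi> (a + c *\<^sub>R z))"
proof -
  obtain K where K: "compact K" "\<And>z. z \<notin> K \<Longrightarrow> \<phi> z = 0"
    using test_function_bounds[OF assms(1)] by metis
  show ?thesis
  proof (rule test_functionI)
    show "C_k k (\<lambda>z. \<phi> (a + c *\<^sub>R z))" for k
      using assms(1) by (intro C_k_affine) (simp add: test_function_def)
    show "z \<in> (\<lambda>w. (1 / c) *\<^sub>R (w - a)) ` K" if "\<phi> (a + c *\<^sub>R z) \<noteq> 0" for z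
    proof (rule image_eqI[of _ _ "a + c *\<^sub>R z"])
      show "a + c *\<^sub>R z \<in> K" using that K(2) by blast
    qed (use assms(2) in simp)
    have "compact ((\<lambda>w. (1 / c) *\<^sub>R (w - a)) ` K)"
      by (intro compact_continuous_image K(1) continuous_intros)
    then show "bounded ((\<lambda>w. (1 / c) *\<^sub>R (w - a)) ` K)" by (rule compact_imp_bounded)
  qed
qed

section \<open>Integration in the plane\<close>

lemma abs_diff_le_1: "a \<in> {0..1} \<Longrightarrow> b \<in> {0..1} \<Longrightarrow> \<bar>a - b\<bar> \<le> (1::real)"
  by auto

lemma abs_lincomb_le:
  fixes a b x y A C :: real
  assumes "\<bar>a\<bar> \<le> A" "\<bar>b\<bar> \<le> A" "\<bar>x\<bar> \<le> C" "\<bar>y\<bar> \<le> C"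
  shows "\<bar>a * x + b * y\<bar> \<le> A * C + A * C"
proof -
  have "\<bar>a * x\<bar> \<le> A * C" "\<bar>b * y\<bar> \<le> A * C"
    unfolding abs_mult using assms by (auto intro!: mult_mono)
  then show ?thesis by linarith
qed

lemma borel_measurable_binary:
  fixes N :: "real \<Rightarrow> real \<Rightarrow> real"
  assumes "case_prod N \<in> borel_measurable borel"
    and "f \<in> borel_measurable M" "g \<in> borel_measurable M"
  shows "(\<lambda>x. N (f x) (g x)) \<in> borel_measurable M"
  using measurable_compose[OF borel_measurable_Pair[OF assms(2,3)] assms(1)] by simp

lemma borel_measurable_fst_snd_plane [measurable]:
  "fst \<in> borel_measurable (borel :: (real \<times> real) measure)"
  "snd \<in> borel_measurable (borel :: (real \<times> real) measure)"
  by (auto intro!: borel_measurable_continuous_onI continuous_intros)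

lemma bounded_imp_subset_cball_0:
  fixes S :: "'a::real_normed_vector set"
  assumes "bounded S"
  obtains r where "S \<subseteq> cball 0 r" "0 \<le> r"
proof -
  obtain r where "\<And>x. x \<in> S \<Longrightarrow> norm x \<le> r" using assms by (auto simp: bounded_iff)
  then show thesis by (intro that[of "\<bar>r\<bar>"]) (auto simp: subset_eq intro: order_trans[OF _ abs_ge_self])
qed

lemma integrable_indicator_cball:
  "integrable lborel (indicator (cball a r) :: 'a::euclidean_space \<Rightarrow> real)"
  using emeasure_bounded_finite[OF bounded_cball, of a r] by (intro integrable_real_indicator) auto

lemma integrable_bounded_support:
  fixes f :: "'a::euclidean_space \<Rightarrow> real"
  assumes [measurable]: "f \<in> borel_measurable borel" and "bounded S"
    and "\<And>z. \<bar>f z\<bar> \<le> B" and "\<And>z. z \<notin> S \<Longrightarrow> f z = 0"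
  shows "integrable lborel f"
proof -
  obtain r where r: "S \<subseteq> cball 0 r"
    using assms(2) by (auto simp: bounded_iff subset_eq)
  show ?thesis
  proof (rule Bochner_Integration.integrable_bound)
    show "integrable lborel (\<lambda>z. B * indicator (cball 0 r) z :: real)"
      by (intro integrable_mult_right integrable_indicator_cball)
    show "AE z in lborel. norm (f z) \<le> norm (B * indicator (cball 0 r) z :: real)"
    proof (intro AE_I2)
      fix z
      have "0 \<le> B" using assms(3)[of z] by linarith
      then show "norm (f z) \<le> norm (B * indicator (cball 0 r) z :: real)"
        using assms(3,4)[of z] subsetD[OF r, of z] by (auto simp: indicator_def)
    qed
  qed simp
qed

lemma integrable_lebesgue_bounded_support:
  fixes f :: "'a::euclidean_space \<Rightarrow> real"
  assumes [measurable]: "f \<in> borel_measurable lebesgue" and "bounded S"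
    and f: "\<And>z. \<bar>f z\<bar> \<le> B" "\<And>z. z \<notin> S \<Longrightarrow> f z = 0"
  shows "integrable lebesgue f"
proof -
  obtain r where r: "S \<subseteq> cball 0 r" using bounded_imp_subset_cball_0[OF assms(2)] .
  show ?thesis
  proof (rule Bochner_Integration.integrable_bound)
    show "integrable lebesgue (\<lambda>z. B * indicator (cball 0 r) z :: real)"
      by (intro integrable_mult_right 
        iffD2[OF integrable_completion[OF borel_measurable_integrable]] integrable_indicator_cball)
    show "AE z in lebesgue. norm (f z) \<le> norm (B * indicator (cball 0 r) z :: real)"
    proof (intro AE_I2)
      fix z
      have "0 \<le> B" using f(1)[of z] by linarith
      then show "norm (f z) \<le> norm (B * indicator (cball 0 r) z :: real)"
        using f[of z] subsetD[OF r, of z] by (auto simp: indicator_def)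
    qed
  qed simp
qed

lemma integrable_lebesgue_indicator_Icc: "integrable lebesgue (indicator {a..b::real} :: real \<Rightarrow> real)"
proof (rule integrable_lebesgue_bounded_support[of _ "{a..b}" 1])
  have "{a..b} \<in> sets lebesgue" by simp
  then show "(indicator {a..b} :: real \<Rightarrow> real) \<in> borel_measurable lebesgue" by (rule borel_measurable_indicator)
qed (simp_all add: indicator_def)

lemma abs_integral_le_measure_support:
  fixes f :: "real \<Rightarrow> real"
  assumes "f \<in> borel_measurable lebesgue" and f: "\<And>x. \<bar>f x\<bar> \<le> 1" "\<And>x. x \<notin> {a..b} \<Longrightarrow> f x = 0"
  shows "\<bar>\<integral>x. f x \<partial>lebesgue\<bar> \<le> measure lebesgue {a..b}"
proof -
  have int: "integrable lebesgue f"
    by (rule integrable_lebesgue_bounded_support[OF assms(1) bounded_closed_interval f])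
  have "\<bar>\<integral>x. f x \<partial>lebesgue\<bar> \<le> (LINT x|lebesgue. \<bar>f x\<bar>)" by (rule integral_abs_bound)
  also have "\<dots> \<le> (LINT x|lebesgue. indicator {a..b} x)"
  proof (rule integral_mono[OF _ integrable_lebesgue_indicator_Icc])
    show "\<bar>f x\<bar> \<le> indicator {a..b} x" for x using f[of x] by (cases "x \<in> {a..b}") auto
  qed (use int in simp)
  finally show ?thesis by simp
qed

text \<open>
  This is what makes the integrals in the definition of distributional inequalities additive.
\<close>

lemma integrable_test_derivs:
  fixes p q :: "real \<times> real \<Rightarrow> real"
  assumes \<phi>: "test_function \<phi>" and [measurable]: "p \<in> borel_measurable borel" "q \<in> borel_measurable borel"
    and b: "\<And>z. \<bar>p z\<bar> \<le> B" "\<And>z. \<bar>q z\<bar> \<le> B"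
  shows "integrable lborel (\<lambda>z. p z * time_deriv \<phi> z + q z * space_deriv \<phi> z)"
proof -
  obtain K C where K: "compact K" and C: "\<And>z. \<bar>time_deriv \<phi> z\<bar> \<le> C" "\<And>z. \<bar>space_deriv \<phi> z\<bar> \<le> C"
    and out: "\<And>z. z \<notin> K \<Longrightarrow> time_deriv \<phi> z = 0" "\<And>z. z \<notin> K \<Longrightarrow> space_deriv \<phi> z = 0"
    using test_function_bounds[OF \<phi>] by metis
  note [measurable] = borel_measurable_time_deriv[OF \<phi>] borel_measurable_space_deriv[OF \<phi>]
  show ?thesis
    by (rule integrable_bounded_support[OF _ compact_imp_bounded[OF K] abs_lincomb_le[OF b C]])
      (simp_all add: out)
qed

lemma lborel_integral_shift:
  fixes f :: "'a::euclidean_space \<Rightarrow> real"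
  assumes [measurable]: "f \<in> borel_measurable borel"
  shows "(LBINT z. f (a + z)) = (LBINT z. f z)"
proof -
  have "(LBINT z. f z) = (\<integral>z. f z \<partial>distr lborel borel ((+) a))"
    by (simp add: lborel_distr_plus)
  also have "\<dots> = (LBINT z. f (a + z))"
    by (rule integral_distr) auto
  finally show ?thesis by simp
qed

lemma lborel_integral_scale:
  fixes f :: "'a::euclidean_space \<Rightarrow> real"
  assumes [measurable]: "f \<in> borel_measurable borel" and "c \<noteq> 0"
  shows "(LBINT z. f z) = \<bar>c\<bar> ^ DIM('a) * (LBINT z. f (a + c *\<^sub>R z))"
proof -
  have "(LBINT z. f z) = (\<integral>z. f z \<partial>density (distr lborel borel (\<lambda>x. a + c *\<^sub>R x)) (\<lambda>_. ennreal (\<bar>c\<bar> ^ DIM('a))))"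
    using lborel_affine[OF assms(2), of a] by (simp add: ennreal_power)
  also have "\<dots> = (\<integral>z. \<bar>c\<bar> ^ DIM('a) *\<^sub>R f z \<partial>distr lborel borel (\<lambda>x. a + c *\<^sub>R x))"
    by (rule integral_density) auto
  also have "\<dots> = (LBINT z. \<bar>c\<bar> ^ DIM('a) * f (a + c *\<^sub>R z))"
    by (subst integral_distr) auto
  finally show ?thesis by simp
qed

lemma AE_lborel_shift:
  assumes "AE z in lborel. P (z :: 'a::euclidean_space)"
  shows "AE z in lborel. P (a + z)"
proof -
  have "AE z in distr lborel borel ((+) a). P z" using assms unfolding lborel_distr_plus .
  then show ?thesis by (rule AE_distrD[rotated]) simp
qed

lemma borel_measurable_lebesgue_shift:
  assumes "f \<in> borel_measurable lebesgue"
  shows "(\<lambda>x. f (x + h :: real)) \<in> borel_measurable lebesgue"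
proof -
  have "(\<lambda>x. h + (\<Sum>j\<in>Basis. (1 * (x \<bullet> j)) *\<^sub>R j)) \<in> lebesgue \<rightarrow>\<^sub>M lebesgue" for h :: real
    by (rule lebesgue_affine_measurable) auto
  then have "(+) h \<in> lebesgue \<rightarrow>\<^sub>M lebesgue" by simp
  moreover have "(+) h = (\<lambda>x. x + h)" by (auto simp: add.commute)
  ultimately have "(\<lambda>x. x + h) \<in> lebesgue \<rightarrow>\<^sub>M lebesgue" by simp
  then show ?thesis using measurable_compose assms by blast
qed

lemma lebesgue_integral_shift:
  fixes f :: "real \<Rightarrow> real"
  assumes f: "f \<in> borel_measurable lebesgue"
  shows "(LINT x|lebesgue. f (x + h)) = (LINT x|lebesgue. f x)"
proof -
  obtain g where g: "g \<in> borel_measurable lborel" and ae: "AE x in lborel. f x = g x"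
    using completion_ex_borel_measurable_real[OF f] by blast
  have [measurable]: "g \<in> borel_measurable borel" using g by simp
  have eq: "(LINT x|lebesgue. p x) = (LBINT x. q x)"
    if "p \<in> borel_measurable lebesgue" "q \<in> borel_measurable borel" "AE x in lborel. p x = q x" for p q :: "real \<Rightarrow> real"
  proof -
    have "(LINT x|lebesgue. p x) = (LINT x|lebesgue. q x)"
      using that by (intro integral_cong_AE AE_completion) (auto intro: measurable_completion)
    then show ?thesis using that(2) by (simp add: integral_completion)
  qed
  have "AE x in lborel. f (x + h) = g (h + x)" using AE_lborel_shift[OF ae, of h] by (simp add: add.commute)
  then have "(LINT x|lebesgue. f (x + h)) = (LBINT x. g (h + x))"
    by (intro eq borel_measurable_lebesgue_shift f) auto
  also have "\<dots> = (LBINT x. g x)" by (rule lborel_integral_shift) simp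
  also have "\<dots> = (LINT x|lebesgue. f x)" by (rule eq[OF f _ ae, symmetric]) simp
  finally show ?thesis .
qed

text \<open>
  A measurable function is an almost everywhere limit of continuous functions, which may be clamped to
  \<open>[0, 1]\<close> and then converge in \<open>L\<^sup>1\<close> on balls. For a continuous function the claim is dominated
  convergence; the approximation error enters twice, once translated, and the slightly larger ball
  \<open>S\<close> takes up the translation.
\<close>

lemma translation_continuous_L1_loc:
  fixes g :: "'a::euclidean_space \<Rightarrow> real"
  assumes g[measurable]: "g \<in> borel_measurable borel" and range: "\<And>z. 0 \<le> g z" "\<And>z. g z \<le> 1"
    and h: "h \<longlonglongrightarrow> 0" "\<And>n. norm (h n) \<le> d"
  shows "(\<lambda>n. \<integral>z. indicator (cball 0 r) z * \<bar>g (h n + z) - g z\<bar> \<partial>lborel) \<longlonglongrightarrow> 0"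
proof -
  have unit: "\<bar>a - b\<bar> \<le> 1" if "0 \<le> a" "a \<le> 1" "0 \<le> b" "b \<le> 1" for a b :: real
    using that by auto
  define S where "S = cball (0::'a) (r + d)"
  define I where "I f = (LBINT z. indicator (cball 0 r) z * f z)" for f :: "'a \<Rightarrow> real"
  have [measurable]: "S \<in> sets borel" by (simp add: S_def)
  have [measurable]: "cball a \<rho> \<in> sets borel" for a :: 'a and \<rho> by simp
  have int: "integrable lborel (\<lambda>z. indicator (cball a \<rho>) z * f z)"
    if [measurable]: "f \<in> borel_measurable borel" and "\<And>z. \<bar>f z\<bar> \<le> 2" for a \<rho> and f :: "'a \<Rightarrow> real"
    by (rule integrable_bounded_support[of _ "cball a \<rho>" 2]) (use that in \<open>auto simp: indicator_def\<close>)
  have "g measurable_on UNIV"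
    using range by (intro lebesgue_measurable_imp_measurable_on_nnreal_UNIV) (auto intro: measurable_completion)
  then obtain N G where N: "negligible N" and G: "\<And>k. continuous_on UNIV (G k)"
    and lim: "\<And>x. x \<notin> N \<Longrightarrow> (\<lambda>k. G k x) \<longlonglongrightarrow> g x"
    unfolding measurable_on_def by auto
  define c where "c k z = max 0 (min 1 (G k z))" for k z
  have c: "continuous_on UNIV (c k)" "0 \<le> c k z" "c k z \<le> 1" for k z
    using G unfolding c_def by (auto intro!: continuous_intros)
  have [measurable]: "c k \<in> borel_measurable borel" for k
    using c(1) by (rule borel_measurable_continuous_onI)
  have [measurable]: "(\<lambda>z. c k (a + z)) \<in> borel_measurable borel" for k a
    by (rule measurable_compose[of "\<lambda>z. a + z" borel borel]) auto
  have [measurable]: "(\<lambda>z. g (a + z)) \<in> borel_measurable borel" for a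
    by (rule measurable_compose[of "\<lambda>z. a + z" borel borel]) auto
  have "AE z in lebesgue. z \<notin> N" using N by (intro AE_not_in) (simp add: negligible_iff_null_sets)
  then have "AE z in lborel. z \<notin> N" by (simp add: AE_completion_iff)
  then have clim: "AE z in lborel. (\<lambda>k. c k z) \<longlonglongrightarrow> g z"
  proof eventually_elim
    case (elim z)
    have "(\<lambda>k. c k z) \<longlonglongrightarrow> max 0 (min 1 (g z))"
      unfolding c_def by (intro tendsto_max tendsto_min tendsto_const lim elim)
    then show ?case using range[of z] by simp
  qed
  have approx: "(\<lambda>k. \<integral>z. indicator S z * \<bar>c k z - g z\<bar> \<partial>lborel) \<longlonglongrightarrow> (\<integral>z. 0 \<partial>(lborel::'a measure))"
  proof (rule integral_dominated_convergence[where w = "indicator S"])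
    show "integrable lborel (indicator S :: 'a \<Rightarrow> real)"
      unfolding S_def by (rule integrable_indicator_cball)
    show "AE z in lborel. (\<lambda>k. indicator S z * \<bar>c k z - g z\<bar>) \<longlonglongrightarrow> 0"
      using clim
    proof eventually_elim
      case (elim z)
      have "(\<lambda>k. indicator S z * \<bar>c k z - g z\<bar>) \<longlonglongrightarrow> indicator S z * \<bar>g z - g z\<bar>"
        by (intro tendsto_intros elim)
      then show ?case by simp
    qed
    show "AE z in lborel. norm (indicator S z * \<bar>c k z - g z\<bar>) \<le> indicator S z" for k
      by (intro AE_I2) (auto simp: indicator_def intro!: unit c range)
  qed auto
  have cont: "(\<lambda>n. I (\<lambda>z. \<bar>c k (h n + z) - c k z\<bar>)) \<longlonglongrightarrow> (\<integral>z. 0 \<partial>(lborel::'a measure))" for k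
    unfolding I_def
  proof (rule integral_dominated_convergence[where w = "indicator (cball 0 r)"])
    show "integrable lborel (indicator (cball 0 r) :: 'a \<Rightarrow> real)"
      by (rule integrable_indicator_cball)
    show "AE z in lborel. (\<lambda>n. indicator (cball 0 r) z * \<bar>c k (h n + z) - c k z\<bar>) \<longlonglongrightarrow> 0"
    proof (intro AE_I2)
      fix z
      have "isCont (c k) (0 + z)" using c(1) by (simp add: continuous_on_eq_continuous_at)
      then have "(\<lambda>n. c k (h n + z)) \<longlonglongrightarrow> c k (0 + z)"
        by (rule isCont_tendsto_compose) (intro tendsto_intros h)
      then have "(\<lambda>n. indicator (cball 0 r) z * \<bar>c k (h n + z) - c k z\<bar>) \<longlonglongrightarrow> indicator (cball 0 r) z * \<bar>c k (0 + z) - c k z\<bar>"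
        by (intro tendsto_intros)
      then show "(\<lambda>n. indicator (cball 0 r) z * \<bar>c k (h n + z) - c k z\<bar>) \<longlonglongrightarrow> 0" by simp
    qed
    show "AE z in lborel. norm (indicator (cball 0 r) z * \<bar>c k (h n + z) - c k z\<bar>) \<le> indicator (cball 0 r) z" for n
      by (intro AE_I2) (auto simp: indicator_def intro!: unit c)
  qed auto
  have range2: "\<bar>g x - c k z\<bar> \<le> 2" "\<bar>c k z - g x\<bar> \<le> 2" "\<bar>c k x - c k z\<bar> \<le> 2" "\<bar>g x - g z\<bar> \<le> 2" for k x z
    using c(2,3)[of k x] c(2,3)[of k z] range[of x] range[of z] by auto
  \<comment> \<open>Triangle inequality through the translate of \<open>c k\<close> and \<open>c k\<close> itself.\<close>
  have key: "I (\<lambda>z. \<bar>g (h n + z) - g z\<bar>) \<le> 2 * (LBINT z. indicator S z * \<bar>c k z - g z\<bar>) + I (\<lambda>z. \<bar>c k (h n + z) - c k z\<bar>)" for n k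
  proof -
    have "0 \<le> d" using h(2)[of 0] norm_ge_zero order_trans by blast
    have "I (\<lambda>z. \<bar>g (h n + z) - g z\<bar>) \<le> (LBINT z. indicator (cball 0 r) z * \<bar>c k (h n + z) - g (h n + z)\<bar>
        + indicator (cball 0 r) z * \<bar>c k (h n + z) - c k z\<bar> + indicator (cball 0 r) z * \<bar>c k z - g z\<bar>)"
      unfolding I_def
      by (intro integral_mono Bochner_Integration.integrable_add int) (simp_all add: range2 indicator_def, arith?)
    also have "\<dots> = (LBINT z. indicator (cball 0 r) z * \<bar>c k (h n + z) - g (h n + z)\<bar>)
        + I (\<lambda>z. \<bar>c k (h n + z) - c k z\<bar>) + (LBINT z. indicator (cball 0 r) z * \<bar>c k z - g z\<bar>)"
      unfolding I_def by (simp add: int range2)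
    also have "(LBINT z. indicator (cball 0 r) z * \<bar>c k z - g z\<bar>) \<le> (LBINT z. indicator S z * \<bar>c k z - g z\<bar>)"
      unfolding S_def using \<open>0 \<le> d\<close>
      by (intro integral_mono int) (simp_all add: range2 indicator_def)
    also have "(LBINT z. indicator (cball 0 r) z * \<bar>c k (h n + z) - g (h n + z)\<bar>)
        \<le> (LBINT z. indicator S (h n + z) * \<bar>c k (h n + z) - g (h n + z)\<bar>)"
    proof (intro integral_mono)
      show "integrable lborel (\<lambda>z. indicator S (h n + z) * \<bar>c k (h n + z) - g (h n + z)\<bar>)"
      proof (rule integrable_bounded_support[of _ "cball 0 (r + d + norm (h n))" 2])
        show "indicator S (h n + z) * \<bar>c k (h n + z) - g (h n + z)\<bar> = 0"
          if "z \<notin> cball 0 (r + d + norm (h n))" for z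
          using norm_triangle_ineq4[of "h n + z" "h n"] that by (auto simp: S_def indicator_def)
      qed (simp_all add: indicator_def range2)
      show "indicator (cball 0 r) z * \<bar>c k (h n + z) - g (h n + z)\<bar> \<le> indicator S (h n + z) * \<bar>c k (h n + z) - g (h n + z)\<bar>" for z
        using norm_triangle_ineq[of "h n" z] h(2)[of n] by (auto simp: indicator_def S_def)
    qed (simp add: int range2)
    also have "\<dots> = (LBINT z. indicator S z * \<bar>c k z - g z\<bar>)"
      by (rule lborel_integral_shift[of "\<lambda>z. indicator S z * \<bar>c k z - g z\<bar>"]) simp
    finally show ?thesis by simp
  qed
  have nn: "0 \<le> I (\<lambda>z. \<bar>g (h n + z) - g z\<bar>)" for n
    unfolding I_def by (intro Bochner_Integration.integral_nonneg) auto
  have "I (\<lambda>z. \<bar>g (h n + z) - g z\<bar>) = (LBINT z. indicator (cball 0 r) z * \<bar>g (h n + z) - g z\<bar>)" for n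
    by (simp add: I_def)
  moreover have "(\<lambda>n. I (\<lambda>z. \<bar>g (h n + z) - g z\<bar>)) \<longlonglongrightarrow> 0"
  proof (rule LIMSEQ_I)
    fix e :: real assume "0 < e"
    then obtain k where k: "(LBINT z. indicator S z * \<bar>c k z - g z\<bar>) < e / 4"
      using order_tendstoD(2)[OF approx, of "e / 4"] by (auto simp: eventually_sequentially)
    obtain n0 where n0: "\<And>n. n \<ge> n0 \<Longrightarrow> I (\<lambda>z. \<bar>c k (h n + z) - c k z\<bar>) < e / 2"
      using order_tendstoD(2)[OF cont[of k], of "e / 2"] \<open>0 < e\<close> by (auto simp: eventually_sequentially)
    have "norm (I (\<lambda>z. \<bar>g (h n + z) - g z\<bar>) - 0) < e" if "n \<ge> n0" for n
      using key[of n k] k n0[OF that] nn[of n] by simp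
    then show "\<exists>no. \<forall>n\<ge>no. norm (I (\<lambda>z. \<bar>g (h n + z) - g z\<bar>) - 0) < e" by blast
  qed
  ultimately show ?thesis by simp
qed

text \<open>
  The open intervals generate the Borel sets and are stable under intersection, so the measures with
  densities \<open>f\<close> and \<open>g\<close> coincide, and densities are unique almost everywhere.
\<close>

lemma AE_eq_if_integrals_on_intervals_eq:
  fixes f g :: "real \<Rightarrow> real"
  assumes [measurable]: "f \<in> borel_measurable borel" "g \<in> borel_measurable borel"
    and fr: "\<And>x. f x \<in> {0..1}" and gr: "\<And>x. g x \<in> {0..1}"
    and eq: "\<And>a b. a < b \<Longrightarrow> (LBINT x. f x * indicator {a<..<b} x) = (LBINT x. g x * indicator {a<..<b} x)"
  shows "AE x in lborel. f x = g x"
proof -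
  have em: "emeasure (density lborel (\<lambda>x. ennreal (f x))) {a<..<b} = ennreal (LBINT x. f x * indicator {a<..<b} x)"
    if [measurable]: "f \<in> borel_measurable borel" and r: "\<And>x. f x \<in> {0..1}" for f :: "real \<Rightarrow> real" and a b
  proof -
    have "integrable lborel (\<lambda>x. f x * indicator {a<..<b} x)"
      by (rule integrable_bounded_support[of _ "{a<..<b}" 1]) (use r in \<open>auto simp: indicator_def\<close>)
    then have "ennreal (LBINT x. f x * indicator {a<..<b} x) = (\<integral>\<^sup>+x. ennreal (f x * indicator {a<..<b} x) \<partial>lborel)"
      using r by (intro nn_integral_eq_integral[symmetric]) auto
    also have "\<dots> = (\<integral>\<^sup>+x. ennreal (f x) * indicator {a<..<b} x \<partial>lborel)"
      by (intro nn_integral_cong) (simp add: indicator_def)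
    finally show ?thesis by (simp add: emeasure_density)
  qed
  have "density lborel (\<lambda>x. ennreal (f x)) = density lborel (\<lambda>x. ennreal (g x))"
  proof (rule measure_eqI_generator_eq)
    let ?E = "range (\<lambda>(a, b). box a b :: real set)"
    show "Int_stable ?E" by (auto simp: Int_stable_def box_Int_box)
    show "sets (density lborel (\<lambda>x. ennreal (f x))) = sigma_sets UNIV ?E"
      "sets (density lborel (\<lambda>x. ennreal (g x))) = sigma_sets UNIV ?E"
      by (simp_all add: borel_eq_box)
    let ?A = "\<lambda>n::nat. box (- real n) (real n)"
    show "range ?A \<subseteq> ?E" by auto
    show "(\<Union>i. ?A i) = UNIV"
    proof (intro set_eqI iffI UNIV_I)
      fix x :: real
      obtain n where "\<bar>x\<bar> < real n" using reals_Archimedean2 by blast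
      then show "x \<in> (\<Union>i. ?A i)" by (intro UN_I[of n]) auto
    qed
    show "emeasure (density lborel (\<lambda>x. ennreal (f x))) (?A i) \<noteq> \<infinity>" for i
      using em[of f] fr by (simp add: box_real)
    show "emeasure (density lborel (\<lambda>x. ennreal (f x))) X = emeasure (density lborel (\<lambda>x. ennreal (g x))) X" if "X \<in> ?E" for X
    proof -
      obtain p where "X = (case p of (a, b) \<Rightarrow> box a b)" using \<open>X \<in> ?E\<close> by blast
      then obtain a b where X: "X = {a<..<b}" by (simp add: split_beta)
      show ?thesis
        by (cases "a < b") (simp_all add: X em fr gr eq del: atLeastAtMost_iff)
    qed
  qed auto
  then have "AE x in lborel. ennreal (f x) = ennreal (g x)" by (rule sigma_finite_measure.density_unique[OF lborel.sigma_finite_measure_axioms, rotated 2]) auto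
  then show ?thesis using fr gr by (elim AE_mp) (auto simp: ennreal_inj)
qed

section \<open>Distributional inequalities\<close>

text \<open>
  The inequality \<open>\<partial>\<^sub>t a + \<partial>\<^sub>x b \<le> 0\<close> in the sense of distributions on the half-plane \<open>t > 0\<close>. Test
  functions vanish for \<open>t \<le> 0\<close>, so that neither the initial datum nor values at negative times
  enter.
\<close>

definition dissipates :: "(real \<times> real \<Rightarrow> real) \<Rightarrow> (real \<times> real \<Rightarrow> real) \<Rightarrow> bool" where
  "dissipates a b \<longleftrightarrow>
    (\<forall>\<phi>. test_function \<phi> \<and> (\<forall>z. 0 \<le> \<phi> z) \<and> (\<forall>z. fst z \<le> 0 \<longrightarrow> \<phi> z = 0) \<longrightarrow>
      0 \<le> (LBINT z. a z * time_deriv \<phi> z + b z * space_deriv \<phi> z))"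

lemma dissipatesI:
  assumes "\<And>\<phi>. test_function \<phi> \<Longrightarrow> (\<And>z. 0 \<le> \<phi> z) \<Longrightarrow> (\<And>z. fst z \<le> 0 \<Longrightarrow> \<phi> z = 0)
    \<Longrightarrow> 0 \<le> (LBINT z. a z * time_deriv \<phi> z + b z * space_deriv \<phi> z)"
  shows "dissipates a b"
  using assms unfolding dissipates_def by blast

lemma dissipatesD:
  assumes "dissipates a b" "test_function \<phi>" "\<And>z. 0 \<le> \<phi> z" "\<And>z. fst z \<le> 0 \<Longrightarrow> \<phi> z = 0"
  shows "0 \<le> (LBINT z. a z * time_deriv \<phi> z + b z * space_deriv \<phi> z)"
  using assms unfolding dissipates_def by blast

lemma dissipates_add:
  assumes "dissipates a b" "dissipates a' b'"
    and [measurable]: "a \<in> borel_measurable borel" "b \<in> borel_measurable borel" "a' \<in> borel_measurable borel" "b' \<in> borel_measurable borel"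
    and bnd: "\<And>z. \<bar>a z\<bar> \<le> B" "\<And>z. \<bar>b z\<bar> \<le> B" "\<And>z. \<bar>a' z\<bar> \<le> B" "\<And>z. \<bar>b' z\<bar> \<le> B"
  shows "dissipates (\<lambda>z. a z + a' z) (\<lambda>z. b z + b' z)"
proof (rule dissipatesI)
  fix \<phi> assume \<phi>: "test_function \<phi>" and nn: "\<And>z. 0 \<le> \<phi> z" and past: "\<And>z. fst z \<le> 0 \<Longrightarrow> \<phi> z = (0::real)"
  have "(LBINT z. (a z + a' z) * time_deriv \<phi> z + (b z + b' z) * space_deriv \<phi> z)
    = (LBINT z. (a z * time_deriv \<phi> z + b z * space_deriv \<phi> z) + (a' z * time_deriv \<phi> z + b' z * space_deriv \<phi> z))"
    by (simp add: algebra_simps)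
  also have "\<dots> = (LBINT z. a z * time_deriv \<phi> z + b z * space_deriv \<phi> z) + (LBINT z. a' z * time_deriv \<phi> z + b' z * space_deriv \<phi> z)"
    by (intro Bochner_Integration.integral_add integrable_test_derivs[OF \<phi>, where B = B]) (simp_all add: bnd)
  finally show "0 \<le> (LBINT z. (a z + a' z) * time_deriv \<phi> z + (b z + b' z) * space_deriv \<phi> z)"
    using dissipatesD[OF assms(1) \<phi> nn past] dissipatesD[OF assms(2) \<phi> nn past] by simp
qed

lemma dissipates_scale:
  assumes "dissipates a b" "0 \<le> k"
  shows "dissipates (\<lambda>z. k * a z) (\<lambda>z. k * b z)"
proof (rule dissipatesI)
  fix \<phi> assume \<phi>: "test_function \<phi>" and nn: "\<And>z. 0 \<le> \<phi> z" and past: "\<And>z. fst z \<le> 0 \<Longrightarrow> \<phi> z = (0::real)"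
  have "(LBINT z. k * a z * time_deriv \<phi> z + k * b z * space_deriv \<phi> z)
     = (LBINT z. k * (a z * time_deriv \<phi> z + b z * space_deriv \<phi> z))" by (simp add: algebra_simps)
  also have "\<dots> = k * (LBINT z. a z * time_deriv \<phi> z + b z * space_deriv \<phi> z)" by simp
  finally show "0 \<le> (LBINT z. k * a z * time_deriv \<phi> z + k * b z * space_deriv \<phi> z)"
    using dissipatesD[OF assms(1) \<phi> nn past] assms(2) by simp
qed

lemma dissipates_shift:
  assumes "dissipates a b" and [measurable]: "a \<in> borel_measurable borel" "b \<in> borel_measurable borel"
  shows "dissipates (\<lambda>z. a ((0, h) + z)) (\<lambda>z. b ((0, h) + z))"
proof (rule dissipatesI)
  fix \<phi> assume \<phi>: "test_function \<phi>" and nn: "\<And>z. 0 \<le> \<phi> z" and past: "\<And>z. fst z \<le> 0 \<Longrightarrow> \<phi> z = (0::real)"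
  let ?\<phi> = "\<lambda>z. \<phi> ((0, - h) + 1 *\<^sub>R z)"
  note [measurable] = borel_measurable_time_deriv[OF \<phi>] borel_measurable_space_deriv[OF \<phi>]
  have t: "test_function ?\<phi>" by (rule test_function_affine[OF \<phi>]) simp
  have "0 \<le> (LBINT z. a z * time_deriv ?\<phi> z + b z * space_deriv ?\<phi> z)"
    by (rule dissipatesD[OF assms(1) t]) (use nn past in auto)
  also have "\<dots> = (LBINT z. a z * time_deriv \<phi> ((0, - h) + z) + b z * space_deriv \<phi> ((0, - h) + z))"
    by (simp only: time_deriv_affine[OF test_function_differentiable[OF \<phi>]] space_deriv_affine[OF test_function_differentiable[OF \<phi>]]) simp
  also have "\<dots> = (LBINT z. a ((0, h) + z) * time_deriv \<phi> ((0, - h) + ((0, h) + z)) + b ((0, h) + z) * space_deriv \<phi> ((0, - h) + ((0, h) + z)))"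
    by (rule lborel_integral_shift[symmetric]) measurable
  also have "\<dots> = (LBINT z. a ((0, h) + z) * time_deriv \<phi> z + b ((0, h) + z) * space_deriv \<phi> z)"
    by (intro Bochner_Integration.integral_cong) auto
  finally show "0 \<le> (LBINT z. a ((0, h) + z) * time_deriv \<phi> z + b ((0, h) + z) * space_deriv \<phi> z)" .
qed

text \<open>
  A function that increases in direction \<open>d\<close> has a nonnegative derivative in that direction. The
  increase is only known almost everywhere for each separate step length, so the derivative is put on
  \<open>\<phi>\<close> as a limit of difference quotients, and the discrete integration by parts is the translation
  invariance of Lebesgue measure.
\<close>

lemma integral_increasing_times_derivative_nonpos:
  fixes g \<phi> D :: "'a::euclidean_space \<Rightarrow> real"
  assumes [measurable]: "g \<in> borel_measurable borel" "\<phi> \<in> borel_measurable borel" "D \<in> borel_measurable borel"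
    and g: "\<And>z. \<bar>g z\<bar> \<le> B"
    and incr: "\<And>h. 0 < h \<Longrightarrow> AE z in lborel. g z \<le> g (h *\<^sub>R d + z)"
    and nonneg: "\<And>z. 0 \<le> \<phi> z" and supp: "bounded K" "\<And>z. z \<notin> K \<Longrightarrow> \<phi> z = 0"
    and bounds: "\<And>z. \<bar>\<phi> z\<bar> \<le> C" "\<And>z. \<bar>D z\<bar> \<le> C"
    and deriv: "\<And>z h. ((\<lambda>h. \<phi> (h *\<^sub>R d + z)) has_real_derivative D (h *\<^sub>R d + z)) (at h)"
  shows "(LBINT z. g z * D z) \<le> 0"
proof -
  \<comment> \<open>Step lengths tending to \<open>0\<close>, and the backward difference quotients of \<open>\<phi>\<close> along them.\<close>
  define h where "h n = inverse (real (Suc n))" for n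
  have h: "0 < h n" "h n \<le> 1" for n by (auto simp: h_def field_simps)
  have h0: "h \<longlonglongrightarrow> 0" unfolding h_def by (rule LIMSEQ_inverse_real_of_nat)
  obtain r where r: "\<And>z. z \<in> K \<Longrightarrow> norm z \<le> r" using supp(1) by (auto simp: bounded_iff)
  define S where "S = cball (0::'a) (r + norm d)"
  have C: "0 \<le> C" "0 \<le> B" using bounds(1)[of 0] g[of 0] by auto
  define q where "q n z = (\<phi> z - \<phi> (- h n *\<^sub>R d + z)) / h n" for n z
  have [measurable]: "q n \<in> borel_measurable borel" for n unfolding q_def by measurable
  have qS: "q n z = 0" if "z \<notin> S" for n z
  proof -
    have "z \<notin> K" using that r[of z] norm_ge_zero[of d] by (auto simp: S_def)
    moreover have "- h n *\<^sub>R d + z \<notin> K"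
    proof
      assume "- h n *\<^sub>R d + z \<in> K"
      then have "norm (- h n *\<^sub>R d + z) \<le> r" by (rule r)
      moreover have "norm z \<le> norm (- h n *\<^sub>R d + z) + norm (h n *\<^sub>R d)"
        using norm_triangle_ineq[of "- h n *\<^sub>R d + z" "h n *\<^sub>R d"] by simp
      moreover have "norm (h n *\<^sub>R d) \<le> norm d" using h[of n] by (simp add: mult_left_le_one_le)
      ultimately show False using that by (simp add: S_def)
    qed
    ultimately show ?thesis using supp(2) by (simp add: q_def)
  qed
  \<comment> \<open>By the mean value theorem the quotients inherit the bound on the derivative.\<close>
  have qb: "\<bar>q n z\<bar> \<le> C" for n z
  proof -
    have "\<exists>\<xi>. - h n < \<xi> \<and> \<xi> < 0 \<and> \<phi> (0 *\<^sub>R d + z) - \<phi> (- h n *\<^sub>R d + z) = (0 - (- h n)) * D (\<xi> *\<^sub>R d + z)"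
      using h(1)[of n] deriv by (intro MVT2) auto
    then obtain \<xi> where "\<phi> z - \<phi> (- h n *\<^sub>R d + z) = h n * D (\<xi> *\<^sub>R d + z)" by auto
    then have "q n z = D (\<xi> *\<^sub>R d + z)" using h(1)[of n] by (simp add: q_def)
    then show ?thesis using bounds(2) by simp
  qed
  have qlim: "(\<lambda>n. q n z) \<longlonglongrightarrow> D z" for z
  proof -
    have "((\<lambda>k. (\<phi> (k *\<^sub>R d + z) - \<phi> z) / k) \<longlongrightarrow> D z) (at 0)"
      using deriv[of z 0] by (simp add: DERIV_def)
    moreover have "filterlim (\<lambda>n. - h n) (at 0) sequentially"
      unfolding filterlim_at using h h0 tendsto_minus[OF h0] by (auto simp: less_imp_neq[OF h(1), symmetric])
    ultimately have "((\<lambda>n. (\<phi> (- h n *\<^sub>R d + z) - \<phi> z) / (- h n)) \<longlongrightarrow> D z) sequentially"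
      by (rule filterlim_compose)
    then show ?thesis by (simp add: q_def divide_simps algebra_simps minus_divide_left)
  qed
  have intS: "integrable lborel (\<lambda>z. B * C * indicator S z)"
    unfolding S_def by (intro integrable_mult_right integrable_indicator_cball)
  have lim: "(\<lambda>n. \<integral>z. g z * q n z \<partial>lborel) \<longlonglongrightarrow> (LBINT z. g z * D z)"
  proof (rule integral_dominated_convergence[OF _ _ intS])
    show "AE z in lborel. (\<lambda>n. g z * q n z) \<longlonglongrightarrow> g z * D z"
      using qlim by (intro AE_I2 tendsto_mult tendsto_const)
    show "AE z in lborel. norm (g z * q n z) \<le> B * C * indicator S z" for n
      using qS[of _ n] qb[of n] g C by (intro AE_I2) (auto simp: indicator_def abs_mult mult_mono)
  qed auto
  have int: "integrable lborel (\<lambda>z. f z * \<phi> z)" if [measurable]: "f \<in> borel_measurable borel" and "\<And>z. \<bar>f z\<bar> \<le> B" for f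
    by (rule integrable_bounded_support[OF _ supp(1), of _ "B * C"])
      (use that C bounds supp in \<open>auto simp: abs_mult mult_mono\<close>)
  have "(LBINT z. g z * q n z) \<le> 0" for n
  proof -
    have i2: "integrable lborel (\<lambda>z. g z * \<phi> (- h n *\<^sub>R d + z))"
    proof (rule integrable_bounded_support[of _ S "B * C"])
      show "g z * \<phi> (- h n *\<^sub>R d + z) = 0" if "z \<notin> S" for z
      proof -
        have "z \<notin> K" using that r[of z] norm_ge_zero[of d] by (auto simp: S_def)
        then show ?thesis using qS[OF that, of n] h(1)[of n] supp(2) by (simp add: q_def)
      qed
    qed (use C g bounds in \<open>auto simp: abs_mult mult_mono S_def\<close>)
    have "(LBINT z. g z * q n z) = (LBINT z. (g z * \<phi> z - g z * \<phi> (- h n *\<^sub>R d + z)) / h n)"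
      by (simp add: q_def algebra_simps)
    also have "\<dots> = ((LBINT z. g z * \<phi> z) - (LBINT z. g z * \<phi> (- h n *\<^sub>R d + z))) / h n"
      using int[of g] g i2 by simp
    also have "(LBINT z. g z * \<phi> (- h n *\<^sub>R d + z)) = (LBINT z. g (h n *\<^sub>R d + z) * \<phi> z)"
      using lborel_integral_shift[of "\<lambda>z. g z * \<phi> (- h n *\<^sub>R d + z)" "h n *\<^sub>R d"] by simp
    also have "(LBINT z. g z * \<phi> z) \<le> (LBINT z. g (h n *\<^sub>R d + z) * \<phi> z)"
      using incr[OF h(1)[of n]] nonneg g by (intro integral_mono_AE int) (auto intro: mult_right_mono)
    finally show ?thesis using h(1)[of n] by (simp add: divide_right_mono field_simps)
  qed
  then show ?thesis using lim LIMSEQ_le_const2 by blast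
qed

lemma integral_increasing_times_space_deriv_nonpos:
  fixes g :: "real \<times> real \<Rightarrow> real"
  assumes "test_function \<phi>" "\<And>z. 0 \<le> \<phi> z"
    and "g \<in> borel_measurable borel" and "\<And>z. \<bar>g z\<bar> \<le> B"
    and "\<And>h. 0 < h \<Longrightarrow> AE z in lborel. g z \<le> g ((0, h) + z)"
  shows "(LBINT z. g z * space_deriv \<phi> z) \<le> 0"
proof -
  obtain K C where K: "compact K" and b: "\<And>z. \<bar>\<phi> z\<bar> \<le> C" "\<And>z. \<bar>space_deriv \<phi> z\<bar> \<le> C"
    "\<And>z. z \<notin> K \<Longrightarrow> \<phi> z = 0"
    using test_function_bounds[OF assms(1)] by metis
  note [measurable] = borel_measurable_test_function[OF assms(1)] borel_measurable_space_deriv[OF assms(1)]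
  show ?thesis
  proof (rule integral_increasing_times_derivative_nonpos[where d = "(0, 1)", OF assms(3) _ _ assms(4) _ assms(2) compact_imp_bounded[OF K] b(3) b(1,2)])
    show "((\<lambda>h. \<phi> (h *\<^sub>R (0, 1) + z)) has_real_derivative space_deriv \<phi> (h *\<^sub>R (0, 1) + z)) (at h)" for z h
    proof -
      have "((\<lambda>y. \<phi> (fst z, y)) has_real_derivative space_deriv \<phi> (fst z, h + snd z)) (at (h + snd z))"
        using has_space_deriv[OF test_function_differentiable[OF assms(1)], of "(fst z, h + snd z)"] by simp
      then have "((\<lambda>h. \<phi> (fst z, h + snd z)) has_real_derivative space_deriv \<phi> (fst z, h + snd z)) (at h)"
        by (simp add: DERIV_shift)
      then show ?thesis by (cases z) simp
    qed
  qed (use assms(5) in auto)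
qed

lemma integral_time_deriv_nonpos:
  assumes "test_function \<phi>" "\<And>z. 0 \<le> \<phi> z"
  shows "(LBINT z. c * time_deriv \<phi> z) \<le> 0"
proof -
  obtain K C where K: "compact K" and b: "\<And>z. \<bar>\<phi> z\<bar> \<le> C" "\<And>z. \<bar>time_deriv \<phi> z\<bar> \<le> C"
    "\<And>z. z \<notin> K \<Longrightarrow> \<phi> z = 0"
    using test_function_bounds[OF assms(1)] by metis
  note [measurable] = borel_measurable_test_function[OF assms(1)] borel_measurable_time_deriv[OF assms(1)]
  show ?thesis
  proof (rule integral_increasing_times_derivative_nonpos[where d = "(1, 0)" and g = "\<lambda>_. c" and B = "\<bar>c\<bar>", OF _ _ _ _ _ assms(2) compact_imp_bounded[OF K] b(3) b(1,2)])
    show "((\<lambda>h. \<phi> (h *\<^sub>R (1, 0) + z)) has_real_derivative time_deriv \<phi> (h *\<^sub>R (1, 0) + z)) (at h)" for z h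
    proof -
      have "((\<lambda>y. \<phi> (y, snd z)) has_real_derivative time_deriv \<phi> (h + fst z, snd z)) (at (h + fst z))"
        using has_time_deriv[OF test_function_differentiable[OF assms(1)], of "(h + fst z, snd z)"] by simp
      then have "((\<lambda>h. \<phi> (h + fst z, snd z)) has_real_derivative time_deriv \<phi> (h + fst z, snd z)) (at h)"
        by (simp add: DERIV_shift)
      then show ?thesis by (cases z) simp
    qed
  qed auto
qed

text \<open>
  Both signs of a constant are increasing functions.
\<close>

lemma
  assumes "test_function \<phi>" "\<And>z. 0 \<le> \<phi> z"
  shows integral_time_deriv: "(LBINT z. time_deriv \<phi> z) = 0"
    and integral_space_deriv: "(LBINT z. space_deriv \<phi> z) = 0"
proof -
  show "(LBINT z. time_deriv \<phi> z) = 0"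
    using integral_time_deriv_nonpos[OF assms, of 1] integral_time_deriv_nonpos[OF assms, of "-1"] by simp
  show "(LBINT z. space_deriv \<phi> z) = 0"
    using integral_increasing_times_space_deriv_nonpos[OF assms, of "\<lambda>_. 1" 1]
      integral_increasing_times_space_deriv_nonpos[OF assms, of "\<lambda>_. -1" 1] by simp
qed

lemma dissipates_const: "dissipates (\<lambda>_. c) (\<lambda>_. d)"
proof (rule dissipatesI)
  fix \<phi> :: "real \<times> real \<Rightarrow> real" assume \<phi>: "test_function \<phi>" and nn: "\<And>z. 0 \<le> \<phi> z"
  have "(LBINT z. c * time_deriv \<phi> z + d * space_deriv \<phi> z) = c * (LBINT z. time_deriv \<phi> z) + d * (LBINT z. space_deriv \<phi> z)"
    using integrable_test_derivs[OF \<phi>, of "\<lambda>_. 1" "\<lambda>_. 0" 1] integrable_test_derivs[OF \<phi>, of "\<lambda>_. 0" "\<lambda>_. 1" 1] by simp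
  then show "0 \<le> (LBINT z. c * time_deriv \<phi> z + d * space_deriv \<phi> z)"
    by (simp add: integral_time_deriv[OF \<phi> nn] integral_space_deriv[OF \<phi> nn])
qed

text \<open>
  This allows an increasing function to be subtracted from the flux of any distributional
  inequality.
\<close>

lemma dissipates_minus_increasing:
  assumes [measurable]: "g \<in> borel_measurable borel" and "\<And>z. \<bar>g z\<bar> \<le> B"
    and "\<And>h. 0 < h \<Longrightarrow> AE z in lborel. g z \<le> g ((0, h) + z)"
  shows "dissipates (\<lambda>_. 0) (\<lambda>z. - g z)"
proof (rule dissipatesI)
  fix \<phi> :: "real \<times> real \<Rightarrow> real" assume \<phi>: "test_function \<phi>" and nn: "\<And>z. 0 \<le> \<phi> z"
  show "0 \<le> (LBINT z. 0 * time_deriv \<phi> z + - g z * space_deriv \<phi> z)"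
    using integral_increasing_times_space_deriv_nonpos[OF \<phi> nn assms] by simp
qed

section \<open>Doubling of variables\<close>

text \<open>
  In the doubling argument the bump is a function of the displacement \<open>z' - z\<close>. As it sits in
  \<open>t > 0\<close>, the point \<open>z'\<close> is later than \<open>z\<close>, and the product with a test function of \<open>z\<close> vanishes
  unless both times are positive.
\<close>

lemma exists_bump_in_future:
  obtains J where "test_function J" "\<And>z. 0 \<le> J z" "\<And>z. fst z \<le> 0 \<Longrightarrow> J z = 0" "0 < (LBINT z. J z)"
proof -
  define J where "J z = ramp (fst z) * ramp (1 - fst z) * (ramp (snd z) * ramp (1 - snd z))"
    for z :: "real \<times> real"
  have J: "test_function J"
  proof (rule test_functionI)
    show "C_k k J" for k
      using C_k_flat_exp_affine[of k 1 0 1 0] C_k_flat_exp_affine[of k 1 1 "-1" 0] C_k_flat_exp_affine[of k 1 0 0 1] C_k_flat_exp_affine[of k 1 1 0 "-1"]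
      unfolding J_def[abs_def] by (intro C_k_mult) simp_all
    show "z \<in> cbox (0, 0) (1, 1)" if "J z \<noteq> 0" for z
    proof -
      have "0 < fst z" "0 < 1 - fst z" "0 < snd z" "0 < 1 - snd z"
        by (rule ccontr, use that in \<open>simp add: J_def\<close>)+
      then show ?thesis by (cases z) simp
    qed
  qed (rule bounded_cbox)
  have nn: "0 \<le> J z" for z by (simp add: J_def)
  obtain K C where K: "compact K" and b: "\<And>z. \<bar>J z\<bar> \<le> C" "\<And>z. z \<notin> K \<Longrightarrow> J z = 0"
    using test_function_bounds[OF J] by metis
  have int: "integrable lborel J"
    by (rule integrable_bounded_support[OF borel_measurable_test_function[OF J] compact_imp_bounded[OF K] b])
  have "(LBINT z. J z) \<noteq> 0"
  proof
    assume "(LBINT z. J z) = 0"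
    then have "AE z in lborel. J z = 0"
      using integral_nonneg_eq_0_iff_AE[OF int] nn by auto
    then have "{z. J z \<noteq> 0} \<in> null_sets lborel"
      using borel_measurable_test_function[OF J] by (subst (asm) AE_iff_null) auto
    then have "negligible {z. J z \<noteq> 0}"
      by (simp add: negligible_iff_null_sets null_sets_completionI)
    moreover have "open {z. J z \<noteq> 0}"
      by (intro open_Collect_neq continuous_on_const continuous_test_function[OF J])
    moreover have "(1/2, 1/2) \<in> {z. J z \<noteq> 0}" by (simp add: J_def less_imp_neq[symmetric])
    ultimately show False using open_not_negligible by blast
  qed
  moreover have "0 \<le> (LBINT z. J z)" using nn by (intro Bochner_Integration.integral_nonneg) auto
  ultimately have "0 < (LBINT z. J z)" by linarith
  then show thesis by (intro that[OF J nn]) (simp_all add: J_def)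
qed

text \<open>
  Freeze the second point \<open>z\<close> in the inequality for \<open>u\<close> and the first point \<open>z'\<close> in the inequality for
  \<open>v\<close>, and test both with \<open>\<psi> z J (k (z' - z))\<close>. When the two inequalities are integrated over the
  frozen points and added, the large derivatives of \<open>J\<close> cancel, because the pair \<open>(N, F)\<close> is the
  same in both. What remains carries derivatives on \<open>\<psi>\<close> only, and converges as \<open>z' \<rightarrow> z\<close> by continuity
  of translations in \<open>L\<^sup>1\<close>. Since \<open>\<psi>\<close> depends on \<open>z\<close> alone, only the first argument \<open>u z'\<close> moves in this
  limit, and a Lipschitz condition in that argument suffices.
\<close>

lemma dissipates_doubling:
  fixes N F :: "real \<Rightarrow> real \<Rightarrow> real"
  assumes u[measurable]: "u \<in> borel_measurable borel" and ur: "\<And>z. u z \<in> {0..1}"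
    and v[measurable]: "v \<in> borel_measurable borel" and vr: "\<And>z. v z \<in> {0..1}"
    and NF[measurable]: "case_prod N \<in> borel_measurable borel" "case_prod F \<in> borel_measurable borel"
    and bnd: "\<And>a b. a \<in> {0..1} \<Longrightarrow> b \<in> {0..1} \<Longrightarrow> \<bar>N a b\<bar> \<le> B"
      "\<And>a b. a \<in> {0..1} \<Longrightarrow> b \<in> {0..1} \<Longrightarrow> \<bar>F a b\<bar> \<le> B"
    and lip: "\<And>a a' b. a \<in> {0..1} \<Longrightarrow> a' \<in> {0..1} \<Longrightarrow> b \<in> {0..1} \<Longrightarrow> \<bar>N a b - N a' b\<bar> \<le> B * \<bar>a - a'\<bar>"
      "\<And>a a' b. a \<in> {0..1} \<Longrightarrow> a' \<in> {0..1} \<Longrightarrow> b \<in> {0..1} \<Longrightarrow> \<bar>F a b - F a' b\<bar> \<le> B * \<bar>a - a'\<bar>"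
    and du: "\<And>c. c \<in> {0..1} \<Longrightarrow> dissipates (\<lambda>z. N (u z) c) (\<lambda>z. F (u z) c)"
    and dv: "\<And>c. c \<in> {0..1} \<Longrightarrow> dissipates (\<lambda>z. N c (v z)) (\<lambda>z. F c (v z))"
  shows "dissipates (\<lambda>z. N (u z) (v z)) (\<lambda>z. F (u z) (v z))"
proof (rule dissipatesI)
  fix \<psi> :: "real \<times> real \<Rightarrow> real"
  assume \<psi>: "test_function \<psi>" and \<psi>0: "\<And>z. 0 \<le> \<psi> z" and \<psi>t: "\<And>z. fst z \<le> 0 \<Longrightarrow> \<psi> z = 0"
  obtain J where J: "test_function J" and J0: "\<And>z. 0 \<le> J z" and Jt: "\<And>z. fst z \<le> 0 \<Longrightarrow> J z = 0"
    and Jpos: "0 < (LBINT z. J z)"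
    using exists_bump_in_future by blast
  obtain K1 C1 where K1: "compact K1" "0 < C1" and \<psi>b: "\<And>z. \<bar>\<psi> z\<bar> \<le> C1" "\<And>z. \<bar>time_deriv \<psi> z\<bar> \<le> C1" "\<And>z. \<bar>space_deriv \<psi> z\<bar> \<le> C1"
    and \<psi>K: "\<And>z. z \<notin> K1 \<Longrightarrow> \<psi> z = 0" "\<And>z. z \<notin> K1 \<Longrightarrow> time_deriv \<psi> z = 0" "\<And>z. z \<notin> K1 \<Longrightarrow> space_deriv \<psi> z = 0"
    using test_function_bounds[OF \<psi>] by metis
  obtain K2 C2 where K2: "compact K2" "0 < C2" and Jb: "\<And>z. \<bar>J z\<bar> \<le> C2" "\<And>z. \<bar>time_deriv J z\<bar> \<le> C2" "\<And>z. \<bar>space_deriv J z\<bar> \<le> C2"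
    and JK: "\<And>z. z \<notin> K2 \<Longrightarrow> J z = 0" "\<And>z. z \<notin> K2 \<Longrightarrow> time_deriv J z = 0" "\<And>z. z \<notin> K2 \<Longrightarrow> space_deriv J z = 0"
    using test_function_bounds[OF J] by metis
  note [measurable] = borel_measurable_test_function[OF \<psi>] borel_measurable_time_deriv[OF \<psi>] borel_measurable_space_deriv[OF \<psi>]
    borel_measurable_test_function[OF J] borel_measurable_time_deriv[OF J] borel_measurable_space_deriv[OF J]
  obtain r1 where r1: "K1 \<subseteq> cball 0 r1" "0 \<le> r1"
    using bounded_imp_subset_cball_0[OF compact_imp_bounded[OF K1(1)]] .
  obtain r2 where r2: "K2 \<subseteq> cball 0 r2" "0 \<le> r2"
    using bounded_imp_subset_cball_0[OF compact_imp_bounded[OF K2(1)]] .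
  note [measurable] = borel_measurable_binary[OF NF(1)] borel_measurable_binary[OF NF(2)]
  have [measurable]: "fst \<in> borel_measurable (borel :: ((real \<times> real) \<times> (real \<times> real)) measure)"
    "snd \<in> borel_measurable (borel :: ((real \<times> real) \<times> (real \<times> real)) measure)"
    by (auto intro!: borel_measurable_continuous_onI continuous_intros)
  have "0 \<le> B" using bnd(1)[of 0 0] by auto
  have NFuv: "\<bar>N (u a) (v b)\<bar> \<le> B" "\<bar>F (u a) (v b)\<bar> \<le> B" for a b
    using bnd ur vr by auto
  define \<epsilon> where "\<epsilon> n = inverse (real (Suc n))" for n
  have \<epsilon>: "0 < \<epsilon> n" "\<epsilon> n \<le> 1" "\<epsilon> n * real (Suc n) = 1" "real (Suc n) * \<epsilon> n = 1" for n
    by (auto simp: \<epsilon>_def field_simps)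
  have \<epsilon>0: "\<epsilon> \<longlonglongrightarrow> 0" unfolding \<epsilon>_def by (rule LIMSEQ_inverse_real_of_nat)

  \<comment> \<open>After rescaling \<open>z' = z + \<epsilon> w\<close>, \<open>G n w\<close> is the integral in \<open>z\<close> for a fixed displacement \<open>w\<close>, and \<open>G'\<close> its expected limit.\<close>
  define G where "G n w = (LBINT z. N (u (z + \<epsilon> n *\<^sub>R w)) (v z) * time_deriv \<psi> z
      + F (u (z + \<epsilon> n *\<^sub>R w)) (v z) * space_deriv \<psi> z)" for n w
  define G' where "G' = (LBINT z. N (u z) (v z) * time_deriv \<psi> z + F (u z) (v z) * space_deriv \<psi> z)"

  have step: "0 \<le> (LBINT w. J w * G n w)" for n
  proof -
    define k where "k = real (Suc n)"
    have k: "1 \<le> k" "k \<noteq> 0" by (auto simp: k_def)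
    have int: "integrable lborel (\<lambda>p. X p * f (fst p) * g (k *\<^sub>R (snd p - fst p)))"
      if [measurable]: "X \<in> borel_measurable borel" "f \<in> borel_measurable borel" "g \<in> borel_measurable borel"
        and X: "\<And>p. \<bar>X p\<bar> \<le> B" and f: "\<And>z. \<bar>f z\<bar> \<le> C1" "\<And>z. z \<notin> K1 \<Longrightarrow> f z = 0"
        and g: "\<And>z. \<bar>g z\<bar> \<le> C2" "\<And>z. z \<notin> K2 \<Longrightarrow> g z = 0"
      for X :: "(real \<times> real) \<times> (real \<times> real) \<Rightarrow> real" and f g :: "real \<times> real \<Rightarrow> real"
    proof (rule integrable_bounded_support[of _ "cball 0 r1 \<times> cball 0 (r1 + r2)" "B * C1 * C2"])
      show "bounded (cball 0 r1 \<times> cball (0::real \<times> real) (r1 + r2) :: ((real \<times> real) \<times> (real \<times> real)) set)"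
        by (intro bounded_Times bounded_cball)
      show "\<bar>X p * f (fst p) * g (k *\<^sub>R (snd p - fst p))\<bar> \<le> B * C1 * C2" for p
        unfolding abs_mult using X f g \<open>0 \<le> B\<close> K1(2) K2(2) by (intro mult_mono) auto
      show "X p * f (fst p) * g (k *\<^sub>R (snd p - fst p)) = 0" if "p \<notin> cball 0 r1 \<times> cball 0 (r1 + r2)" for p
      proof (rule ccontr)
        assume "\<not> ?thesis"
        then have "fst p \<in> K1" "k *\<^sub>R (snd p - fst p) \<in> K2"
          using f(2)[of "fst p"] g(2)[of "k *\<^sub>R (snd p - fst p)"] by fastforce+
        then have 1: "norm (fst p) \<le> r1" "norm (k *\<^sub>R (snd p - fst p)) \<le> r2" using r1 r2 by auto
        have "norm (snd p - fst p) \<le> k * norm (snd p - fst p)"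
          using k(1) by (simp add: mult_le_cancel_right1)
        then have "norm (snd p - fst p) \<le> r2" using 1(2) k(1) by simp
        then have "norm (snd p) \<le> r1 + r2"
          using norm_triangle_sub[of "snd p" "fst p"] 1(1) by simp
        then show False using that 1(1) by (cases p) auto
      qed
    qed measurable
    let ?N = "\<lambda>p. N (u (snd p)) (v (fst p))" and ?F = "\<lambda>p. F (u (snd p)) (v (fst p))"
    let ?q = "\<lambda>z w. N (u (z + \<epsilon> n *\<^sub>R w)) (v z) * time_deriv \<psi> z + F (u (z + \<epsilon> n *\<^sub>R w)) (v z) * space_deriv \<psi> z"
    let ?I = "\<lambda>X f g p. X p * f (fst p) * g (k *\<^sub>R (snd p - fst p))"
    have i: "integrable lborel (?I ?N \<psi> (time_deriv J))" "integrable lborel (?I ?F \<psi> (space_deriv J))"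
      "integrable lborel (?I ?N (time_deriv \<psi>) J)" "integrable lborel (?I ?F (space_deriv \<psi>) J)"
      by (rule int; (rule NFuv \<psi>b Jb \<psi>K JK; assumption | measurable))+
    \<comment> \<open>\<open>A\<close> is the integrand of the inequality for \<open>u\<close> and \<open>A'\<close> that of the inequality for \<open>v\<close>; their sum has no derivative on \<open>J\<close>.\<close>
    define A where "A p = k * ?I ?N \<psi> (time_deriv J) p + k * ?I ?F \<psi> (space_deriv J) p" for p
    define A' where "A' p = ?I ?N (time_deriv \<psi>) J p + ?I ?F (space_deriv \<psi>) J p - A p" for p
    have iA: "integrable lborel A" "integrable lborel A'"
      unfolding A_def[abs_def] A'_def[abs_def] by (intro Bochner_Integration.integrable_add Bochner_Integration.integrable_diff integrable_mult_right i)+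
    have Aprod: "(LBINT p. A p) = (LBINT z. (LBINT z'. A (z, z')))"
      using lborel_pair.integral_fst'[of A] iA(1) by (simp add: lborel_prod)
    have A'prod: "(LBINT p. A' p) = (LBINT z'. (LBINT z. A' (z, z')))"
      using lborel_pair.integral_snd[of "\<lambda>z z'. A' (z, z')"] iA(2) by (simp add: lborel_prod)
    have "0 \<le> (LBINT z'. A (z, z'))" for z
    proof (cases "fst z \<le> 0")
      case True
      then have "\<psi> z = 0" using \<psi>t by blast
      then show ?thesis by (simp add: A_def)
    next
      case False
      let ?\<phi> = "\<lambda>z'. J ((- k) *\<^sub>R z + k *\<^sub>R z')"
      have td: "time_deriv ?\<phi> z' = k * time_deriv J (k *\<^sub>R (z' - z))"
        "space_deriv ?\<phi> z' = k * space_deriv J (k *\<^sub>R (z' - z))" for z'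
        by (subst time_deriv_affine space_deriv_affine, rule test_function_differentiable[OF J],
            simp add: algebra_simps)+
      have "?\<phi> z' = 0" if "fst z' \<le> 0" for z'
      proof (rule Jt)
        have "k * fst z' \<le> 0" "0 \<le> k * fst z" using that False k(1) by (auto simp: mult_nonneg_nonpos)
        then show "fst ((- k) *\<^sub>R z + k *\<^sub>R z') \<le> 0" by simp
      qed
      then have "0 \<le> (LBINT z'. N (u z') (v z) * time_deriv ?\<phi> z' + F (u z') (v z) * space_deriv ?\<phi> z')"
        by (rule dissipatesD[OF du[OF vr] test_function_affine[OF J k(2)] J0])
      then have "0 \<le> \<psi> z * (LBINT z'. N (u z') (v z) * time_deriv ?\<phi> z' + F (u z') (v z) * space_deriv ?\<phi> z')"
        using \<psi>0 by simp
      also have "\<dots> = (LBINT z'. \<psi> z * (N (u z') (v z) * time_deriv ?\<phi> z' + F (u z') (v z) * space_deriv ?\<phi> z'))"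
        by simp
      also have "\<dots> = (LBINT z'. A (z, z'))"
        unfolding td by (intro Bochner_Integration.integral_cong) (simp_all add: A_def algebra_simps)
      finally show ?thesis .
    qed
    then have A0: "0 \<le> (LBINT p. A p)" unfolding Aprod by (rule Bochner_Integration.integral_nonneg)
    have "0 \<le> (LBINT z. A' (z, z'))" for z'
    proof -
      let ?J = "\<lambda>z. J (k *\<^sub>R z' + (- k) *\<^sub>R z)" let ?\<phi> = "\<lambda>z. \<psi> z * ?J z"
      have tJ: "test_function ?J" by (rule test_function_affine[OF J]) (use k in simp)
      then have t\<phi>: "test_function ?\<phi>" by (intro test_function_mult[OF \<psi>]) (use tJ in \<open>simp add: test_function_def\<close>)
      have td: "time_deriv ?J z = - k * time_deriv J (k *\<^sub>R (z' - z))"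
        "space_deriv ?J z = - k * space_deriv J (k *\<^sub>R (z' - z))" for z
        by (subst time_deriv_affine space_deriv_affine, rule test_function_differentiable[OF J],
            simp add: algebra_simps)+
      have td\<phi>: "time_deriv ?\<phi> z = time_deriv \<psi> z * ?J z - k * \<psi> z * time_deriv J (k *\<^sub>R (z' - z))"
        "space_deriv ?\<phi> z = space_deriv \<psi> z * ?J z - k * \<psi> z * space_deriv J (k *\<^sub>R (z' - z))" for z
        using time_deriv_mult[OF test_function_differentiable[OF \<psi>] test_function_differentiable[OF tJ], of z]
          space_deriv_mult[OF test_function_differentiable[OF \<psi>] test_function_differentiable[OF tJ], of z]
        unfolding td by (simp_all add: algebra_simps)
      have "0 \<le> (LBINT z. N (u z') (v z) * time_deriv ?\<phi> z + F (u z') (v z) * space_deriv ?\<phi> z)"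
        by (rule dissipatesD[OF dv[OF ur] t\<phi>]) (simp_all add: J0 \<psi>0 \<psi>t)
      also have "\<dots> = (LBINT z. A' (z, z'))"
        unfolding td\<phi> by (intro Bochner_Integration.integral_cong) (simp_all add: A_def A'_def algebra_simps)
      finally show ?thesis .
    qed
    then have "0 \<le> (LBINT p. A' p)" unfolding A'prod by (rule Bochner_Integration.integral_nonneg)
    with A0 have "0 \<le> (LBINT p. A p + A' p)" using iA by simp
    also have "\<dots> = (LBINT p. (?N p * time_deriv \<psi> (fst p) + ?F p * space_deriv \<psi> (fst p)) * J (k *\<^sub>R (snd p - fst p)))"
      by (intro Bochner_Integration.integral_cong) (simp_all add: A'_def algebra_simps)
    also have "\<dots> = (LBINT z. (LBINT z'. (N (u z') (v z) * time_deriv \<psi> z + F (u z') (v z) * space_deriv \<psi> z) * J (k *\<^sub>R (z' - z))))"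
      using lborel_pair.integral_fst'[of "\<lambda>p. (?N p * time_deriv \<psi> (fst p) + ?F p * space_deriv \<psi> (fst p)) * J (k *\<^sub>R (snd p - fst p))"]
        Bochner_Integration.integrable_add[OF i(3,4)] by (simp add: lborel_prod algebra_simps)
    \<comment> \<open>The square is the Jacobian of the dilation in the plane.\<close>
    also have "\<dots> = (LBINT z. \<epsilon> n ^ 2 * (LBINT w. ?q z w * J w))"
    proof (intro Bochner_Integration.integral_cong refl)
      fix z
      have "k * \<epsilon> n = 1" using \<epsilon>(4)[of n] by (simp add: k_def)
      then show "(LBINT z'. (N (u z') (v z) * time_deriv \<psi> z + F (u z') (v z) * space_deriv \<psi> z) * J (k *\<^sub>R (z' - z)))
        = \<epsilon> n ^ 2 * (LBINT w. ?q z w * J w)"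
        using \<epsilon>(1)[of n] by (subst lborel_integral_scale[where a = z and c = "\<epsilon> n"]) (simp_all add: power2_eq_square)
    qed
    also have "\<dots> = \<epsilon> n ^ 2 * (LBINT z. (LBINT w. ?q z w * J w))"
      by simp
    also have "(LBINT z. (LBINT w. ?q z w * J w))
      = (LBINT w. (LBINT z. ?q z w * J w))"
    proof (rule lborel_pair.Fubini_integral[symmetric], unfold lborel_prod)
      show "integrable lborel (\<lambda>(z, w). ?q z w * J w)"
      proof (rule integrable_bounded_support[of _ "K1 \<times> K2" "(B * C1 + B * C1) * C2"])
        show "bounded (K1 \<times> K2)" by (intro bounded_Times compact_imp_bounded K1 K2)
        have "\<bar>(N a b * time_deriv \<psi> z + F a b * space_deriv \<psi> z) * J w\<bar> \<le> (B * C1 + B * C1) * C2"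
          if "\<bar>N a b\<bar> \<le> B" "\<bar>F a b\<bar> \<le> B" for a b z w
          unfolding abs_mult[of _ "J w"]
          by (intro mult_mono abs_lincomb_le that \<psi>b Jb) (use \<open>0 \<le> B\<close> K1(2) in simp_all)
        then show "\<bar>case p of (z, w) \<Rightarrow> ?q z w * J w\<bar> \<le> (B * C1 + B * C1) * C2" for p
          using NFuv by (cases p) simp
        show "(case p of (z, w) \<Rightarrow> ?q z w * J w) = 0"
          if "p \<notin> K1 \<times> K2" for p
          using that \<psi>K(2,3)[of "fst p"] JK(1)[of "snd p"] by (cases p, cases "fst p \<in> K1") simp_all
      qed (simp add: split_beta')
    qed
    also have "\<dots> = (LBINT w. J w * G n w)"
      unfolding G_def by (simp add: mult.commute)
    finally show ?thesis using \<epsilon>(1)[of n] by (simp add: zero_le_mult_iff)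
  qed
  show "0 \<le> (LBINT z. N (u z) (v z) * time_deriv \<psi> z + F (u z) (v z) * space_deriv \<psi> z)"
  proof -
    define V :: real where "V = (\<integral>z. indicator (cball 0 r1) z \<partial>(lborel :: (real \<times> real) measure))"
    define T where "T n w = (LBINT z. indicator (cball 0 r1) z * \<bar>u (\<epsilon> n *\<^sub>R w + z) - u z\<bar>)" for n w
    have u01: "0 \<le> u z" "u z \<le> 1" for z using ur[of z] by auto
    have u1: "\<bar>u a - u b\<bar> \<le> 1" for a b using u01[of a] u01[of b] by auto
    have intT: "integrable lborel (\<lambda>z. indicator (cball 0 r1) z * \<bar>u (\<epsilon> n *\<^sub>R w + z) - u z\<bar>)" for n w
      by (rule integrable_bounded_support[of _ "cball 0 r1" 1]) (simp_all add: indicator_def u1)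
    have T: "(\<lambda>n. T n w) \<longlonglongrightarrow> 0" for w
      unfolding T_def
    proof (rule translation_continuous_L1_loc[OF u u01])
      show "(\<lambda>n. \<epsilon> n *\<^sub>R w) \<longlonglongrightarrow> 0"
        using tendsto_scaleR[OF \<epsilon>0 tendsto_const[of w]] by simp
      show "norm (\<epsilon> n *\<^sub>R w) \<le> norm w" for n
        using \<epsilon>(1,2)[of n] by (simp add: mult_left_le_one_le)
    qed
    have intq: "integrable lborel (\<lambda>z. N (x z) (v z) * time_deriv \<psi> z + F (x z) (v z) * space_deriv \<psi> z)"
      if [measurable]: "x \<in> borel_measurable borel" and x: "\<And>z. x z \<in> {0..1}" for x
    proof (rule integrable_bounded_support[OF _ compact_imp_bounded[OF K1(1)], of _ "B * C1 + B * C1"])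
      show "\<bar>N (x z) (v z) * time_deriv \<psi> z + F (x z) (v z) * space_deriv \<psi> z\<bar> \<le> B * C1 + B * C1" for z
        by (intro abs_lincomb_le bnd x vr \<psi>b)
    qed (simp_all add: \<psi>K)
    \<comment> \<open>The Lipschitz bounds reduce the convergence to a modulus of continuity of translations of \<open>u\<close>.\<close>
    have GG': "\<bar>G n w - G'\<bar> \<le> 2 * B * C1 * T n w" for n w
    proof -
      have [measurable]: "(\<lambda>z. u (z + \<epsilon> n *\<^sub>R w)) \<in> borel_measurable borel" by measurable
      let ?d = "\<lambda>z. (N (u (z + \<epsilon> n *\<^sub>R w)) (v z) * time_deriv \<psi> z + F (u (z + \<epsilon> n *\<^sub>R w)) (v z) * space_deriv \<psi> z)
           - (N (u z) (v z) * time_deriv \<psi> z + F (u z) (v z) * space_deriv \<psi> z)"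
      have "G n w - G' = (LBINT z. ?d z)"
        unfolding G_def G'_def using intq[of u] intq[of "\<lambda>z. u (z + \<epsilon> n *\<^sub>R w)"] ur by simp
      then have "\<bar>G n w - G'\<bar> \<le> (LBINT z. \<bar>?d z\<bar>)" by (simp add: integral_abs_bound)
      also have "\<dots> \<le> (LBINT z. 2 * B * C1 * (indicator (cball 0 r1) z * \<bar>u (\<epsilon> n *\<^sub>R w + z) - u z\<bar>))"
      proof (rule integral_mono)
        show "integrable lborel (\<lambda>z. \<bar>?d z\<bar>)"
          using intq[of u] intq[of "\<lambda>z. u (z + \<epsilon> n *\<^sub>R w)"] ur by (intro integrable_abs Bochner_Integration.integrable_diff) auto
        show "integrable lborel (\<lambda>z. 2 * B * C1 * (indicator (cball 0 r1) z * \<bar>u (\<epsilon> n *\<^sub>R w + z) - u z\<bar>))"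
          by (intro integrable_mult_right intT)
        show "\<bar>?d z\<bar> \<le> 2 * B * C1 * (indicator (cball 0 r1) z * \<bar>u (\<epsilon> n *\<^sub>R w + z) - u z\<bar>)" for z
        proof (cases "z \<in> K1")
          case True
          define a where "a = u (z + \<epsilon> n *\<^sub>R w)"
          have "\<bar>?d z\<bar> = \<bar>(N a (v z) - N (u z) (v z)) * time_deriv \<psi> z + (F a (v z) - F (u z) (v z)) * space_deriv \<psi> z\<bar>"
            by (simp add: a_def algebra_simps)
          also have "\<dots> \<le> (B * \<bar>a - u z\<bar>) * C1 + (B * \<bar>a - u z\<bar>) * C1"
            unfolding a_def by (intro abs_lincomb_le lip ur vr \<psi>b)
          finally show ?thesis using True r1 by (auto simp: a_def add.commute algebra_simps)
        next
          case False
          then show ?thesis using \<open>0 \<le> B\<close> K1(2) by (simp add: \<psi>K)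
        qed
      qed
      finally show ?thesis by (simp add: T_def)
    qed
    have TV: "T n w \<le> V" for n w
      unfolding T_def V_def
    proof (rule integral_mono)
      show "integrable lborel (\<lambda>z. indicator (cball 0 r1) z * \<bar>u (\<epsilon> n *\<^sub>R w + z) - u z\<bar>)"
        by (rule intT)
      show "indicator (cball 0 r1) z * \<bar>u (\<epsilon> n *\<^sub>R w + z) - u z\<bar> \<le> indicator (cball 0 r1) z" for z
        using u01[of z] u01[of "\<epsilon> n *\<^sub>R w + z"] by (auto simp: indicator_def)
    qed (rule integrable_indicator_cball)
    have intJ: "integrable lborel J"
      by (rule integrable_bounded_support[OF _ compact_imp_bounded[OF K2(1)] Jb(1) JK(1)]) simp_all
    have G: "(\<lambda>n. \<integral>w. J w * G n w \<partial>lborel) \<longlonglongrightarrow> (LBINT w. J w * G')"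
    proof (rule integral_dominated_convergence[where w = "\<lambda>w. J w * (\<bar>G'\<bar> + 2 * B * C1 * V)"])
      show "integrable lborel (\<lambda>w. J w * (\<bar>G'\<bar> + 2 * B * C1 * V))" using intJ by simp
      show "AE w in lborel. (\<lambda>n. J w * G n w) \<longlonglongrightarrow> J w * G'"
      proof (intro AE_I2 tendsto_mult tendsto_const)
        fix w
        have "(\<lambda>n. 2 * B * C1 * T n w) \<longlonglongrightarrow> 0" using tendsto_mult_left[OF T[of w], of "2 * B * C1"] by simp
        then have "(\<lambda>n. G n w - G') \<longlonglongrightarrow> 0"
          by (rule Lim_null_comparison[rotated]) (use GG'[of _ w] in auto)
        then show "(\<lambda>n. G n w) \<longlonglongrightarrow> G'" by (rule LIM_zero_cancel)
      qed
      show "AE w in lborel. norm (J w * G n w) \<le> J w * (\<bar>G'\<bar> + 2 * B * C1 * V)" for n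
      proof (intro AE_I2)
        fix w
        have "2 * B * C1 * T n w \<le> 2 * B * C1 * V" using TV[of n w] \<open>0 \<le> B\<close> K1(2) by (intro mult_left_mono) auto
        then have "\<bar>G n w\<bar> \<le> \<bar>G'\<bar> + 2 * B * C1 * V" using GG'[of n w] by linarith
        then show "norm (J w * G n w) \<le> J w * (\<bar>G'\<bar> + 2 * B * C1 * V)"
          using J0[of w] by (simp add: abs_mult mult_left_mono)
      qed
      show "(\<lambda>w. J w * G n w) \<in> borel_measurable lborel" for n
        unfolding G_def by measurable
    qed simp
    have "0 \<le> (LBINT w. J w * G')"
      by (rule LIMSEQ_le_const[OF G]) (use step in auto)
    then show ?thesis using Jpos by (simp add: G'_def[symmetric] zero_le_mult_iff)
  qed
qed

section \<open>Curves in local L1 and their Borel versions\<close>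

text \<open>
  The regularity that entropy solutions and their spatial translates share.
\<close>

definition L1_loc_curve :: "(real \<Rightarrow> real \<Rightarrow> real) \<Rightarrow> bool" where
  "L1_loc_curve u \<longleftrightarrow> (\<forall>t\<ge>0. \<forall>x. u t x \<in> {0..1}) \<and> (\<forall>t\<ge>0. u t \<in> borel_measurable lebesgue) \<and> continuous_in_L1_loc u"

lemma L1_loc_curve_shift:
  assumes u: "L1_loc_curve u"
  shows "L1_loc_curve (\<lambda>t x. u t (x + h))"
  unfolding L1_loc_curve_def continuous_in_L1_loc_def
proof (intro conjI allI impI)
  fix t :: real assume t: "0 \<le> t"
  have ur: "u s x \<in> {0..1}" if "0 \<le> s" for s x using u that by (auto simp: L1_loc_curve_def)
  have um: "u s \<in> borel_measurable lebesgue" if "0 \<le> s" for s using u that by (auto simp: L1_loc_curve_def)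
  show "u t (x + h) \<in> {0..1}" for x using ur[OF t] .
  show "(\<lambda>x. u t (x + h)) \<in> borel_measurable lebesgue" by (rule borel_measurable_lebesgue_shift[OF um[OF t]])
  fix R :: real
  define r where "r = \<bar>R\<bar> + \<bar>h\<bar>"
  have lim: "((\<lambda>s. LINT x:{-r..r}|lebesgue. \<bar>u s x - u t x\<bar>) \<longlongrightarrow> 0) (at t within {0..})"
    using u t by (auto simp: L1_loc_curve_def continuous_in_L1_loc_def)
  show "((\<lambda>s. LINT x:{-R..R}|lebesgue. \<bar>u s (x + h) - u t (x + h)\<bar>) \<longlongrightarrow> 0) (at t within {0..})"
  proof (rule Lim_null_comparison[OF _ lim])
    have "norm (LINT x:{-R..R}|lebesgue. \<bar>u s (x + h) - u t (x + h)\<bar>) \<le> (LINT x:{-r..r}|lebesgue. \<bar>u s x - u t x\<bar>)" if s: "0 \<le> s" for s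
    proof -
      note [measurable] = um[OF s] um[OF t] borel_measurable_lebesgue_shift[OF um[OF s], of h] borel_measurable_lebesgue_shift[OF um[OF t], of h]
      have d: "\<bar>u s x - u t x\<bar> \<le> 1" for x using abs_diff_le_1[OF ur[OF s] ur[OF t]] .
      have Icc: "{a..b} \<in> sets lebesgue" for a b :: real by simp
      note [measurable] = Icc
      have m: "(\<lambda>x. indicator {-r..r} x * \<bar>u s x - u t x\<bar>) \<in> borel_measurable lebesgue" by measurable
      have m2: "(\<lambda>x. indicator {-R..R} x * \<bar>u s (x + h) - u t (x + h)\<bar>) \<in> borel_measurable lebesgue" by measurable
      have "norm (LINT x:{-R..R}|lebesgue. \<bar>u s (x + h) - u t (x + h)\<bar>) = (LINT x|lebesgue. indicator {-R..R} x * \<bar>u s (x + h) - u t (x + h)\<bar>)"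
        unfolding set_lebesgue_integral_def by (simp add: Bochner_Integration.integral_nonneg)
      also have "\<dots> \<le> (LINT x|lebesgue. indicator {-r..r} (x + h) * \<bar>u s (x + h) - u t (x + h)\<bar>)"
      proof (rule integral_mono)
        show "integrable lebesgue (\<lambda>x. indicator {-R..R} x * \<bar>u s (x + h) - u t (x + h)\<bar>)"
          by (rule integrable_lebesgue_bounded_support[of _ "{-R..R}" 1]) (use d m2 in \<open>auto simp: indicator_def\<close>)
        show "integrable lebesgue (\<lambda>x. indicator {-r..r} (x + h) * \<bar>u s (x + h) - u t (x + h)\<bar>)"
          by (rule integrable_lebesgue_bounded_support[of _ "{-r-h..r-h}" 1])
            (use d borel_measurable_lebesgue_shift[OF m, of h] in \<open>auto simp: indicator_def\<close>)
        show "indicator {-R..R} x * \<bar>u s (x + h) - u t (x + h)\<bar> \<le> indicator {-r..r} (x + h) * \<bar>u s (x + h) - u t (x + h)\<bar>" for x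
          by (auto simp: indicator_def r_def)
      qed
      also have "\<dots> = (LINT x:{-r..r}|lebesgue. \<bar>u s x - u t x\<bar>)"
        using lebesgue_integral_shift[OF m, of h] by (simp add: set_lebesgue_integral_def)
      finally show ?thesis .
    qed
    then show "eventually (\<lambda>s. norm (LINT x:{-R..R}|lebesgue. \<bar>u s (x + h) - u t (x + h)\<bar>) \<le> (LINT x:{-r..r}|lebesgue. \<bar>u s x - u t x\<bar>)) (at t within {0..})"
      by (auto simp: eventually_at_filter)
  qed
qed

text \<open>
  Both the energy in a cone and the pairing of a solution with a fixed function are integrals of this
  kind: the integrand depends on time through \<open>u\<close> and \<open>v\<close> and through a Lipschitz weight.
\<close>

lemma continuous_integral_of_L1_loc_curves:
  assumes u: "L1_loc_curve u" and v: "L1_loc_curve v" and t: "0 \<le> t"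
    and e_meas: "\<And>s. 0 \<le> s \<Longrightarrow> e s \<in> borel_measurable lebesgue"
    and e_bound: "\<And>s x. 0 \<le> s \<Longrightarrow> \<bar>e s x\<bar> \<le> 1"
    and e_support: "\<And>s x. 0 \<le> s \<Longrightarrow> x \<notin> {-r..r} \<Longrightarrow> e s x = 0"
    and e_Lipschitz: "\<And>s x. 0 \<le> s \<Longrightarrow> \<bar>e s x - e t x\<bar> \<le> \<bar>u s x - u t x\<bar> + \<bar>v s x - v t x\<bar> + K * \<bar>s - t\<bar>"
  shows "((\<lambda>s. \<integral>x. e s x \<partial>lebesgue) \<longlongrightarrow> (LINT x|lebesgue. e t x)) (at t within {0..})"
proof -
  define I where "I f = (LINT x|lebesgue. indicator {-r..r} x * f x)" for f :: "real \<Rightarrow> real"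
  define V where "V = I (\<lambda>_. 1)"
  have I: "integrable lebesgue (\<lambda>x. indicator {-r..r} x * \<bar>w s x - w t x\<bar>)"
    "((\<lambda>s. I (\<lambda>x. \<bar>w s x - w t x\<bar>)) \<longlongrightarrow> 0) (at t within {0..})" if w: "L1_loc_curve w" and s: "0 \<le> s" for w s
  proof -
    have wm: "w s \<in> borel_measurable lebesgue" "w t \<in> borel_measurable lebesgue"
      using w s t by (auto simp: L1_loc_curve_def)
    have w1: "\<bar>w s x - w t x\<bar> \<le> 1" for x
      using w s t by (intro abs_diff_le_1) (auto simp: L1_loc_curve_def)
    have "{-r..r} \<in> sets lebesgue" by simp
    then have "(\<lambda>x. indicator {-r..r} x * \<bar>w s x - w t x\<bar>) \<in> borel_measurable lebesgue"
      using wm by measurable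
    then show "integrable lebesgue (\<lambda>x. indicator {-r..r} x * \<bar>w s x - w t x\<bar>)"
      by (rule integrable_lebesgue_bounded_support[of _ "{-r..r}" 1]) (simp_all add: indicator_def w1)
    show "((\<lambda>s. I (\<lambda>x. \<bar>w s x - w t x\<bar>)) \<longlongrightarrow> 0) (at t within {0..})"
      using w t unfolding L1_loc_curve_def continuous_in_L1_loc_def I_def set_lebesgue_integral_def
      by simp
  qed
  have int: "integrable lebesgue (e s)" if s: "0 \<le> s" for s
    by (rule integrable_lebesgue_bounded_support[OF e_meas[OF s] bounded_closed_interval e_bound[OF s] e_support[OF s]])
  let ?B = "\<lambda>s. I (\<lambda>x. \<bar>u s x - u t x\<bar>) + I (\<lambda>x. \<bar>v s x - v t x\<bar>) + K * \<bar>s - t\<bar> * V"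
  have bound: "\<bar>(LINT x|lebesgue. e s x) - (LINT x|lebesgue. e t x)\<bar> \<le> ?B s" if s: "0 \<le> s" for s
  proof -
    have "\<bar>(LINT x|lebesgue. e s x) - (LINT x|lebesgue. e t x)\<bar> = \<bar>\<integral>x. e s x - e t x \<partial>lebesgue\<bar>"
      using int[OF s] int[OF t] by simp
    also have "\<dots> \<le> (LINT x|lebesgue. \<bar>e s x - e t x\<bar>)" by (rule integral_abs_bound)
    also have "\<dots> \<le> (LINT x|lebesgue. indicator {-r..r} x * \<bar>u s x - u t x\<bar> + indicator {-r..r} x * \<bar>v s x - v t x\<bar>
        + K * \<bar>s - t\<bar> * indicator {-r..r} x)"
    proof (rule integral_mono)
      show "\<bar>e s x - e t x\<bar> \<le> indicator {-r..r} x * \<bar>u s x - u t x\<bar> + indicator {-r..r} x * \<bar>v s x - v t x\<bar>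
          + K * \<bar>s - t\<bar> * indicator {-r..r} x" for x
        using e_Lipschitz[OF s, of x] e_support[OF s, of x] e_support[OF t, of x] by (cases "x \<in> {-r..r}") simp_all
    qed (use int[OF s] int[OF t] I(1)[OF u s] I(1)[OF v s] integrable_lebesgue_indicator_Icc[of "-r" r] in simp_all)
    also have "\<dots> = ?B s"
      unfolding V_def I_def using I(1)[OF u s] I(1)[OF v s] integrable_lebesgue_indicator_Icc[of "-r" r] by simp
    finally show ?thesis .
  qed
  have "((\<lambda>s. K * \<bar>s - t\<bar> * V) \<longlongrightarrow> K * \<bar>t - t\<bar> * V) (at t within {0..})"
    by (intro tendsto_intros)
  then have lim: "(?B \<longlongrightarrow> 0) (at t within {0..})"
    using tendsto_add[OF tendsto_add[OF I(2)[OF u t] I(2)[OF v t]]] by fastforce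
  have "((\<lambda>s. (LINT x|lebesgue. e s x) - (LINT x|lebesgue. e t x)) \<longlongrightarrow> 0) (at t within {0..})"
  proof (rule Lim_null_comparison[OF _ lim])
    show "eventually (\<lambda>s. norm ((LINT x|lebesgue. e s x) - (LINT x|lebesgue. e t x)) \<le> ?B s) (at t within {0..})"
      using bound by (auto simp: eventually_at_filter)
  qed
  then show ?thesis by (rule LIM_zero_cancel)
qed

text \<open>
  Fubini's theorem is applied to a Borel measurable representative. It is set to \<open>0\<close> at negative
  times, so that spatial monotonicity can be stated almost everywhere in the whole plane.
\<close>

definition borel_version :: "(real \<Rightarrow> real \<Rightarrow> real) \<Rightarrow> (real \<times> real \<Rightarrow> real) \<Rightarrow> bool" where
  "borel_version u w \<longleftrightarrow> w \<in> borel_measurable borel \<and> (\<forall>z. w z \<in> {0..1}) \<and> (\<forall>z. fst z < 0 \<longrightarrow> w z = 0) \<and>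
     (AE z in lborel. 0 \<le> fst z \<longrightarrow> u (fst z) (snd z) = w z)"

lemma borel_version_slices:
  assumes "borel_version u w"
  shows "AE t in lborel. 0 \<le> t \<longrightarrow> (AE x in lborel. u t x = w (t, x))"
proof -
  have "AE z in lborel \<Otimes>\<^sub>M lborel. 0 \<le> fst z \<longrightarrow> u (fst z) (snd z) = w z"
    using assms unfolding borel_version_def lborel_prod by blast
  from lborel_pair.AE_pair[OF this] show ?thesis by simp
qed

lemma borel_version_shift:
  assumes w: "borel_version u w"
  shows "borel_version (\<lambda>t x. u t (x + h)) (\<lambda>z. w ((0, h) + z))"
  unfolding borel_version_def
proof (intro conjI allI)
  have [measurable]: "w \<in> borel_measurable borel" using w by (simp add: borel_version_def)
  show "(\<lambda>z. w ((0, h) + z)) \<in> borel_measurable borel" by measurable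
  show "w ((0, h) + z) \<in> {0..1}" for z using w unfolding borel_version_def by blast
  show "fst z < 0 \<longrightarrow> w ((0, h) + z) = 0" for z
  proof -
    have "fst ((0, h) + z) < 0 \<longrightarrow> w ((0, h) + z) = 0" using w unfolding borel_version_def by blast
    then show ?thesis by simp
  qed
  have "AE z in lborel. 0 \<le> fst z \<longrightarrow> u (fst z) (snd z) = w z" using w by (simp add: borel_version_def)
  then have "AE z in lborel. 0 \<le> fst ((0, h) + z) \<longrightarrow> u (fst ((0, h) + z)) (snd ((0, h) + z)) = w ((0, h) + z)"
    by (rule AE_lborel_shift)
  then show "AE z in lborel. 0 \<le> fst z \<longrightarrow> u (fst z) (snd z + h) = w ((0, h) + z)" by (simp add: add.commute)
qed

section \<open>Cutoffs in one variable\<close>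

text \<open>
  Both \<open>\<sigma> = 1\<close> and \<open>\<sigma> = - 1\<close> are used, for the two flanks of a plateau. The factor
  \<open>ramp (n d - r)\<close> is the value of the opposite flank, which tends to \<open>1\<close>.
\<close>

lemma ramp'_concentration:
  assumes [measurable]: "E \<in> borel_measurable borel" and B: "\<And>r. \<bar>E r\<bar> \<le> B" and d: "0 < d"
    and lim: "((\<lambda>r. E (x0 + \<sigma> * r)) \<longlongrightarrow> E x0) (at_right 0)"
  shows "(\<lambda>n. \<integral>r. ramp' r * (ramp (real (Suc n) * d - r) * E (x0 + \<sigma> * (r / real (Suc n)))) \<partial>lborel) \<longlonglongrightarrow> E x0"
proof -
  have i: "integrable lborel ramp'" "(LBINT r. ramp' r) = 1"
    using has_bochner_integral_ramp' by (auto simp: has_bochner_integral_iff)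
  have "(\<lambda>n. \<integral>r. ramp' r * (ramp (real (Suc n) * d - r) * E (x0 + \<sigma> * (r / real (Suc n)))) \<partial>lborel)
     \<longlonglongrightarrow> (LBINT r. ramp' r * (1 * E x0))"
  proof (rule integral_dominated_convergence[where w = "\<lambda>r. ramp' r * B"])
    show "integrable lborel (\<lambda>r. ramp' r * B)" using i by simp
    show "AE r in lborel. norm (ramp' r * (ramp (real (Suc n) * d - r) * E (x0 + \<sigma> * (r / real (Suc n))))) \<le> ramp' r * B" for n
    proof (intro AE_I2)
      fix r
      have "ramp (real (Suc n) * d - r) * \<bar>E (x0 + \<sigma> * (r / real (Suc n)))\<bar> \<le> 1 * B"
        using B by (intro mult_mono) auto
      then show "norm (ramp' r * (ramp (real (Suc n) * d - r) * E (x0 + \<sigma> * (r / real (Suc n))))) \<le> ramp' r * B"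
        by (simp add: abs_mult mult_left_mono)
    qed
    show "AE r in lborel. (\<lambda>n. ramp' r * (ramp (real (Suc n) * d - r) * E (x0 + \<sigma> * (r / real (Suc n))))) \<longlonglongrightarrow> ramp' r * (1 * E x0)"
    proof (intro AE_I2)
      fix r :: real
      show "(\<lambda>n. ramp' r * (ramp (real (Suc n) * d - r) * E (x0 + \<sigma> * (r / real (Suc n))))) \<longlonglongrightarrow> ramp' r * (1 * E x0)"
      proof (cases "r \<le> 0")
        case False
        have "(\<lambda>n. r / real (Suc n)) \<longlonglongrightarrow> 0"
          using tendsto_mult_right_zero[OF LIMSEQ_inverse_real_of_nat, of r] by (simp add: divide_inverse)
        then have "filterlim (\<lambda>n. r / real (Suc n)) (at_right 0) sequentially"
          unfolding filterlim_at using False by (auto simp: field_simps)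
        then have "(\<lambda>n. E (x0 + \<sigma> * (r / real (Suc n)))) \<longlonglongrightarrow> E x0"
          by (rule filterlim_compose[OF lim])
        moreover have "filterlim (\<lambda>n. real (Suc n) * d - r) at_top sequentially"
          using d by real_asymp
        then have "(\<lambda>n. ramp (real (Suc n) * d - r)) \<longlonglongrightarrow> 1"
          by (rule filterlim_compose[OF ramp_tendsto_1])
        ultimately show ?thesis by (intro tendsto_intros)
      qed simp
    qed
  qed auto
  then show ?thesis using i by simp
qed

text \<open>
  A smooth substitute for the indicator of \<open>(a, b)\<close>, sharp for large \<open>k\<close>.
\<close>

definition plateau :: "real \<Rightarrow> real \<Rightarrow> real \<Rightarrow> real \<Rightarrow> real" where
  "plateau k a b x = ramp (k * (x - a)) * ramp (k * (b - x))"

text \<open>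
  The derivative of the plateau, written as rising flank minus falling flank.
\<close>

definition plateau' :: "real \<Rightarrow> real \<Rightarrow> real \<Rightarrow> real \<Rightarrow> real" where
  "plateau' k a b x = k * (ramp' (k * (x - a)) * ramp (k * (b - x))) - k * (ramp (k * (x - a)) * ramp' (k * (b - x)))"

lemma plateau_bounds: "0 \<le> plateau k a b x" "plateau k a b x \<le> 1" "\<bar>plateau k a b x\<bar> \<le> 1"
  by (auto simp: plateau_def mult_le_one abs_mult)

lemma plateau_support:
  assumes "0 < k" "x \<notin> {a<..<b}" shows "plateau k a b x = 0" "plateau' k a b x = 0"
proof -
  have "k * (x - a) \<le> 0 \<or> k * (b - x) \<le> 0" using assms by (auto simp: mult_le_0_iff)
  then show "plateau k a b x = 0" "plateau' k a b x = 0" by (auto simp: plateau_def plateau'_def)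
qed

lemma plateau'_bound:
  assumes "0 < k" shows "\<bar>plateau' k a b x\<bar> \<le> k"
proof -
  define p q where "p = ramp' (k * (x - a)) * ramp (k * (b - x))" and "q = ramp (k * (x - a)) * ramp' (k * (b - x))"
  have "p \<in> {0..1}" "q \<in> {0..1}" by (auto simp: p_def q_def ramp'_le_1 mult_le_one)
  then have "k * \<bar>p - q\<bar> \<le> k * 1" using assms by (intro mult_left_mono abs_diff_le_1) auto
  moreover have "plateau' k a b x = k * (p - q)" by (simp add: plateau'_def p_def q_def algebra_simps)
  ultimately show ?thesis using assms by (simp add: abs_mult)
qed

lemma plateau_has_derivative: "(plateau k a b has_real_derivative plateau' k a b x) (at x)"
  unfolding plateau_def[abs_def] plateau'_def by (auto intro!: derivative_eq_intros simp: algebra_simps)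

lemma borel_measurable_plateau [measurable]:
  "plateau k a b \<in> borel_measurable borel" "plateau' k a b \<in> borel_measurable borel"
  unfolding plateau_def[abs_def] plateau'_def[abs_def] by measurable

lemma plateau_tendsto_indicator: "(\<lambda>n. plateau (real (Suc n)) a b x) \<longlonglongrightarrow> indicator {a<..<b} x"
proof (cases "x \<in> {a<..<b}")
  case True
  have "(\<lambda>n. ramp (real (Suc n) * d)) \<longlonglongrightarrow> 1" if "0 < d" for d
  proof (rule filterlim_compose[OF ramp_tendsto_1])
    show "filterlim (\<lambda>n. real (Suc n) * d) at_top sequentially" using that by real_asymp
  qed
  then have "(\<lambda>n. ramp (real (Suc n) * (x - a)) * ramp (real (Suc n) * (b - x))) \<longlonglongrightarrow> 1 * 1"
    using True by (intro tendsto_mult) auto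
  then show ?thesis using True by (simp add: plateau_def)
qed (simp add: plateau_support)

text \<open>
  Each flank of the plateau becomes a point mass after the substitution that zooms in on its end point;
  the one-sided limits of \<open>E\<close> from inside \<open>(s, t)\<close> are enough.
\<close>

lemma plateau'_concentration:
  assumes [measurable]: "E \<in> borel_measurable borel" and B: "\<And>r. \<bar>E r\<bar> \<le> B" and "s < t"
    and lim_s: "(E \<longlongrightarrow> E s) (at_right s)" and lim_t: "(E \<longlongrightarrow> E t) (at_left t)"
  shows "(\<lambda>n. \<integral>r. plateau' (real (Suc n)) s t r * E r \<partial>lborel) \<longlonglongrightarrow> E s - E t"
proof -
  define m where "m n = real (Suc n)" for n
  have m: "0 < m n" for n by (simp add: m_def)
  let ?p = "\<lambda>n r. m n * (ramp' (m n * (r - s)) * ramp (m n * (t - r)))"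
  let ?q = "\<lambda>n r. m n * (ramp (m n * (r - s)) * ramp' (m n * (t - r)))"
  have int: "integrable lborel (\<lambda>r. ?p n r * E r)" "integrable lborel (\<lambda>r. ?q n r * E r)" for n
  proof -
    have out: "?p n r = 0" "?q n r = 0" if "r \<notin> {s..t}" for r
    proof -
      have "m n * (r - s) \<le> 0 \<or> m n * (t - r) \<le> 0" using that m[of n] by (auto simp: mult_le_0_iff)
      then show "?p n r = 0" "?q n r = 0" by auto
    qed
    have "\<bar>?p n r * E r\<bar> \<le> m n * (1 * 1) * B" "\<bar>?q n r * E r\<bar> \<le> m n * (1 * 1) * B" for r
      unfolding abs_mult using m[of n] B by (intro mult_mono; simp add: ramp'_le_1 mult_le_one)+
    then show "integrable lborel (\<lambda>r. ?p n r * E r)" "integrable lborel (\<lambda>r. ?q n r * E r)"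
      by (intro integrable_bounded_support[of _ "{s..t}" "m n * (1 * 1) * B"]; use out in force)+
  qed
  have p: "(LBINT r. ?p n r * E r) = (LBINT r. ramp' r * (ramp (real (Suc n) * (t - s) - r) * E (s + 1 * (r / real (Suc n)))))" for n
  proof -
    have "(LBINT r. ?p n r * E r) = \<bar>1 / m n\<bar> *\<^sub>R (LBINT r. ?p n (s + 1 / m n * r) * E (s + 1 / m n * r))"
      using m[of n] by (intro lborel_integral_real_affine) auto
    also have "\<dots> = (LBINT r. \<bar>1 / m n\<bar> * (?p n (s + 1 / m n * r) * E (s + 1 / m n * r)))" by simp
    also have "\<dots> = (LBINT r. ramp' r * (ramp (m n * (t - s) - r) * E (s + 1 * (r / m n))))"
    proof (intro Bochner_Integration.integral_cong refl)
      fix r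
      have e: "m n * (s + 1 / m n * r - s) = r" "m n * (t - (s + 1 / m n * r)) = m n * (t - s) - r"
        using m[of n] by (simp_all add: field_simps)
      show "\<bar>1 / m n\<bar> * (?p n (s + 1 / m n * r) * E (s + 1 / m n * r)) = ramp' r * (ramp (m n * (t - s) - r) * E (s + 1 * (r / m n)))"
        unfolding e using m[of n] by simp
    qed
    finally show ?thesis by (simp add: m_def)
  qed
  have q: "(LBINT r. ?q n r * E r) = (LBINT r. ramp' r * (ramp (real (Suc n) * (t - s) - r) * E (t + - 1 * (r / real (Suc n)))))" for n
  proof -
    have "(LBINT r. ?q n r * E r) = \<bar>- 1 / m n\<bar> *\<^sub>R (LBINT r. ?q n (t + - 1 / m n * r) * E (t + - 1 / m n * r))"
      using m[of n] by (intro lborel_integral_real_affine) auto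
    also have "\<dots> = (LBINT r. \<bar>- 1 / m n\<bar> * (?q n (t + - 1 / m n * r) * E (t + - 1 / m n * r)))" by simp
    also have "\<dots> = (LBINT r. ramp' r * (ramp (m n * (t - s) - r) * E (t + - 1 * (r / m n))))"
    proof (intro Bochner_Integration.integral_cong refl)
      fix r
      have e: "m n * (t + - 1 / m n * r - s) = m n * (t - s) - r" "m n * (t - (t + - 1 / m n * r)) = r"
        using m[of n] by (simp_all add: field_simps)
      show "\<bar>- 1 / m n\<bar> * (?q n (t + - 1 / m n * r) * E (t + - 1 / m n * r)) = ramp' r * (ramp (m n * (t - s) - r) * E (t + - 1 * (r / m n)))"
        unfolding e using m[of n] by simp
    qed
    finally show ?thesis by (simp add: m_def)
  qed
  have "filterlim (\<lambda>r. s + 1 * r) (at_right s) (at_right 0)"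
    unfolding filterlim_at by (auto simp: eventually_at_filter intro!: tendsto_eq_intros)
  then have p_lim: "(\<lambda>n. \<integral>r. ?p n r * E r \<partial>lborel) \<longlonglongrightarrow> E s"
    unfolding p using \<open>s < t\<close> by (intro ramp'_concentration[OF _ B] filterlim_compose[OF lim_s]) auto
  have "filterlim (\<lambda>r. t + - 1 * r) (at_left t) (at_right 0)"
    unfolding filterlim_at by (auto simp: eventually_at_filter intro!: tendsto_eq_intros)
  then have q_lim: "(\<lambda>n. \<integral>r. ?q n r * E r \<partial>lborel) \<longlonglongrightarrow> E t"
    unfolding q using \<open>s < t\<close> by (intro ramp'_concentration[OF _ B] filterlim_compose[OF lim_t]) auto
  have "(LBINT r. plateau' (real (Suc n)) s t r * E r) = (LBINT r. ?p n r * E r) - (LBINT r. ?q n r * E r)" for n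
    using int by (simp add: plateau'_def m_def left_diff_distrib)
  then show ?thesis using tendsto_diff[OF p_lim q_lim] by simp
qed

section \<open>The energy in a shrinking cone\<close>

text \<open>
  A smooth substitute for the indicator of the cone \<open>\<bar>x\<bar> < R - L t\<close>. As both factors are functions of
  \<open>R - L t \<plusminus> x\<close>, the weight decays in time at least \<open>L\<close> times as fast as it varies in space.
\<close>

definition cone_weight :: "real \<Rightarrow> real \<Rightarrow> real \<Rightarrow> real \<Rightarrow> real" where
  "cone_weight L R t x = ramp (R - L * t - x) * ramp (R - L * t + x)"

lemma cone_weight_bounds: "0 \<le> cone_weight L R t x" "cone_weight L R t x \<le> 1"
  by (auto simp: cone_weight_def mult_le_one)

lemma cone_weight_support:
  assumes "0 \<le> L" "0 \<le> t" "x \<notin> {-R..R}" shows "cone_weight L R t x = 0"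
proof -
  have "0 \<le> L * t" using assms by simp
  then have "R - L * t - x \<le> 0 \<or> R - L * t + x \<le> 0" using assms(3) by auto
  then show ?thesis by (auto simp: cone_weight_def)
qed

lemma borel_measurable_cone_weight [measurable]: "cone_weight L R t \<in> borel_measurable borel"
  unfolding cone_weight_def[abs_def] by measurable

lemma cone_weight_Lipschitz:
  assumes "0 \<le> L" shows "\<bar>cone_weight L R s x - cone_weight L R t x\<bar> \<le> 2 * L * \<bar>s - t\<bar>"
proof -
  have r: "\<bar>ramp (R - L * s + y) - ramp (R - L * t + y)\<bar> \<le> L * \<bar>s - t\<bar>" for y
    using ramp_Lipschitz[of "R - L * s + y" "R - L * t + y"] assms
    by (simp add: abs_mult[symmetric] algebra_simps abs_minus_commute) (metis abs_minus_commute abs_mult abs_of_nonneg right_diff_distrib)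
  have "cone_weight L R s x - cone_weight L R t x =
     (ramp (R - L * s + - x) - ramp (R - L * t + - x)) * ramp (R - L * s + x)
     + (ramp (R - L * s + x) - ramp (R - L * t + x)) * ramp (R - L * t + - x)"
    by (simp add: cone_weight_def algebra_simps)
  also have "\<bar>\<dots>\<bar> \<le> (L * \<bar>s - t\<bar>) * 1 + (L * \<bar>s - t\<bar>) * 1"
    by (intro abs_lincomb_le r) auto
  finally show ?thesis by simp
qed

definition cone_energy where
  "cone_energy N L R u v t = (LINT x|lebesgue. N (u t x) (v t x) * cone_weight L R t x)"

lemma
  fixes N :: "real \<Rightarrow> real \<Rightarrow> real"
  assumes u: "L1_loc_curve u" and v: "L1_loc_curve v" and Nm: "case_prod N \<in> borel_measurable borel"
    and N: "\<And>a b. a \<in> {0..1} \<Longrightarrow> b \<in> {0..1} \<Longrightarrow> N a b \<in> {0..1}" and L: "0 \<le> L" and t: "0 \<le> t"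
  shows cone_energy_integrand_measurable: "(\<lambda>x. N (u t x) (v t x) * cone_weight L R t x) \<in> borel_measurable lebesgue"
    and cone_energy_integrand_bound: "\<bar>N (u t x) (v t x) * cone_weight L R t x\<bar> \<le> 1"
    and cone_energy_integrand_integrable: "integrable lebesgue (\<lambda>x. N (u t x) (v t x) * cone_weight L R t x)"
proof -
  have "cone_weight L R t \<in> borel_measurable lebesgue" by (intro measurable_completion) simp
  then show m: "(\<lambda>x. N (u t x) (v t x) * cone_weight L R t x) \<in> borel_measurable lebesgue"
    using u v t by (intro borel_measurable_times borel_measurable_binary[OF Nm]) (auto simp: L1_loc_curve_def)
  have b: "\<bar>N (u t x) (v t x) * cone_weight L R t x\<bar> \<le> 1" for x
    using N[of "u t x" "v t x"] u v t cone_weight_bounds[of L R t x]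
    by (auto simp: L1_loc_curve_def abs_mult intro!: mult_le_one)
  then show "\<bar>N (u t x) (v t x) * cone_weight L R t x\<bar> \<le> 1" .
  show "integrable lebesgue (\<lambda>x. N (u t x) (v t x) * cone_weight L R t x)"
    by (rule integrable_lebesgue_bounded_support[OF m _ b, of "{-R..R}"])
      (simp_all add: cone_weight_support[OF L t] del: atLeastAtMost_iff)
qed

lemma cone_energy_continuous:
  fixes N :: "real \<Rightarrow> real \<Rightarrow> real"
  assumes u: "L1_loc_curve u" and v: "L1_loc_curve v" and Nm: "case_prod N \<in> borel_measurable borel"
    and N: "\<And>a b. a \<in> {0..1} \<Longrightarrow> b \<in> {0..1} \<Longrightarrow> N a b \<in> {0..1}"
    and N_lip: "\<And>a b a' b'. \<bar>N a b - N a' b'\<bar> \<le> \<bar>a - a'\<bar> + \<bar>b - b'\<bar>"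
    and L: "0 \<le> L" and t: "0 \<le> t"
  shows "(cone_energy N L R u v \<longlongrightarrow> cone_energy N L R u v t) (at t within {0..})"
  unfolding cone_energy_def[abs_def]
proof (rule continuous_integral_of_L1_loc_curves[OF u v t, where r = R and K = "2 * L"])
  fix s x :: real assume s: "0 \<le> s"
  let ?N = "\<lambda>s. N (u s x) (v s x)" and ?c = "\<lambda>s. cone_weight L R s x"
  have N01: "?N t \<in> {0..1}" using u v t by (intro N) (auto simp: L1_loc_curve_def)
  have "\<bar>(?N s - ?N t) * ?c s\<bar> \<le> (\<bar>u s x - u t x\<bar> + \<bar>v s x - v t x\<bar>) * 1"
    unfolding abs_mult using N_lip cone_weight_bounds[of L R s x] by (intro mult_mono) auto
  moreover have "\<bar>?N t * (?c s - ?c t)\<bar> \<le> 1 * (2 * L * \<bar>s - t\<bar>)"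
    unfolding abs_mult using N01 cone_weight_Lipschitz[OF L, of R s x t] by (intro mult_mono) auto
  moreover have d: "?N s * ?c s - ?N t * ?c t = (?N s - ?N t) * ?c s + ?N t * (?c s - ?c t)"
    by (simp add: algebra_simps)
  ultimately show "\<bar>?N s * ?c s - ?N t * ?c t\<bar> \<le> \<bar>u s x - u t x\<bar> + \<bar>v s x - v t x\<bar> + 2 * L * \<bar>s - t\<bar>"
    unfolding d by (intro order_trans[OF abs_triangle_ineq]) simp
next
  fix s x :: real assume s: "0 \<le> s"
  show "(\<lambda>x. N (u s x) (v s x) * cone_weight L R s x) \<in> borel_measurable lebesgue"
    by (rule cone_energy_integrand_measurable[OF u v Nm _ L s]) (rule N)
  show "\<bar>N (u s x) (v s x) * cone_weight L R s x\<bar> \<le> 1"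
    by (rule cone_energy_integrand_bound[OF u v Nm _ L s]) (rule N)
qed (simp_all add: cone_weight_support[OF L] del: atLeastAtMost_iff)

text \<open>
  The inequality for \<open>(N, F)\<close> tested with a plateau in time multiplied by the cone weight. With \<open>P\<close>
  and \<open>Q\<close> the contributions of the right and of the left flank, the weight has time derivative
  \<open>- L (P + Q)\<close> and space derivative \<open>Q - P\<close>. Splitting \<open>F = (F + H) - H\<close>, the first part is
  absorbed by the time derivative, and \<open>- H (Q - P) \<le> h P\<close>. The integral of \<open>P\<close> in \<open>x\<close> is at most
  \<open>1\<close>.
\<close>

lemma cone_energy_weak_estimate:
  fixes N F :: "real \<Rightarrow> real \<Rightarrow> real" and H :: "real \<Rightarrow> real"
  assumes u: "L1_loc_curve u" "borel_version u u'" and v: "L1_loc_curve v" "borel_version v v'"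
    and NF[measurable]: "case_prod N \<in> borel_measurable borel" "case_prod F \<in> borel_measurable borel"
    and N: "\<And>a b. a \<in> {0..1} \<Longrightarrow> b \<in> {0..1} \<Longrightarrow> N a b \<in> {0..1}"
    and N_lip: "\<And>a b a' b'. \<bar>N a b - N a' b'\<bar> \<le> \<bar>a - a'\<bar> + \<bar>b - b'\<bar>"
    and F: "\<And>a b. a \<in> {0..1} \<Longrightarrow> b \<in> {0..1} \<Longrightarrow> \<bar>F a b + H a\<bar> \<le> L * N a b"
    and H: "\<And>a. a \<in> {0..1} \<Longrightarrow> H a \<in> {0..h}" and L: "0 \<le> L"
    and diss: "dissipates (\<lambda>z. N (u' z) (v' z)) (\<lambda>z. F (u' z) (v' z))"
    and st: "0 \<le> s" "s < t" and k: "0 < k"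
  shows "0 \<le> (\<integral>\<tau>. plateau' k s t \<tau> * (indicator {0..} \<tau> *\<^sub>R cone_energy N L R u v \<tau>) \<partial>lborel) + (t - s) * h"
proof -
  note [measurable (raw)] = borel_measurable_binary[OF NF(1)] borel_measurable_binary[OF NF(2)]
  have u'r: "u' z \<in> {0..1}" and v'r: "v' z \<in> {0..1}" for z
    using u(2) v(2) unfolding borel_version_def by blast+
  have [measurable]: "u' \<in> borel_measurable borel" "v' \<in> borel_measurable borel"
    using u v by (auto simp: borel_version_def)
  have energy_meas: "(\<lambda>x. N (u \<tau> x) (v \<tau> x) * cone_weight L R \<tau> x) \<in> borel_measurable lebesgue" if "0 \<le> \<tau>" for \<tau>
    by (rule cone_energy_integrand_measurable[OF u(1) v(1) NF(1) _ L that]) (rule N)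
  have Nc: "\<bar>N (u' z) (v' z) * cone_weight L R \<tau> x\<bar> \<le> 1" for z \<tau> x
    using N[OF u'r[of z] v'r[of z]] cone_weight_bounds[of L R \<tau> x] by (auto simp: abs_mult intro!: mult_le_one)
  define E0 where "E0 \<tau> = indicator {0..} \<tau> *\<^sub>R cone_energy N L R u v \<tau>" for \<tau>
  have [measurable]: "E0 \<in> borel_measurable borel"
    unfolding E0_def[abs_def]
  proof (rule borel_measurable_continuous_on_indicator)
    show "continuous_on {0..} (cone_energy N L R u v)"
      unfolding continuous_on_def
    proof
      fix \<tau> :: real assume "\<tau> \<in> {0..}"
      then show "(cone_energy N L R u v \<longlongrightarrow> cone_energy N L R u v \<tau>) (at \<tau> within {0..})"
        by (intro cone_energy_continuous[OF u(1) v(1) NF(1) _ N_lip L] N) auto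
    qed
  qed simp
  \<comment> \<open>The contributions of the right and of the left flank of the cone.\<close>
  define P where "P \<tau> x = ramp' (R - L * \<tau> - x) * ramp (R - L * \<tau> + x)" for \<tau> x
  define Q where "Q \<tau> x = ramp (R - L * \<tau> - x) * ramp' (R - L * \<tau> + x)" for \<tau> x
  have Pm: "P \<tau> \<in> borel_measurable borel" for \<tau>
    unfolding P_def[abs_def] by measurable
  have PQ: "0 \<le> P \<tau> x" "0 \<le> Q \<tau> x" "P \<tau> x \<le> 1" for \<tau> x
    by (auto simp: P_def Q_def ramp'_le_1 mult_le_one)
  let ?W = "\<lambda>z. cone_weight L R (fst z) (snd z)"
  define \<psi> where "\<psi> z = plateau k s t (fst z) * ?W z" for z
  have \<psi>0: "0 \<le> \<psi> z" for z by (simp add: \<psi>_def plateau_bounds cone_weight_bounds)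
  have \<psi>: "test_function \<psi>"
  proof (rule test_functionI)
    show "C_k j \<psi>" for j
    proof -
      have "\<psi> = (\<lambda>z. (ramp (- k * s + k * fst z + 0 * snd z) * ramp (k * t + - k * fst z + 0 * snd z))
        * (ramp (R + - L * fst z + - 1 * snd z) * ramp (R + - L * fst z + 1 * snd z)))"
        by (auto simp: \<psi>_def plateau_def cone_weight_def algebra_simps)
      then show ?thesis by (auto intro!: C_k_mult C_k_flat_exp_affine simp only:)
    qed
    show "z \<in> cbox (s, -R) (t, R)" if "\<psi> z \<noteq> 0" for z
    proof -
      have "fst z \<in> {s<..<t}" using that plateau_support(1)[OF k, of "fst z" s t] by (auto simp: \<psi>_def)
      moreover from this have "snd z \<in> {-R..R}"
        using that cone_weight_support[OF L, of "fst z" "snd z" R] st(1) by (auto simp: \<psi>_def)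
      ultimately show ?thesis by (cases z) auto
    qed
  qed (rule bounded_cbox)
  have \<psi>t: "\<psi> z = 0" if "fst z \<le> 0" for z
    using that st(1) plateau_support(1)[OF k, of "fst z" s t] by (simp add: \<psi>_def)
  have td: "time_deriv \<psi> z = plateau' k s t (fst z) * ?W z - plateau k s t (fst z) * (L * (P (fst z) (snd z) + Q (fst z) (snd z)))" for z
    unfolding \<psi>_def[abs_def] cone_weight_def P_def Q_def
    by (rule time_deriv_eqI) (auto intro!: derivative_eq_intros plateau_has_derivative simp: algebra_simps)
  have sd: "space_deriv \<psi> z = plateau k s t (fst z) * (Q (fst z) (snd z) - P (fst z) (snd z))" for z
    unfolding \<psi>_def[abs_def] cone_weight_def P_def Q_def
    by (rule space_deriv_eqI) (auto intro!: derivative_eq_intros simp: algebra_simps)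
  let ?N = "\<lambda>z. N (u' z) (v' z)" and ?F = "\<lambda>z. F (u' z) (v' z)"
  have [measurable]: "?W \<in> borel_measurable borel" "(\<lambda>z. P (fst z) (snd z)) \<in> borel_measurable borel"
    unfolding cone_weight_def P_def by measurable
  note [measurable] = borel_measurable_time_deriv[OF \<psi>] borel_measurable_space_deriv[OF \<psi>]
  \<comment> \<open>The pointwise form of the estimate; only the nonnegative term \<open>H Q\<close> is discarded.\<close>
  have pt: "?N z * time_deriv \<psi> z + ?F z * space_deriv \<psi> z
    \<le> (plateau' k s t (fst z) * (?N z * ?W z)) + h * (plateau k s t (fst z) * P (fst z) (snd z))" for z
  proof -
    define p q where "p = P (fst z) (snd z)" and "q = Q (fst z) (snd z)"
    have pq: "0 \<le> p" "0 \<le> q" using PQ by (auto simp: p_def q_def)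
    have "?F z * (q - p) = (?F z + H (u' z)) * (q - p) + H (u' z) * p - H (u' z) * q"
      by (simp add: algebra_simps)
    also have "(?F z + H (u' z)) * (q - p) \<le> \<bar>?F z + H (u' z)\<bar> * \<bar>q - p\<bar>"
      by (metis abs_ge_self abs_mult)
    also have "\<dots> \<le> (L * ?N z) * (p + q)"
      using F[OF u'r[of z] v'r[of z]] pq by (intro mult_mono) auto
    also have "H (u' z) * p \<le> h * p" using H[OF u'r[of z]] pq by (intro mult_right_mono) auto
    finally have "?F z * (q - p) \<le> L * ?N z * (p + q) + h * p"
      using H[OF u'r[of z]] pq by (simp add: zero_le_mult_iff) (smt (verit) mult_nonneg_nonneg)
    then have "plateau k s t (fst z) * (?F z * (q - p)) \<le> plateau k s t (fst z) * (L * ?N z * (p + q) + h * p)"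
      using plateau_bounds(1) by (intro mult_left_mono)
    then show ?thesis by (simp add: td sd p_def[symmetric] q_def[symmetric] algebra_simps)
  qed
  have P_support: "P \<tau> x = 0" if "0 \<le> \<tau>" "x \<notin> {-R..R}" for \<tau> x
  proof -
    have "0 \<le> L * \<tau>" using L that by simp
    then have "R - L * \<tau> - x \<le> 0 \<or> R - L * \<tau> + x \<le> 0" using that(2) by auto
    then show ?thesis by (auto simp: P_def)
  qed
  have int_plane: "integrable lborel (\<lambda>z. f (fst z) * g z)"
    if [measurable]: "f \<in> borel_measurable borel" "g \<in> borel_measurable borel"
      and f: "\<And>\<tau>. \<bar>f \<tau>\<bar> \<le> B" "\<And>\<tau>. \<tau> \<notin> {s<..<t} \<Longrightarrow> f \<tau> = 0"
      and g: "\<And>z. \<bar>g z\<bar> \<le> 1" "\<And>\<tau> x. 0 \<le> \<tau> \<Longrightarrow> x \<notin> {-R..R} \<Longrightarrow> g (\<tau>, x) = 0"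
    for f :: "real \<Rightarrow> real" and g :: "real \<times> real \<Rightarrow> real" and B
  proof (rule integrable_bounded_support[of _ "cbox (s, -R) (t, R)" "B * 1"])
    have "0 \<le> B" using f(1)[of 0] by linarith
    then show "\<bar>f (fst z) * g z\<bar> \<le> B * 1" for z
      unfolding abs_mult by (intro mult_mono f g) auto
    show "f (fst z) * g z = 0" if "z \<notin> cbox (s, -R) (t, R)" for z
    proof (cases "fst z \<in> {s<..<t}")
      case True
      then have "0 \<le> fst z" "snd z \<notin> {-R..R}" using that st(1) by (cases z; auto)+
      then show ?thesis using g(2)[of "fst z" "snd z"] by simp
    qed (simp add: f)
  qed (simp_all add: bounded_cbox)
  have iN: "integrable lborel (\<lambda>z. plateau' k s t (fst z) * (?N z * ?W z))"
    by (rule int_plane[OF _ _ plateau'_bound[OF k]])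
      (simp_all add: plateau_support[OF k] Nc cone_weight_support[OF L] del: atLeastAtMost_iff greaterThanLessThan_iff)
  have iP: "integrable lborel (\<lambda>z. plateau k s t (fst z) * P (fst z) (snd z))"
    by (rule int_plane[OF _ _ plateau_bounds(3)])
      (simp_all add: plateau_support[OF k] PQ P_support del: atLeastAtMost_iff greaterThanLessThan_iff)
  have "0 \<le> h" using H[of 0] by simp
  have "0 \<le> (LBINT z. ?N z * time_deriv \<psi> z + ?F z * space_deriv \<psi> z)"
    by (rule dissipatesD[OF diss \<psi> \<psi>0 \<psi>t])
  also have "\<dots> \<le> (LBINT z. (plateau' k s t (fst z) * (?N z * ?W z)) + h * (plateau k s t (fst z) * P (fst z) (snd z)))"
  proof (rule integral_mono[OF _ _ pt])
    obtain K C where K: "compact K" and C: "\<And>z. \<bar>time_deriv \<psi> z\<bar> \<le> C" "\<And>z. \<bar>space_deriv \<psi> z\<bar> \<le> C"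
      and out: "\<And>z. z \<notin> K \<Longrightarrow> time_deriv \<psi> z = 0" "\<And>z. z \<notin> K \<Longrightarrow> space_deriv \<psi> z = 0"
      using test_function_bounds[OF \<psi>] by metis
    have NF_bound: "\<bar>?N z\<bar> \<le> 1 + L + h" "\<bar>?F z\<bar> \<le> 1 + L + h" for z
    proof -
      have "?N z \<in> {0..1}" "H (u' z) \<in> {0..h}" "\<bar>?F z + H (u' z)\<bar> \<le> L * ?N z"
        using N F H u'r v'r by blast+
      moreover from this have "L * ?N z \<le> L" using L by (simp add: mult_left_le)
      ultimately show "\<bar>?N z\<bar> \<le> 1 + L + h" "\<bar>?F z\<bar> \<le> 1 + L + h"
        using L \<open>0 \<le> h\<close> by auto
    qed
    show "integrable lborel (\<lambda>z. ?N z * time_deriv \<psi> z + ?F z * space_deriv \<psi> z)"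
      by (rule integrable_bounded_support[OF _ compact_imp_bounded[OF K] abs_lincomb_le[OF NF_bound C]])
        (simp_all add: out)
  qed (intro Bochner_Integration.integrable_add integrable_mult_right iN iP)
  also have "\<dots> = (LBINT z. plateau' k s t (fst z) * (?N z * ?W z)) + h * (LBINT z. plateau k s t (fst z) * P (fst z) (snd z))"
    using iN iP by simp
  also have "(LBINT z. plateau' k s t (fst z) * (?N z * ?W z))
      = (\<integral>\<tau>. plateau' k s t \<tau> * E0 \<tau> \<partial>lborel)"
  proof -
    note borel_version_slices[OF u(2)]
    moreover note borel_version_slices[OF v(2)]
    ultimately have ae: "AE \<tau> in lborel. (LBINT x. plateau' k s t \<tau> * (N (u' (\<tau>, x)) (v' (\<tau>, x)) * cone_weight L R \<tau> x))
        = plateau' k s t \<tau> * E0 \<tau>"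
    proof eventually_elim
      case (elim \<tau>)
      show ?case
      proof (cases "0 \<le> \<tau>")
        case True
        have [measurable]: "(\<lambda>x. u' (\<tau>, x)) \<in> borel_measurable borel" "(\<lambda>x. v' (\<tau>, x)) \<in> borel_measurable borel"
          by (rule measurable_compose[of "Pair \<tau>" borel borel]; auto intro!: borel_measurable_continuous_onI continuous_intros)+
        have [measurable]: "(\<lambda>x. N (u' (\<tau>, x)) (v' (\<tau>, x)) * cone_weight L R \<tau> x) \<in> borel_measurable borel" by measurable
        have "AE x in lebesgue. N (u' (\<tau>, x)) (v' (\<tau>, x)) * cone_weight L R \<tau> x = N (u \<tau> x) (v \<tau> x) * cone_weight L R \<tau> x"
        proof (rule AE_completion)
          from elim True have "AE x in lborel. u \<tau> x = u' (\<tau>, x)" "AE x in lborel. v \<tau> x = v' (\<tau>, x)" by auto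
          then show "AE x in lborel. N (u' (\<tau>, x)) (v' (\<tau>, x)) * cone_weight L R \<tau> x = N (u \<tau> x) (v \<tau> x) * cone_weight L R \<tau> x"
            by eventually_elim simp
        qed
        then have "(LINT x|lebesgue. N (u' (\<tau>, x)) (v' (\<tau>, x)) * cone_weight L R \<tau> x) = cone_energy N L R u v \<tau>"
          unfolding cone_energy_def using energy_meas[OF True] by (intro integral_cong_AE) (auto intro: measurable_completion)
        then have "(LBINT x. N (u' (\<tau>, x)) (v' (\<tau>, x)) * cone_weight L R \<tau> x) = E0 \<tau>"
          by (simp add: integral_completion E0_def True)
        then show ?thesis by simp
      next
        case False
        then show ?thesis using st(1) by (simp add: plateau_support[OF k])
      qed
    qed
    have "(LBINT z. plateau' k s t (fst z) * (?N z * ?W z))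
       = (\<integral>\<tau>. (LBINT x. plateau' k s t \<tau> * (N (u' (\<tau>, x)) (v' (\<tau>, x)) * cone_weight L R \<tau> x)) \<partial>lborel)"
      using lborel_pair.integral_fst'[of "\<lambda>z. plateau' k s t (fst z) * (?N z * ?W z)"] iN by (simp add: lborel_prod)
    also have "\<dots> = (\<integral>\<tau>. plateau' k s t \<tau> * E0 \<tau> \<partial>lborel)"
    proof (rule integral_cong_AE[OF _ _ ae])
      show "(\<lambda>\<tau>. \<integral>x. plateau' k s t \<tau> * (N (u' (\<tau>, x)) (v' (\<tau>, x)) * cone_weight L R \<tau> x) \<partial>lborel) \<in> borel_measurable lborel"
        using lborel_pair.integrable_fst'[of "\<lambda>z. plateau' k s t (fst z) * (?N z * ?W z)"] iN
        by (simp add: lborel_prod borel_measurable_integrable)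
    qed simp
    finally show ?thesis .
  qed
  also have "h * (LBINT z. plateau k s t (fst z) * P (fst z) (snd z)) \<le> h * (t - s)"
  proof (rule mult_left_mono[OF _ \<open>0 \<le> h\<close>])
    have iramp: "integrable lborel ramp'" "(LBINT r. ramp' r) = 1"
      using has_bochner_integral_ramp' by (auto simp: has_bochner_integral_iff)
    have "integrable lborel (\<lambda>\<tau>. \<integral>x. plateau k s t \<tau> * P \<tau> x \<partial>lborel)"
      using lborel_pair.integrable_fst'[of "\<lambda>z. plateau k s t (fst z) * P (fst z) (snd z)"] iP by (simp add: lborel_prod)
    moreover have "(LBINT x. plateau k s t \<tau> * P \<tau> x) \<le> indicator {s..t} \<tau>" for \<tau>
    proof (cases "\<tau> \<in> {s<..<t}")
      case True
      have i: "integrable lborel (\<lambda>x. ramp' ((R - L * \<tau>) + (- 1) * x))"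
        by (rule lborel_integrable_real_affine[OF iramp(1)]) simp
      have "(LBINT x. P \<tau> x) \<le> (LBINT x. ramp' ((R - L * \<tau>) + (- 1) * x))"
      proof (rule integral_mono[OF _ i])
        show "integrable lborel (P \<tau>)"
          by (rule integrable_bounded_support[of _ "{-R..R}" 1])
            (use True st(1) in \<open>simp_all add: Pm P_support PQ del: atLeastAtMost_iff\<close>)
        show "P \<tau> x \<le> ramp' ((R - L * \<tau>) + (- 1) * x)" for x by (simp add: P_def mult_left_le)
      qed
      also have "\<dots> = 1"
        using lborel_integral_real_affine[of "-1" ramp' "R - L * \<tau>"] iramp(2) by simp
      finally have "plateau k s t \<tau> * (LBINT x. P \<tau> x) \<le> 1 * 1"
        using plateau_bounds[of k s t \<tau>] PQ by (intro mult_mono) auto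
      then show ?thesis using True by simp
    qed (simp add: plateau_support[OF k])
    ultimately have "(\<integral>\<tau>. (LBINT x. plateau k s t \<tau> * P \<tau> x) \<partial>lborel) \<le> (\<integral>\<tau>. indicator {s..t} \<tau> \<partial>lborel)"
      using \<open>s < t\<close> by (intro integral_mono) auto
    then show "(LBINT z. plateau k s t (fst z) * P (fst z) (snd z)) \<le> t - s"
      using lborel_pair.integral_fst'[of "\<lambda>z. plateau k s t (fst z) * P (fst z) (snd z)"] iP \<open>s < t\<close> by (simp add: lborel_prod)
  qed
  finally show ?thesis by (simp add: mult.commute E0_def)
qed

text \<open>
  When the plateau in time becomes the indicator of \<open>(s, t)\<close>, its derivative picks out the energies at
  the two end points. The energy is continuous on \<open>[0, \<infinity>)\<close>, so that \<open>s = 0\<close> is included.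
\<close>

lemma cone_estimate:
  fixes N F :: "real \<Rightarrow> real \<Rightarrow> real" and H :: "real \<Rightarrow> real"
  assumes u: "L1_loc_curve u" "borel_version u u'" and v: "L1_loc_curve v" "borel_version v v'"
    and NF[measurable]: "case_prod N \<in> borel_measurable borel" "case_prod F \<in> borel_measurable borel"
    and N: "\<And>a b. a \<in> {0..1} \<Longrightarrow> b \<in> {0..1} \<Longrightarrow> N a b \<in> {0..1}"
    and N_lip: "\<And>a b a' b'. \<bar>N a b - N a' b'\<bar> \<le> \<bar>a - a'\<bar> + \<bar>b - b'\<bar>"
    and F: "\<And>a b. a \<in> {0..1} \<Longrightarrow> b \<in> {0..1} \<Longrightarrow> \<bar>F a b + H a\<bar> \<le> L * N a b"
    and H: "\<And>a. a \<in> {0..1} \<Longrightarrow> H a \<in> {0..h}" and L: "0 \<le> L"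
    and diss: "dissipates (\<lambda>z. N (u' z) (v' z)) (\<lambda>z. F (u' z) (v' z))"
    and st: "0 \<le> s" "s \<le> t"
  shows "cone_energy N L R u v t \<le> cone_energy N L R u v s + (t - s) * h"
proof (cases "s = t")
  case False
  then have "s < t" using st by simp
  let ?E = "cone_energy N L R u v"
  define E0 where "E0 \<tau> = indicator {0..} \<tau> *\<^sub>R ?E \<tau>" for \<tau>
  have cont: "(?E \<longlongrightarrow> ?E \<tau>) (at \<tau> within {0..})" if "0 \<le> \<tau>" for \<tau>
    by (rule cone_energy_continuous[OF u(1) v(1) NF(1) _ N_lip L that]) (rule N)
  have E0m: "E0 \<in> borel_measurable borel"
    unfolding E0_def[abs_def] using cont
    by (intro borel_measurable_continuous_on_indicator) (auto simp: continuous_on_def)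
  have E0: "E0 \<tau> = ?E \<tau>" if "0 \<le> \<tau>" for \<tau> using that by (simp add: E0_def)
  have E0_bound: "\<bar>E0 \<tau>\<bar> \<le> measure lebesgue {-R..R}" for \<tau>
  proof (cases "0 \<le> \<tau>")
    case True
    show ?thesis
      unfolding E0[OF True] cone_energy_def
    proof (rule abs_integral_le_measure_support)
      show "(\<lambda>x. N (u \<tau> x) (v \<tau> x) * cone_weight L R \<tau> x) \<in> borel_measurable lebesgue"
        by (rule cone_energy_integrand_measurable[OF u(1) v(1) NF(1) _ L True]) (rule N)
      show "\<bar>N (u \<tau> x) (v \<tau> x) * cone_weight L R \<tau> x\<bar> \<le> 1" for x
        by (rule cone_energy_integrand_bound[OF u(1) v(1) NF(1) _ L True]) (rule N)
    qed (simp add: cone_weight_support[OF L True] del: atLeastAtMost_iff)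
  qed (simp add: E0_def)
  have E0_lim: "(E0 \<longlongrightarrow> E0 \<tau>) (at \<tau> within {0..})" if "0 \<le> \<tau>" for \<tau>
    unfolding E0[OF that] by (rule Lim_transform_eventually[OF cont[OF that]]) (auto simp: eventually_at_filter E0)
  have lim: "(\<lambda>n. \<integral>\<tau>. plateau' (real (Suc n)) s t \<tau> * E0 \<tau> \<partial>lborel) \<longlonglongrightarrow> E0 s - E0 t"
  proof (rule plateau'_concentration[OF E0m E0_bound \<open>s < t\<close>])
    show "(E0 \<longlongrightarrow> E0 s) (at_right s)"
      by (rule tendsto_within_subset[OF E0_lim[OF st(1)]]) (use st(1) in auto)
    have "0 < t" using st(1) \<open>s < t\<close> by simp
    then have "at t within {0..} = at t" by (intro at_within_interior) simp
    then show "(E0 \<longlongrightarrow> E0 t) (at_left t)"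
      using E0_lim[of t] \<open>0 < t\<close> by (simp add: filterlim_at_split)
  qed
  have "0 \<le> (\<integral>\<tau>. plateau' (real (Suc n)) s t \<tau> * E0 \<tau> \<partial>lborel) + (t - s) * h" for n
    unfolding E0_def
    by (rule cone_energy_weak_estimate[OF u v NF _ N_lip _ _ L diss st(1) \<open>s < t\<close>, where H = H]) (simp_all add: N F H del: atLeastAtMost_iff)
  then have "0 \<le> E0 s - E0 t + (t - s) * h"
    by (intro LIMSEQ_le_const[OF tendsto_add[OF lim tendsto_const]]) auto
  then show ?thesis using E0[of s] E0[of t] st by simp
qed simp

section \<open>Entropy solutions in terms of Borel versions\<close>

text \<open>
  Fluxes are only given on \<open>[0, 1]\<close>; composed with this function they become continuous, and hence
  Borel, on the whole line.
\<close>

definition clamp01 :: "real \<Rightarrow> real" where "clamp01 a = max 0 (min 1 a)"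

lemma clamp01_in: "clamp01 a \<in> {0..1}" by (auto simp: clamp01_def)

lemma clamp01_id: "a \<in> {0..1} \<Longrightarrow> clamp01 a = a" by (auto simp: clamp01_def)

lemma continuous_clamp01: "continuous_on UNIV clamp01"
  unfolding clamp01_def[abs_def] by (intro continuous_intros)

lemma borel_measurable_clamp01 [measurable]: "clamp01 \<in> borel_measurable borel"
  by (rule borel_measurable_continuous_onI[OF continuous_clamp01])

lemma entropy_solution_L1_loc_curve: "entropy_solution \<Lambda> u0 u \<Longrightarrow> L1_loc_curve u"
  by (auto simp: entropy_solution_def L1_loc_curve_def)

lemma borel_measurable_extend_by_0:
  assumes "(\<lambda>(t, x). u t x) \<in> borel_measurable (lebesgue_on ({0..} \<times> UNIV))"
  shows "(\<lambda>z. if z \<in> {0..} \<times> UNIV then u (fst z) (snd z) else 0 :: real) \<in> borel_measurable (lebesgue :: (real \<times> real) measure)"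
proof -
  have "closed ({0..} \<times> UNIV :: (real \<times> real) set)" by (intro closed_Times) auto
  then have "({0..} \<times> UNIV :: (real \<times> real) set) \<in> sets lebesgue" by simp
  then show ?thesis using assms by (subst borel_measurable_if) (simp_all add: split_beta')
qed

lemma exists_borel_version:
  assumes "entropy_solution \<Lambda> u0 u"
  obtains w where "borel_version u w"
proof -
  let ?S = "{0..} \<times> UNIV :: (real \<times> real) set"
  have u: "u t x \<in> {0..1}" if "0 \<le> t" for t x using assms that by (auto simp: entropy_solution_def)
  have "(\<lambda>z. if z \<in> ?S then u (fst z) (snd z) else 0) \<in> borel_measurable lebesgue"
    using assms by (intro borel_measurable_extend_by_0) (simp add: entropy_solution_def)
  then obtain g where g[measurable]: "g \<in> borel_measurable lborel"
    and ae: "AE z in lborel. (if z \<in> ?S then u (fst z) (snd z) else 0) = g z"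
    using completion_ex_borel_measurable_real by blast
  have [measurable]: "g \<in> borel_measurable borel" using g by simp
  define w where "w z = indicator {0..} (fst z) * clamp01 (g z)" for z
  have "borel_version u w"
    unfolding borel_version_def
  proof (intro conjI allI)
    show "w \<in> borel_measurable borel" unfolding w_def[abs_def] by measurable
    show "w z \<in> {0..1}" for z using clamp01_in[of "g z"] by (auto simp: w_def indicator_def)
    show "fst z < 0 \<longrightarrow> w z = 0" for z by (auto simp: w_def)
    show "AE z in lborel. 0 \<le> fst z \<longrightarrow> u (fst z) (snd z) = w z"
      using ae
    proof eventually_elim
      case (elim z)
      show ?case
      proof
        assume z: "0 \<le> fst z"
        then have "g z = u (fst z) (snd z)" using elim by (cases z) auto
        then show "u (fst z) (snd z) = w z" using z clamp01_id[OF u[OF z]] by (simp add: w_def)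
      qed
    qed
  qed
  then show thesis by (rule that)
qed

text \<open>
  The integrals that define entropy solutions are Lebesgue integrals over \<open>t \<ge> 0\<close> of the solution
  itself; here they are rewritten for a Borel version, and for functions \<open>f'\<close> and \<open>g'\<close> that are Borel
  on the whole line.
\<close>

lemma set_integral_borel_version:
  assumes es: "entropy_solution \<Lambda> u0 u" and w: "borel_version u w" and \<phi>: "test_function \<phi>"
    and [measurable]: "f' \<in> borel_measurable borel" "g' \<in> borel_measurable borel"
    and fg: "\<And>a. a \<in> {0..1} \<Longrightarrow> f a = f' a" "\<And>a. a \<in> {0..1} \<Longrightarrow> g a = g' a"
  shows "(LINT (t, x):{0..} \<times> UNIV|lebesgue. f (u t x) * time_deriv \<phi> (t, x) + g (u t x) * space_deriv \<phi> (t, x))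
    = (LBINT z. indicator {0..} (fst z) * (f' (w z) * time_deriv \<phi> z + g' (w z) * space_deriv \<phi> z))"
proof -
  let ?S = "{0..} \<times> UNIV :: (real \<times> real) set"
  define uu where "uu z = (if z \<in> ?S then u (fst z) (snd z) else 0)" for z
  have u: "u t x \<in> {0..1}" if "0 \<le> t" for t x using es that by (auto simp: entropy_solution_def)
  have fu: "f (u t x) = f' (u t x)" "g (u t x) = g' (u t x)" if "0 \<le> t" for t x
    using fg u[OF that] by blast+
  have [measurable]: "uu \<in> borel_measurable lebesgue"
    unfolding uu_def[abs_def] using es by (intro borel_measurable_extend_by_0) (simp add: entropy_solution_def)
  have [measurable]: "w \<in> borel_measurable borel" using w by (simp add: borel_version_def)
  note [measurable] = borel_measurable_time_deriv[OF \<phi>] borel_measurable_space_deriv[OF \<phi>]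
  have m1: "(\<lambda>z. indicator {0..} (fst z) * (f' (w z) * time_deriv \<phi> z + g' (w z) * space_deriv \<phi> z)) \<in> borel_measurable borel"
    by measurable
  have [measurable]: "time_deriv \<phi> \<in> borel_measurable lebesgue" "space_deriv \<phi> \<in> borel_measurable lebesgue"
    "(\<lambda>z. indicator {0..} (fst z) :: real) \<in> borel_measurable (lebesgue :: (real \<times> real) measure)"
    by (rule measurable_completion, measurable)+
  have "(LINT (t, x):?S|lebesgue. f (u t x) * time_deriv \<phi> (t, x) + g (u t x) * space_deriv \<phi> (t, x))
      = (LINT z|lebesgue. indicator {0..} (fst z) * (f' (uu z) * time_deriv \<phi> z + g' (uu z) * space_deriv \<phi> z))"
    unfolding set_lebesgue_integral_def
    by (intro Bochner_Integration.integral_cong) (auto simp: indicator_def uu_def fu)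
  also have "\<dots> = (LINT z|lebesgue. indicator {0..} (fst z) * (f' (w z) * time_deriv \<phi> z + g' (w z) * space_deriv \<phi> z))"
  proof (rule integral_cong_AE)
    show "(\<lambda>z. indicator {0..} (fst z) * (f' (w z) * time_deriv \<phi> z + g' (w z) * space_deriv \<phi> z)) \<in> borel_measurable lebesgue"
      using m1 by (intro measurable_completion) simp
    have "AE z in lborel. 0 \<le> fst z \<longrightarrow> u (fst z) (snd z) = w z" using w by (simp add: borel_version_def)
    then have "AE z in lebesgue. 0 \<le> fst z \<longrightarrow> u (fst z) (snd z) = w z" by (rule AE_completion)
    then show "AE z in lebesgue. indicator {0..} (fst z) * (f' (uu z) * time_deriv \<phi> z + g' (uu z) * space_deriv \<phi> z)
        = indicator {0..} (fst z) * (f' (w z) * time_deriv \<phi> z + g' (w z) * space_deriv \<phi> z)"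
    proof eventually_elim
      case (elim z) then show ?case by (cases z) (auto simp: uu_def indicator_def)
    qed
  qed measurable
  also have "\<dots> = (LBINT z. indicator {0..} (fst z) * (f' (w z) * time_deriv \<phi> z + g' (w z) * space_deriv \<phi> z))"
    by (rule integral_completion) (use m1 in simp)
  finally show ?thesis .
qed

lemma set_integral_borel_version_interior:
  assumes es: "entropy_solution \<Lambda> u0 u" and w: "borel_version u w" and \<phi>: "test_function \<phi>"
    and meas: "f' \<in> borel_measurable borel" "g' \<in> borel_measurable borel"
    and fg: "\<And>a. a \<in> {0..1} \<Longrightarrow> f a = f' a" "\<And>a. a \<in> {0..1} \<Longrightarrow> g a = g' a"
    and past: "\<And>z. fst z \<le> 0 \<Longrightarrow> \<phi> z = 0"
  shows "(LINT (t, x):{0..} \<times> UNIV|lebesgue. f (u t x) * time_deriv \<phi> (t, x) + g (u t x) * space_deriv \<phi> (t, x))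
    = (LBINT z. f' (w z) * time_deriv \<phi> z + g' (w z) * space_deriv \<phi> z)"
proof -
  have "indicator {0..} (fst z) * (f' (w z) * time_deriv \<phi> z + g' (w z) * space_deriv \<phi> z)
      = f' (w z) * time_deriv \<phi> z + g' (w z) * space_deriv \<phi> z" for z
    using time_deriv_past[where z = z and \<phi> = \<phi>, OF past] space_deriv_past[where z = z and \<phi> = \<phi>, OF past] by (cases "0 \<le> fst z") auto
  then have "(LBINT z. indicator {0..} (fst z) * (f' (w z) * time_deriv \<phi> z + g' (w z) * space_deriv \<phi> z))
      = (LBINT z. f' (w z) * time_deriv \<phi> z + g' (w z) * space_deriv \<phi> z)" by presburger
  with set_integral_borel_version[OF es w \<phi> meas fg] show ?thesis by (rule trans)
qed

text \<open>
  The boundary terms vanish for test functions that are \<open>0\<close> at time \<open>0\<close>. The weak formulation is an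
  equation, and gives an inequality for either sign.
\<close>

lemma
  fixes u :: "real \<Rightarrow> real \<Rightarrow> real"
  assumes es: "entropy_solution \<Lambda> u0 u" and w: "borel_version u w"
    and \<Lambda>: "continuous_on {0..1} \<Lambda>"
  defines "\<Lambda>c \<equiv> \<lambda>a. \<Lambda> (clamp01 a)"
  shows entropy_solution_dissipates:
      "c \<in> {0..1} \<Longrightarrow> dissipates (\<lambda>z. \<bar>w z - c\<bar>) (\<lambda>z. sgn (w z - c) * (\<Lambda>c (w z) - \<Lambda>c c))"
    and entropy_solution_dissipates_weak: "dissipates w (\<lambda>z. \<Lambda>c (w z))"
    and entropy_solution_dissipates_weak_minus: "dissipates (\<lambda>z. - w z) (\<lambda>z. - \<Lambda>c (w z))"
proof -
  have "continuous_on UNIV \<Lambda>c"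
    unfolding \<Lambda>c_def by (rule continuous_on_compose2[OF \<Lambda> continuous_clamp01]) (use clamp01_in in blast)
  then have [measurable]: "\<Lambda>c \<in> borel_measurable borel" by (rule borel_measurable_continuous_onI)
  have \<Lambda>c: "\<Lambda> a = \<Lambda>c a" if "a \<in> {0..1}" for a using clamp01_id[OF that] by (simp add: \<Lambda>c_def)
  show "dissipates (\<lambda>z. \<bar>w z - c\<bar>) (\<lambda>z. sgn (w z - c) * (\<Lambda>c (w z) - \<Lambda>c c))" if c: "c \<in> {0..1}"
  proof (rule dissipatesI)
    fix \<phi> assume \<phi>: "test_function \<phi>" and nn: "\<And>z. 0 \<le> \<phi> z" and past: "\<And>z. fst z \<le> 0 \<Longrightarrow> \<phi> z = (0::real)"
    have "0 \<le> (LINT (t, x):{0..} \<times> UNIV|lebesgue.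
              \<bar>u t x - c\<bar> * time_deriv \<phi> (t, x)
              + sgn (u t x - c) * (\<Lambda> (u t x) - \<Lambda> c) * space_deriv \<phi> (t, x))
          + (LINT x|lebesgue. \<bar>u0 x - c\<bar> * \<phi> (0, x))"
      using es c \<phi> nn unfolding entropy_solution_def kruzkov_entropy_condition_def by blast
    also have "(LINT x|lebesgue. \<bar>u0 x - c\<bar> * \<phi> (0, x)) = 0" by (simp add: past)
    also have "(LINT (t, x):{0..} \<times> UNIV|lebesgue.
              \<bar>u t x - c\<bar> * time_deriv \<phi> (t, x)
              + sgn (u t x - c) * (\<Lambda> (u t x) - \<Lambda> c) * space_deriv \<phi> (t, x))
        = (LBINT z. \<bar>w z - c\<bar> * time_deriv \<phi> z + sgn (w z - c) * (\<Lambda>c (w z) - \<Lambda>c c) * space_deriv \<phi> z)"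
      by (rule set_integral_borel_version_interior[OF es w \<phi>]) (auto simp: \<Lambda>c[OF c, symmetric] \<Lambda>c past)
    finally show "0 \<le> (LBINT z. \<bar>w z - c\<bar> * time_deriv \<phi> z + sgn (w z - c) * (\<Lambda>c (w z) - \<Lambda>c c) * space_deriv \<phi> z)"
      by simp
  qed
  have weak: "(LBINT z. w z * time_deriv \<phi> z + \<Lambda>c (w z) * space_deriv \<phi> z) = 0"
    if \<phi>: "test_function \<phi>" and past: "\<And>z. fst z \<le> 0 \<Longrightarrow> \<phi> z = (0::real)" for \<phi>
  proof -
    have "(LINT (t, x):{0..} \<times> UNIV|lebesgue. u t x * time_deriv \<phi> (t, x) + \<Lambda> (u t x) * space_deriv \<phi> (t, x))
      + (LINT x|lebesgue. u0 x * \<phi> (0, x)) = 0"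
      using es \<phi> unfolding entropy_solution_def weak_solution_def by blast
    moreover have "(LINT x|lebesgue. u0 x * \<phi> (0, x)) = 0" by (simp add: past)
    moreover have "(LINT (t, x):{0..} \<times> UNIV|lebesgue. u t x * time_deriv \<phi> (t, x) + \<Lambda> (u t x) * space_deriv \<phi> (t, x))
       = (LBINT z. w z * time_deriv \<phi> z + \<Lambda>c (w z) * space_deriv \<phi> z)"
      by (rule set_integral_borel_version_interior[OF es w \<phi>, of "\<lambda>a. a"]) (auto simp: \<Lambda>c past)
    ultimately show ?thesis by simp
  qed
  show "dissipates w (\<lambda>z. \<Lambda>c (w z))" by (rule dissipatesI) (simp add: weak)
  show "dissipates (\<lambda>z. - w z) (\<lambda>z. - \<Lambda>c (w z))"
  proof (rule dissipatesI)
    fix \<phi> assume \<phi>: "test_function \<phi>" and past: "\<And>z. fst z \<le> 0 \<Longrightarrow> \<phi> z = (0::real)"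
    have "(LBINT z. - w z * time_deriv \<phi> z + - \<Lambda>c (w z) * space_deriv \<phi> z)
       = - (LBINT z. w z * time_deriv \<phi> z + \<Lambda>c (w z) * space_deriv \<phi> z)"
      by (subst Bochner_Integration.integral_minus[symmetric]) (simp add: algebra_simps)
    then show "0 \<le> (LBINT z. - w z * time_deriv \<phi> z + - \<Lambda>c (w z) * space_deriv \<phi> z)"
      using weak[OF \<phi> past] by simp
  qed
qed

section \<open>The initial datum\<close>

text \<open>
  The weak formulation is tested with \<open>g (m t)\<close> times a plateau in \<open>x\<close>, where \<open>g\<close> is a bump around
  \<open>0\<close> and \<open>m \<rightarrow> \<infinity>\<close>. The time derivative concentrates on \<open>t = 0\<close> and gives \<open>- g 0\<close> times the
  pairing of \<open>u 0\<close> by continuity in time, the flux term lives on a strip of width \<open>1 / m\<close> and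
  disappears, and the boundary term is \<open>g 0\<close> times the pairing of \<open>u0\<close>.
\<close>

lemma entropy_solution_initial_pairing:
  assumes es: "entropy_solution \<Lambda> u0 u" and \<Lambda>: "continuous_on {0..1} \<Lambda>" and k: "0 < k"
  shows "(LINT x|lebesgue. u 0 x * plateau k a b x) = (LINT x|lebesgue. u0 x * plateau k a b x)"
proof -
  obtain w where w: "borel_version u w" using exists_borel_version[OF es] .
  have curve: "L1_loc_curve u" using es by (rule entropy_solution_L1_loc_curve)
  have ur: "u t x \<in> {0..1}" if "0 \<le> t" for t x using curve that by (auto simp: L1_loc_curve_def)
  have um: "u t \<in> borel_measurable lebesgue" if "0 \<le> t" for t using curve that by (auto simp: L1_loc_curve_def)
  have wm[measurable]: "w \<in> borel_measurable borel" and wr: "w z \<in> {0..1}" for z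
    using w unfolding borel_version_def by blast+
  define f where "f c = \<Lambda> (clamp01 c)" for c
  have "continuous_on UNIV f"
    unfolding f_def[abs_def] by (rule continuous_on_compose2[OF \<Lambda> continuous_clamp01]) (use clamp01_in in blast)
  then have fm[measurable]: "f \<in> borel_measurable borel" by (rule borel_measurable_continuous_onI)
  have "compact (\<Lambda> ` {0..1})" by (intro compact_continuous_image \<Lambda> compact_Icc)
  then obtain C where "\<And>y. y \<in> \<Lambda> ` {0..1} \<Longrightarrow> norm y \<le> C"
    using compact_imp_bounded bounded_iff by metis
  then have C: "\<bar>f c\<bar> \<le> C" for c using clamp01_in[of c] by (simp add: f_def)
  let ?\<eta> = "plateau k a b"
  define r where "r = \<bar>a\<bar> + \<bar>b\<bar>"
  have r: "?\<eta> x = 0" if "x \<notin> {-r..r}" for x using that by (intro plateau_support k) (auto simp: r_def)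
  let ?\<eta>' = "plateau' k a b"
  have r': "?\<eta>' x = 0" if "x \<notin> {-r..r}" for x using that by (intro plateau_support k) (auto simp: r_def)
  \<comment> \<open>A smooth even bump, positive at \<open>0\<close>, that vanishes for \<open>\<bar>s\<bar> \<ge> 1\<close>.\<close>
  define g where "g s = ramp (1 + s) * ramp (1 - s)" for s
  define g' where "g' s = ramp' (1 + s) * ramp (1 - s) - ramp (1 + s) * ramp' (1 - s)" for s
  have [measurable]: "g \<in> borel_measurable borel" "g' \<in> borel_measurable borel"
    unfolding g_def[abs_def] g'_def[abs_def] by measurable
  have dg: "(g has_real_derivative g' s) (at s)" for s
    unfolding g_def[abs_def] g'_def by (auto intro!: derivative_eq_intros)
  have g: "\<bar>g s\<bar> \<le> 1" "\<bar>g' s\<bar> \<le> 1" "1 \<le> \<bar>s\<bar> \<Longrightarrow> g s = 0" "1 \<le> \<bar>s\<bar> \<Longrightarrow> g' s = 0" for s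
  proof -
    show "\<bar>g s\<bar> \<le> 1" by (simp add: g_def abs_mult mult_le_one)
    show "\<bar>g' s\<bar> \<le> 1" unfolding g'_def by (intro abs_diff_le_1) (auto simp: ramp'_le_1 mult_le_one)
    assume "1 \<le> \<bar>s\<bar>"
    then have "1 + s \<le> 0 \<or> 1 - s \<le> 0" by auto
    then show "g s = 0" "g' s = 0" by (auto simp: g_def g'_def)
  qed
  have g0: "0 < g 0" by (simp add: g_def)
  have int_g': "(LBINT s. indicator {0..} s * g' s) = - g 0"
  proof -
    have "(LBINT s. indicator {0..} s * g' s) = (LBINT s. indicator {0..1} s *\<^sub>R g' s)"
      by (intro Bochner_Integration.integral_cong) (auto simp: indicator_def g)
    also have "\<dots> = g 1 - g 0"
    proof (rule integral_FTC_atLeastAtMost)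
      show "(g has_vector_derivative g' s) (at s within {0..1})" for s
        using dg[of s] by (auto simp: has_real_derivative_iff_has_vector_derivative intro: has_vector_derivative_at_within)
      show "continuous_on {0..1} g'" unfolding g'_def[abs_def] by (intro continuous_intros)
    qed simp
    finally show ?thesis by (simp add: g)
  qed
  have E_integrand: "(\<lambda>x. u t x * ?\<eta> x) \<in> borel_measurable lebesgue" "\<bar>u t x * ?\<eta> x\<bar> \<le> 1" if "0 \<le> t" for t x
  proof -
    show "(\<lambda>x. u t x * ?\<eta> x) \<in> borel_measurable lebesgue"
      by (intro borel_measurable_times um that measurable_completion) simp
    show "\<bar>u t x * ?\<eta> x\<bar> \<le> 1"
      using ur[OF that, of x] plateau_bounds[of k a b x] by (simp add: abs_mult mult_le_one)
  qed
  define E where "E t = (LINT x|lebesgue. u t x * ?\<eta> x)" for t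
  have E_cont: "(E \<longlongrightarrow> E t) (at t within {0..})" if "0 \<le> t" for t
    unfolding E_def[abs_def]
  proof (rule continuous_integral_of_L1_loc_curves[OF curve curve that, where r = r and K = 0])
    fix s x :: real assume s: "0 \<le> s"
    show "(\<lambda>x. u s x * ?\<eta> x) \<in> borel_measurable lebesgue" "\<bar>u s x * ?\<eta> x\<bar> \<le> 1"
      using E_integrand[OF s] by blast+
    have "\<bar>u s x - u t x\<bar> * \<bar>?\<eta> x\<bar> \<le> \<bar>u s x - u t x\<bar> * 1" by (intro mult_left_mono plateau_bounds) simp
    then have "\<bar>u s x * ?\<eta> x - u t x * ?\<eta> x\<bar> \<le> \<bar>u s x - u t x\<bar>"
      by (simp add: abs_mult[symmetric] left_diff_distrib)
    then show "\<bar>u s x * ?\<eta> x - u t x * ?\<eta> x\<bar> \<le> \<bar>u s x - u t x\<bar> + \<bar>u s x - u t x\<bar> + 0 * \<bar>s - t\<bar>"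
      by linarith
  qed (simp add: r del: atLeastAtMost_iff)
  define E0 where "E0 t = indicator {0..} t *\<^sub>R E t" for t
  have [measurable]: "E0 \<in> borel_measurable borel"
    unfolding E0_def[abs_def] using E_cont
    by (intro borel_measurable_continuous_on_indicator) (auto simp: continuous_on_def)
  have E0: "E0 t = E t" if "0 \<le> t" for t using that by (simp add: E0_def)
  define V where "V = measure lebesgue {-r..r}"
  have V: "\<bar>E0 t\<bar> \<le> V" for t
  proof (cases "0 \<le> t")
    case True
    show ?thesis
      unfolding E0[OF True] E_def V_def
      by (rule abs_integral_le_measure_support[OF E_integrand[OF True]]) (simp add: r del: atLeastAtMost_iff)
  qed (simp add: E0_def V_def)
  define m where "m n = real (Suc n)" for n
  have m: "0 < m n" "1 \<le> m n" for n by (auto simp: m_def)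
  \<comment> \<open>The time derivative and the flux term of the weak formulation.\<close>
  define T1 where "T1 n = (LBINT t. indicator {0..} t * (m n * g' (m n * t)) * E0 t)" for n
  define T2 where "T2 n = (LBINT z. indicator {0..} (fst z) * (f (w z) * (g (m n * fst z) * ?\<eta>' (snd z))))" for n
  have identity: "T1 n + T2 n + g 0 * (LINT x|lebesgue. u0 x * ?\<eta> x) = 0" for n
  proof -
    let ?\<phi> = "\<lambda>z. g (m n * fst z) * ?\<eta> (snd z)"
    have \<phi>: "test_function ?\<phi>"
    proof (rule test_functionI)
      show "C_k i ?\<phi>" for i
      proof -
        have "?\<phi> = (\<lambda>z. (ramp (1 + m n * fst z + 0 * snd z) * ramp (1 + - m n * fst z + 0 * snd z))
          * (ramp (- k * a + 0 * fst z + k * snd z) * ramp (k * b + 0 * fst z + - k * snd z)))"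
          by (auto simp: g_def plateau_def algebra_simps)
        then show ?thesis by (auto intro!: C_k_mult C_k_flat_exp_affine simp only:)
      qed
      show "z \<in> cbox (- 1, - r) (1, r)" if "?\<phi> z \<noteq> 0" for z
      proof -
        have "\<bar>m n * fst z\<bar> < 1" using that g(3)[of "m n * fst z"] by force
        moreover have "\<bar>fst z\<bar> \<le> \<bar>m n * fst z\<bar>" using m(2)[of n] by (simp add: abs_mult mult_le_cancel_right1)
        ultimately have "\<bar>fst z\<bar> < 1" by linarith
        moreover have "snd z \<in> {-r..r}" using that r[of "snd z"] by auto
        ultimately show ?thesis by (cases z) auto
      qed
    qed (rule bounded_cbox)
    have td: "time_deriv ?\<phi> z = m n * g' (m n * fst z) * ?\<eta> (snd z)" for z
    proof (rule time_deriv_eqI)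
      have "((\<lambda>s. g (m n * s)) has_real_derivative g' (m n * fst z) * m n) (at (fst z))"
        by (rule DERIV_chain2[OF dg]) (auto intro!: derivative_eq_intros)
      then show "((\<lambda>s. g (m n * fst (s, snd z)) * ?\<eta> (snd (s, snd z))) has_real_derivative m n * g' (m n * fst z) * ?\<eta> (snd z)) (at (fst z))"
        by (auto intro!: derivative_eq_intros)
    qed
    have sd: "space_deriv ?\<phi> z = g (m n * fst z) * ?\<eta>' (snd z)" for z
      by (rule space_deriv_eqI) (auto intro!: derivative_eq_intros plateau_has_derivative)
    have bdd: "integrable lborel (\<lambda>z. indicator {0..} (fst z) * (q z * (p (m n * fst z) * \<eta> (snd z))))"
      if [measurable]: "q \<in> borel_measurable borel" "p \<in> borel_measurable borel" "\<eta> \<in> borel_measurable borel"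
        and q: "\<And>z. \<bar>q z\<bar> \<le> B" and p: "\<And>s. \<bar>p s\<bar> \<le> 1" "\<And>s. 1 \<le> \<bar>s\<bar> \<Longrightarrow> p s = 0"
        and \<eta>: "\<And>x. \<bar>\<eta> x\<bar> \<le> c" "\<And>x. x \<notin> {-r..r} \<Longrightarrow> \<eta> x = 0"
      for q :: "real \<times> real \<Rightarrow> real" and p \<eta> :: "real \<Rightarrow> real" and B c
    proof (rule integrable_bounded_support[of _ "cbox (- 1, - r) (1, r)" "1 * (B * (1 * c))"])
      have "0 \<le> B" "0 \<le> c" using q[of 0] \<eta>(1)[of 0] by linarith+
      then show "\<bar>indicator {0..} (fst z) * (q z * (p (m n * fst z) * \<eta> (snd z)))\<bar> \<le> 1 * (B * (1 * c))" for z
        unfolding abs_mult by (intro mult_mono q p \<eta>) (auto simp: indicator_def)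
      show "indicator {0..} (fst z) * (q z * (p (m n * fst z) * \<eta> (snd z))) = 0" if "z \<notin> cbox (- 1, - r) (1, r)" for z
      proof (cases "\<bar>fst z\<bar> \<le> 1")
        case True
        then have "snd z \<notin> {-r..r}" using that by (cases z) auto
        then show ?thesis by (simp add: \<eta>)
      next
        case False
        have "\<bar>fst z\<bar> \<le> \<bar>m n * fst z\<bar>" using m(2)[of n] by (simp add: abs_mult mult_le_cancel_right1)
        then show ?thesis using False p(2)[of "m n * fst z"] by simp
      qed
    qed (simp_all add: bounded_cbox)
    have i1: "integrable lborel (\<lambda>z. indicator {0..} (fst z) * (w z * (g' (m n * fst z) * ?\<eta> (snd z))))"
      by (rule bdd[of _ _ _ 1, OF _ _ _ _ g(2) g(4) plateau_bounds(3) r]) (use wr in auto)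
    have i2: "integrable lborel (\<lambda>z. indicator {0..} (fst z) * (f (w z) * (g (m n * fst z) * ?\<eta>' (snd z))))"
      by (rule bdd[OF _ _ _ C g(1) g(3) plateau'_bound[OF k] r']) auto
    have weak: "(LINT (t, x):{0..} \<times> UNIV|lebesgue. u t x * time_deriv ?\<phi> (t, x) + \<Lambda> (u t x) * space_deriv ?\<phi> (t, x))
        + (LINT x|lebesgue. u0 x * ?\<phi> (0, x)) = 0"
      using es \<phi> unfolding entropy_solution_def weak_solution_def by blast
    have bd: "(LINT x|lebesgue. u0 x * ?\<phi> (0, x)) = g 0 * (LINT x|lebesgue. u0 x * ?\<eta> x)"
      by (simp add: mult.left_commute)
    have "(LINT (t, x):{0..} \<times> UNIV|lebesgue. u t x * time_deriv ?\<phi> (t, x) + \<Lambda> (u t x) * space_deriv ?\<phi> (t, x))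
        = (LBINT z. indicator {0..} (fst z) * (w z * time_deriv ?\<phi> z + f (w z) * space_deriv ?\<phi> z))"
    proof (rule set_integral_borel_version[OF es w \<phi>, of "\<lambda>c. c"])
      show "\<Lambda> c = f c" if "c \<in> {0..1}" for c using clamp01_id[OF that] by (simp add: f_def)
    qed simp_all
    also have "\<dots> = (LBINT z. m n * (indicator {0..} (fst z) * (w z * (g' (m n * fst z) * ?\<eta> (snd z))))
        + indicator {0..} (fst z) * (f (w z) * (g (m n * fst z) * ?\<eta>' (snd z))))"
      unfolding td sd by (simp add: algebra_simps)
    also have "\<dots> = m n * (LBINT z. indicator {0..} (fst z) * (w z * (g' (m n * fst z) * ?\<eta> (snd z)))) + T2 n"
      unfolding T2_def using i1 i2 by simp
    also have "(LBINT z. indicator {0..} (fst z) * (w z * (g' (m n * fst z) * ?\<eta> (snd z))))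
        = (LBINT t. indicator {0..} t * g' (m n * t) * E0 t)"
    proof -
      have ae: "AE t in lborel. (LBINT x. indicator {0..} t * (w (t, x) * (g' (m n * t) * ?\<eta> x)))
          = indicator {0..} t * g' (m n * t) * E0 t"
        using borel_version_slices[OF w]
      proof eventually_elim
        case (elim t)
        show ?case
        proof (cases "0 \<le> t")
          case True
          have [measurable]: "(\<lambda>x. w (t, x)) \<in> borel_measurable borel"
            by (rule measurable_compose[of "Pair t" borel borel]; auto intro!: borel_measurable_continuous_onI continuous_intros)
          have "AE x in lborel. u t x = w (t, x)" using elim True by simp
          then have "AE x in lebesgue. w (t, x) * ?\<eta> x = u t x * ?\<eta> x"
            by (intro AE_completion) (auto elim: AE_mp)
          then have "(LINT x|lebesgue. w (t, x) * ?\<eta> x) = E t"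
            unfolding E_def
            by (intro integral_cong_AE borel_measurable_times um True) (auto intro: measurable_completion)
          then have "(LBINT x. w (t, x) * ?\<eta> x) = E t" by (simp add: integral_completion)
          then show ?thesis using True by (simp add: mult.left_commute[of _ "g' (m n * t)"] E0)
        qed simp
      qed
      have "(LBINT z. indicator {0..} (fst z) * (w z * (g' (m n * fst z) * ?\<eta> (snd z))))
          = (LBINT t. (LBINT x. indicator {0..} t * (w (t, x) * (g' (m n * t) * ?\<eta> x))))"
        using lborel_pair.integral_fst'[of "\<lambda>z. indicator {0..} (fst z) * (w z * (g' (m n * fst z) * ?\<eta> (snd z)))"] i1
        by (simp add: lborel_prod)
      also have "\<dots> = (LBINT t. indicator {0..} t * g' (m n * t) * E0 t)"
      proof (rule integral_cong_AE[OF _ _ ae])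
        show "(\<lambda>t. \<integral>x. indicator {0..} t * (w (t, x) * (g' (m n * t) * ?\<eta> x)) \<partial>lborel) \<in> borel_measurable lborel"
          using lborel_pair.integrable_fst'[of "\<lambda>z. indicator {0..} (fst z) * (w z * (g' (m n * fst z) * ?\<eta> (snd z)))"] i1
          by (simp only: lborel_prod borel_measurable_integrable fst_conv snd_conv)
      qed simp
      finally show ?thesis .
    qed
    also have "m n * (LBINT t. indicator {0..} t * g' (m n * t) * E0 t) = T1 n"
      unfolding T1_def by (subst Bochner_Integration.integral_mult_right_zero[symmetric]) (simp add: mult_ac)
    finally show ?thesis using weak unfolding bd by simp
  qed
  have T1: "T1 \<longlonglongrightarrow> - g 0 * E 0"
  proof -
    have T1_eq: "T1 n = (LBINT s. indicator {0..} s * g' s * E0 (s / m n))" for n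
    proof -
      have "T1 n = \<bar>1 / m n\<bar> *\<^sub>R (LBINT s. indicator {0..} (0 + 1 / m n * s) * (m n * g' (m n * (0 + 1 / m n * s))) * E0 (0 + 1 / m n * s))"
        unfolding T1_def using m(1)[of n] by (intro lborel_integral_real_affine) auto
      also have "\<dots> = (LBINT s. \<bar>1 / m n\<bar> * (indicator {0..} (0 + 1 / m n * s) * (m n * g' (m n * (0 + 1 / m n * s))) * E0 (0 + 1 / m n * s)))"
        by simp
      also have "\<dots> = (LBINT s. indicator {0..} s * g' s * E0 (s / m n))"
        using m(1)[of n] by (intro Bochner_Integration.integral_cong) (simp_all add: indicator_def zero_le_divide_iff)
      finally show ?thesis .
    qed
    have "(\<lambda>n. \<integral>s. indicator {0..} s * g' s * E0 (s / m n) \<partial>lborel) \<longlonglongrightarrow> (LBINT s. indicator {0..} s * g' s * E 0)"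
    proof (rule integral_dominated_convergence[where w = "\<lambda>s. indicator {-1..1} s * V"])
      show "integrable lborel (\<lambda>s. indicator {-1..1::real} s * V)" by simp
      have "0 \<le> V" using V[of 0] by linarith
      show "AE s in lborel. norm (indicator {0..} s * g' s * E0 (s / m n)) \<le> indicator {-1..1} s * V" for n
      proof (intro AE_I2)
        fix s
        have "\<bar>indicator {0..} s * g' s\<bar> * \<bar>E0 (s / m n)\<bar> \<le> indicator {-1..1} s * V"
          using V \<open>0 \<le> V\<close> g(2)[of s] g(4)[of s] by (intro mult_mono) (auto simp: indicator_def)
        then show "norm (indicator {0..} s * g' s * E0 (s / m n)) \<le> indicator {-1..1} s * V" by (simp add: abs_mult)
      qed
      show "AE s in lborel. (\<lambda>n. indicator {0..} s * g' s * E0 (s / m n)) \<longlonglongrightarrow> indicator {0..} s * g' s * E 0"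
        using AE_lborel_singleton[of "0::real"]
      proof eventually_elim
        case (elim s)
        show ?case
        proof (cases "0 \<le> s")
          case True
          have s: "0 < s" using True elim by simp
          have "(\<lambda>n. s / m n) \<longlonglongrightarrow> 0"
            using tendsto_mult_right_zero[OF LIMSEQ_inverse_real_of_nat, of s] by (simp add: divide_inverse m_def)
          then have "filterlim (\<lambda>n. s / m n) (at 0 within {0..}) sequentially"
            unfolding filterlim_at using s m(1) by (auto simp: less_imp_le less_imp_neq[OF m(1), symmetric])
          then have "(\<lambda>n. E (s / m n)) \<longlonglongrightarrow> E 0" by (rule filterlim_compose[OF E_cont[OF order_refl]])
          moreover have "E0 (s / m n) = E (s / m n)" for n using s m(1)[of n] by (intro E0) simp
          ultimately show ?thesis by (intro tendsto_intros) simp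
        qed simp
      qed
    qed auto
    also have "(LBINT s. indicator {0..} s * g' s * E 0) = - g 0 * E 0"
      using int_g' by simp
    finally show ?thesis unfolding T1_eq .
  qed
  have T2: "T2 \<longlonglongrightarrow> 0"
  proof -
    have "(\<lambda>n. T2 n) \<longlonglongrightarrow> (\<integral>z. 0 \<partial>(lborel :: (real \<times> real) measure))"
      unfolding T2_def
    proof (rule integral_dominated_convergence[where w = "\<lambda>z. indicator (cbox (- 1, - r) (1, r)) z * (C * k)"])
      show "integrable lborel (\<lambda>z. indicator (cbox (- 1, - r) (1, r)) z * (C * k))"
        by (rule integrable_bounded_support[of _ "cbox (- 1, - r) (1, r)" "\<bar>C * k\<bar>"]) (simp_all add: indicator_def bounded_cbox)
      have "0 \<le> C" using C[of 0] by linarith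
      show "AE z in lborel. norm (indicator {0..} (fst z) * (f (w z) * (g (m n * fst z) * ?\<eta>' (snd z)))) \<le> indicator (cbox (- 1, - r) (1, r)) z * (C * k)" for n
      proof (intro AE_I2)
        fix z :: "real \<times> real"
        show "norm (indicator {0..} (fst z) * (f (w z) * (g (m n * fst z) * ?\<eta>' (snd z)))) \<le> indicator (cbox (- 1, - r) (1, r)) z * (C * k)"
        proof (cases "z \<in> cbox (- 1, - r) (1, r)")
          case True
          have "\<bar>indicator {0..} (fst z) * (f (w z) * (g (m n * fst z) * ?\<eta>' (snd z)))\<bar> \<le> 1 * (C * (1 * k))"
            unfolding abs_mult using \<open>0 \<le> C\<close> k by (intro mult_mono C g plateau'_bound) (auto simp: indicator_def)
          then show ?thesis using True by simp
        next
          case False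
          have z: "g (m n * fst z) * ?\<eta>' (snd z) = 0"
          proof (cases "\<bar>fst z\<bar> \<le> 1")
            case True
            then have "snd z \<notin> {-r..r}" using False by (cases z) auto
            then show ?thesis by (simp add: r')
          next
            case False
            have "\<bar>fst z\<bar> \<le> \<bar>m n * fst z\<bar>" using m(2)[of n] by (simp add: abs_mult mult_le_cancel_right1)
            then show ?thesis using False g(3)[of "m n * fst z"] by simp
          qed
          show ?thesis unfolding z using False by simp
        qed
      qed
      have "AE t in lborel. AE x in (lborel :: real measure). fst (t, x) \<noteq> (0::real)"
        using AE_lborel_singleton[of "0::real"] by eventually_elim simp
      then have "AE z in lborel \<Otimes>\<^sub>M (lborel :: real measure). fst z \<noteq> (0::real)"
        by (rule lborel_pair.AE_pair_measure[rotated]) measurable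
      then have "AE z in lborel. fst (z :: real \<times> real) \<noteq> 0" unfolding lborel_prod .
      then show "AE z in lborel. (\<lambda>n. indicator {0..} (fst z) * (f (w z) * (g (m n * fst z) * ?\<eta>' (snd z)))) \<longlonglongrightarrow> 0"
      proof eventually_elim
        case (elim z)
        obtain n0 where n0: "1 / \<bar>fst z\<bar> < real n0" using reals_Archimedean2 by blast
        have "g (m n * fst z) = 0" if "n0 \<le> n" for n
        proof (rule g(3))
          have "1 / \<bar>fst z\<bar> \<le> m n" using n0 that by (simp add: m_def)
          then show "1 \<le> \<bar>m n * fst z\<bar>" using elim m(1)[of n] by (simp add: abs_mult field_simps)
        qed
        then show ?case by (intro tendsto_eventually) (auto simp: eventually_sequentially)
      qed
    qed auto
    then show ?thesis by simp
  qed
  have "(\<lambda>n. T1 n + T2 n + g 0 * (LINT x|lebesgue. u0 x * ?\<eta> x)) \<longlonglongrightarrow> - g 0 * E 0 + 0 + g 0 * (LINT x|lebesgue. u0 x * ?\<eta> x)"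
    by (intro tendsto_intros T1 T2)
  then have "- g 0 * E 0 + 0 + g 0 * (LINT x|lebesgue. u0 x * ?\<eta> x) = 0"
    unfolding identity by (simp add: LIMSEQ_const_iff)
  then show ?thesis using g0 by (simp add: E_def)
qed

text \<open>
  The plateaus converge to indicators of intervals, and integrals over intervals determine a function.
\<close>

lemma entropy_solution_initial_trace:
  assumes es: "entropy_solution \<Lambda> u0 u" and \<Lambda>: "continuous_on {0..1} \<Lambda>"
    and u0[measurable]: "u0 \<in> borel_measurable borel" and u0r: "\<And>x. u0 x \<in> {0..1}"
  shows "AE x in lborel. u 0 x = u0 x"
proof -
  have ur: "\<And>x. u 0 x \<in> {0..1}" and um: "u 0 \<in> borel_measurable lebesgue"
    using es by (auto simp: entropy_solution_def)
  obtain p0 where p0: "p0 \<in> borel_measurable lborel" and ae: "AE x in lborel. u 0 x = p0 x"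
    using completion_ex_borel_measurable_real[OF um] by blast
  have [measurable]: "p0 \<in> borel_measurable borel" using p0 by simp
  define p where "p x = clamp01 (p0 x)" for x
  have pm[measurable]: "p \<in> borel_measurable borel" unfolding p_def[abs_def] by measurable
  have pr: "p x \<in> {0..1}" for x by (simp add: p_def clamp01_in del: atLeastAtMost_iff)
  have up: "AE x in lborel. u 0 x = p x"
    using ae by eventually_elim (metis clamp01_id p_def ur)
  have lim: "(\<lambda>n. \<integral>x. q x * plateau (real (Suc n)) a b x \<partial>lborel) \<longlonglongrightarrow> (LBINT x. q x * indicator {a<..<b} x)"
    if [measurable]: "q \<in> borel_measurable borel" and q: "\<And>x. q x \<in> {0..1}" for q :: "real \<Rightarrow> real" and a b
  proof (rule integral_dominated_convergence[where w = "indicator {a<..<b}"])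
    show "integrable lborel (indicator {a<..<b} :: real \<Rightarrow> real)"
      by (rule integrable_bounded_support[of _ "{a<..<b}" 1]) (auto simp: indicator_def)
    show "AE x in lborel. (\<lambda>n. q x * plateau (real (Suc n)) a b x) \<longlonglongrightarrow> q x * indicator {a<..<b} x"
      by (intro AE_I2 tendsto_mult tendsto_const plateau_tendsto_indicator)
    show "AE x in lborel. norm (q x * plateau (real (Suc n)) a b x) \<le> indicator {a<..<b} x" for n
    proof (intro AE_I2)
      fix x
      show "norm (q x * plateau (real (Suc n)) a b x) \<le> indicator {a<..<b} x"
        using q[of x] plateau_bounds[of "real (Suc n)" a b x] plateau_support[of "real (Suc n)" x a b]
        by (cases "x \<in> {a<..<b}") (auto simp: abs_mult mult_le_one)
    qed
  qed auto
  have "(LBINT x. p x * plateau (real (Suc n)) a b x) = (LBINT x. u0 x * plateau (real (Suc n)) a b x)" for n a b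
  proof -
    have [measurable]: "plateau (real (Suc n)) a b \<in> borel_measurable lebesgue" by (intro measurable_completion) simp
    have "(LBINT x. p x * plateau (real (Suc n)) a b x) = (LINT x|lebesgue. p x * plateau (real (Suc n)) a b x)"
      by (simp add: integral_completion)
    also have "\<dots> = (LINT x|lebesgue. u 0 x * plateau (real (Suc n)) a b x)"
    proof (rule integral_cong_AE)
      show "(\<lambda>x. p x * plateau (real (Suc n)) a b x) \<in> borel_measurable lebesgue" by (intro measurable_completion) simp
      show "(\<lambda>x. u 0 x * plateau (real (Suc n)) a b x) \<in> borel_measurable lebesgue" using um by measurable
      show "AE x in lebesgue. p x * plateau (real (Suc n)) a b x = u 0 x * plateau (real (Suc n)) a b x"
        using AE_completion[OF up] by eventually_elim simp
    qed
    also have "\<dots> = (LINT x|lebesgue. u0 x * plateau (real (Suc n)) a b x)"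
      by (rule entropy_solution_initial_pairing[OF es \<Lambda>]) simp
    also have "\<dots> = (LBINT x. u0 x * plateau (real (Suc n)) a b x)"
      by (simp add: integral_completion)
    finally show ?thesis .
  qed
  note same = this
  have "(LBINT x. p x * indicator {a<..<b} x) = (LBINT x. u0 x * indicator {a<..<b} x)" for a b
    using lim[OF pm pr, of a b] lim[OF u0 u0r, of a b] unfolding same by (rule LIMSEQ_unique)
  then have "AE x in lborel. p x = u0 x"
    by (intro AE_eq_if_integrals_on_intervals_eq pm pr u0 u0r)
  then show ?thesis using up by eventually_elim simp
qed

section \<open>Monotonicity in space\<close>

text \<open>
  Kruzkov's entropy flux.
\<close>

definition sgn_flux :: "(real \<Rightarrow> real) \<Rightarrow> real \<Rightarrow> real \<Rightarrow> real" where
  "sgn_flux f a b = sgn (a - b) * (f a - f b)"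

lemma sgn_flux_commute: "sgn_flux f a b = sgn_flux f b a"
  by (simp add: sgn_flux_def sgn_if)

lemma sgn_flux_bound:
  assumes "\<bar>f a - f b\<bar> \<le> L * \<bar>a - b\<bar>"
  shows "\<bar>sgn_flux f a b\<bar> \<le> L * \<bar>a - b\<bar>"
  using assms by (auto simp: sgn_flux_def sgn_if)

text \<open>
  On either side of \<open>b\<close> the increments are those of \<open>f\<close> up to sign; if \<open>b\<close> lies between \<open>a\<close> and \<open>a'\<close>,
  the two increments add up along the segment.
\<close>

lemma sgn_flux_Lipschitz:
  assumes L: "\<And>x y. x \<in> S \<Longrightarrow> y \<in> S \<Longrightarrow> \<bar>f x - f y\<bar> \<le> L * \<bar>x - y\<bar>" and "a \<in> S" "a' \<in> S" "b \<in> S"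
  shows "\<bar>sgn_flux f a b - sgn_flux f a' b\<bar> \<le> L * \<bar>a - a'\<bar>"
proof -
  note l = L[OF assms(2,3)] L[OF assms(2,4)] L[OF assms(3,4)]
  consider "a > b \<and> a' > b" | "a < b \<and> a' < b" | "a = b" | "a' = b" | "a < b \<and> a' > b" | "a > b \<and> a' < b" by linarith
  then show ?thesis
  proof cases
    case 5
    have "\<bar>sgn_flux f a b - sgn_flux f a' b\<bar> \<le> \<bar>f a - f b\<bar> + \<bar>f a' - f b\<bar>" using 5 by (simp add: sgn_flux_def)
    also have "\<dots> \<le> L * \<bar>a - b\<bar> + L * \<bar>a' - b\<bar>" using l by simp
    also have "\<dots> = L * \<bar>a - a'\<bar>" using 5 by (simp add: algebra_simps)
    finally show ?thesis .
  next
    case 6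
    have "\<bar>sgn_flux f a b - sgn_flux f a' b\<bar> \<le> \<bar>f a - f b\<bar> + \<bar>f a' - f b\<bar>" using 6 by (simp add: sgn_flux_def)
    also have "\<dots> \<le> L * \<bar>a - b\<bar> + L * \<bar>a' - b\<bar>" using l by simp
    also have "\<dots> = L * \<bar>a - a'\<bar>" using 6 by (simp add: algebra_simps)
    finally show ?thesis .
  qed (use l in \<open>auto simp: sgn_flux_def sgn_if abs_minus_commute\<close>)
qed

lemma borel_measurable_sgn_flux:
  assumes [measurable]: "f \<in> borel_measurable borel"
  shows "case_prod (sgn_flux f) \<in> borel_measurable borel"
  unfolding sgn_flux_def[abs_def] split_beta' by measurable

text \<open>
  Half the sum of the entropy inequality and the weak formulation, minus a constant, is the entropy
  inequality for \<open>(a - c)\<^sup>+\<close>; with the opposite sign of the weak formulation it is the one for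
  \<open>(c - a)\<^sup>+\<close>. The translate of a solution satisfies the same inequalities. Doubling and
  the cone estimate with \<open>H = 0\<close> bound the integral of \<open>(u - v)\<^sup>+\<close> over cones, where \<open>v\<close> is the translate,
  by its initial value, which is \<open>0\<close>.
\<close>

lemma entropy_solution_increasing:
  assumes es: "entropy_solution \<Lambda> u0 u" and w: "borel_version u w"
    and Lip: "\<And>a b. a \<in> {0..1} \<Longrightarrow> b \<in> {0..1} \<Longrightarrow> \<bar>\<Lambda> a - \<Lambda> b\<bar> \<le> L * \<bar>a - b\<bar>"
    and u0: "mono u0" "\<And>x. u0 x \<in> {0..1}" and h: "0 < h"
  shows "AE z in lborel. w z \<le> w ((0, h) + z)"
proof -
  have L: "0 \<le> L" using Lip[of 0 1] by simp
  have \<Lambda>: "continuous_on {0..1} \<Lambda>"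
    using L Lip by (intro lipschitz_on_continuous_on[of L]) (auto simp: lipschitz_on_def dist_real_def)
  define f where "f a = \<Lambda> (clamp01 a)" for a
  have fL: "\<bar>f a - f b\<bar> \<le> L * \<bar>a - b\<bar>" if "a \<in> {0..1}" "b \<in> {0..1}" for a b
    using Lip[OF that] by (simp add: f_def clamp01_id[OF that(1)] clamp01_id[OF that(2)])
  have "continuous_on UNIV f"
    unfolding f_def[abs_def] by (rule continuous_on_compose2[OF \<Lambda> continuous_clamp01]) (use clamp01_in in blast)
  then have fm[measurable]: "f \<in> borel_measurable borel" by (rule borel_measurable_continuous_onI)
  have wm[measurable]: "w \<in> borel_measurable borel" and wr: "w z \<in> {0..1}" for z
    using w unfolding borel_version_def by blast+
  have curve: "L1_loc_curve u" using es by (rule entropy_solution_L1_loc_curve)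
  have ur: "u t x \<in> {0..1}" if "0 \<le> t" for t x using curve that by (auto simp: L1_loc_curve_def)
  define v where "v t x = u t (x + h)" for t x
  define v' where "v' z = w ((0, h) + z)" for z
  have v: "L1_loc_curve v" "borel_version v v'"
    using L1_loc_curve_shift[OF curve] borel_version_shift[OF w] by (simp_all add: v_def[abs_def] v'_def[abs_def])
  \<comment> \<open>\<open>N a b\<close> is \<open>(a - b)\<^sup>+\<close>, written such that it is visibly half of a sum.\<close>
  define N where "N a b = (1 / 2) * (\<bar>a - b\<bar> + (a - b))" for a b :: real
  define F where "F a b = (1 / 2) * (sgn_flux f a b + (f a - f b))" for a b
  have Nm: "case_prod N \<in> borel_measurable borel" "case_prod F \<in> borel_measurable borel"
  proof -
    note [measurable] = borel_measurable_sgn_flux[OF fm, unfolded split_beta']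
    show "case_prod N \<in> borel_measurable borel" unfolding N_def[abs_def] split_beta' by measurable
    show "case_prod F \<in> borel_measurable borel" unfolding F_def[abs_def] split_beta' by measurable
  qed
  note D = entropy_solution_dissipates[OF es w \<Lambda>, folded f_def]
  note W = entropy_solution_dissipates_weak[OF es w \<Lambda>, folded f_def]
  note W_minus = entropy_solution_dissipates_weak_minus[OF es w \<Lambda>, folded f_def]
  have wb: "\<bar>w z - c\<bar> \<le> 1" "\<bar>w z\<bar> \<le> 1" if "c \<in> {0..1}" for z c
    using abs_diff_le_1[OF wr that] abs_diff_le_1[OF wr, of 0] by auto
  define B where "B = 1 + L + \<bar>f 0\<bar>"
  have "0 \<le> B" using L by (simp add: B_def)
  have fB: "\<bar>f a\<bar> \<le> B" if "a \<in> {0..1}" for a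
  proof -
    have "L * \<bar>a - 0\<bar> \<le> L * 1" using that L by (intro mult_left_mono) auto
    then show ?thesis using fL[OF that, of 0] by (simp add: B_def)
  qed
  have gL: "\<bar>sgn_flux f a b\<bar> \<le> L" if "a \<in> {0..1}" "b \<in> {0..1}" for a b
  proof -
    have "L * \<bar>a - b\<bar> \<le> L * 1" using abs_diff_le_1[OF that] L by (intro mult_left_mono)
    then show ?thesis using sgn_flux_bound[of f a b L, OF fL[OF that]] by simp
  qed
  have gB: "\<bar>sgn (w z - c) * (f (w z) - f c)\<bar> \<le> B" if c: "c \<in> {0..1}" for z c
    using gL[OF wr c, of z] by (simp add: sgn_flux_def B_def)
  have B1: "x \<le> 1 \<Longrightarrow> x \<le> B" for x using L by (simp add: B_def)
  have b2: "\<bar>w z - c\<bar> \<le> 2 * B" "\<bar>w z + - c\<bar> \<le> 2 * B" "\<bar>- w z + c\<bar> \<le> 2 * B"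
      "\<bar>sgn (w z - c) * (f (w z) - f c)\<bar> \<le> 2 * B" "\<bar>f (w z) + - f c\<bar> \<le> 2 * B" "\<bar>- f (w z) + f c\<bar> \<le> 2 * B"
    if c: "c \<in> {0..1}" for z c
    using wb(1)[OF c, of z] gB[OF c, of z] fB[OF wr, of z] fB[OF c] B1[OF order_refl] by linarith+
  have du: "dissipates (\<lambda>z. N (w z) c) (\<lambda>z. F (w z) c)" if c: "c \<in> {0..1}" for c
  proof -
    have 1: "dissipates (\<lambda>z. w z + - c) (\<lambda>z. f (w z) + - f c)"
      by (rule dissipates_add[OF W dissipates_const, where B = B])
        (use wb[OF c] fB[OF wr] fB[OF c] c in \<open>simp_all add: B1\<close>)
    have "dissipates (\<lambda>z. \<bar>w z - c\<bar> + (w z + - c)) (\<lambda>z. sgn (w z - c) * (f (w z) - f c) + (f (w z) + - f c))"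
      by (rule dissipates_add[OF D[OF c] 1, where B = "2 * B"])
        (simp_all add: b2[OF c] del: add_uminus_conv_diff uminus_add_conv_diff)
    then have "dissipates (\<lambda>z. (1 / 2) * (\<bar>w z - c\<bar> + (w z + - c))) (\<lambda>z. (1 / 2) * (sgn (w z - c) * (f (w z) - f c) + (f (w z) + - f c)))"
      by (rule dissipates_scale) simp
    then show ?thesis by (simp add: N_def F_def sgn_flux_def)
  qed
  have dw: "dissipates (\<lambda>z. N c (w z)) (\<lambda>z. F c (w z))" if c: "c \<in> {0..1}" for c
  proof -
    have 1: "dissipates (\<lambda>z. - w z + c) (\<lambda>z. - f (w z) + f c)"
      by (rule dissipates_add[OF W_minus dissipates_const, where B = B])
        (use wb[OF c] fB[OF wr] fB[OF c] c in \<open>simp_all add: B1\<close>)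
    have "dissipates (\<lambda>z. \<bar>w z - c\<bar> + (- w z + c)) (\<lambda>z. sgn (w z - c) * (f (w z) - f c) + (- f (w z) + f c))"
      by (rule dissipates_add[OF D[OF c] 1, where B = "2 * B"])
        (simp_all add: b2[OF c] del: add_uminus_conv_diff uminus_add_conv_diff)
    then have "dissipates (\<lambda>z. (1 / 2) * (\<bar>w z - c\<bar> + (- w z + c))) (\<lambda>z. (1 / 2) * (sgn (w z - c) * (f (w z) - f c) + (- f (w z) + f c)))"
      by (rule dissipates_scale) simp
    moreover have "sgn (c - w z) * (f c - f (w z)) = sgn (w z - c) * (f (w z) - f c)" for z
      using sgn_flux_commute[of f c "w z"] by (simp add: sgn_flux_def)
    ultimately show ?thesis
      by (simp add: N_def F_def sgn_flux_def abs_minus_commute[of c] add.commute)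
  qed
  have NFm: "(\<lambda>z. N c (w z)) \<in> borel_measurable borel" "(\<lambda>z. F c (w z)) \<in> borel_measurable borel" for c
    by (rule borel_measurable_binary[OF Nm(1)] borel_measurable_binary[OF Nm(2)]; simp)+
  have dv: "dissipates (\<lambda>z. N c (v' z)) (\<lambda>z. F c (v' z))" if c: "c \<in> {0..1}" for c
    unfolding v'_def by (rule dissipates_shift[OF dw[OF c] NFm])
  have N: "N a b \<in> {0..1}" if "a \<in> {0..1}" "b \<in> {0..1}" for a b
    using that by (auto simp: N_def)
  have N_lip: "\<bar>N a b - N a' b'\<bar> \<le> \<bar>a - a'\<bar> + \<bar>b - b'\<bar>" for a b a' b'
  proof -
    have "N a b = max 0 (a - b)" for a b by (simp add: N_def max_def)
    moreover have "\<bar>max 0 x - max 0 y\<bar> \<le> \<bar>x - y\<bar>" for x y :: real by (simp add: max_def)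
    moreover have "\<bar>(a - b) - (a' - b')\<bar> \<le> \<bar>a - a'\<bar> + \<bar>b - b'\<bar>" by linarith
    ultimately show ?thesis by (metis order_trans)
  qed
  have F_lip: "\<bar>F a b - F a' b\<bar> \<le> L * \<bar>a - a'\<bar>" if "a \<in> {0..1}" "a' \<in> {0..1}" "b \<in> {0..1}" for a a' b
  proof -
    have "\<bar>(1 / 2) * (p + (q - r)) - (1 / 2) * (p' + (q' - r))\<bar> \<le> K"
      if "\<bar>p - p'\<bar> \<le> K" "\<bar>q - q'\<bar> \<le> K" for p p' q q' r K :: real
      using that by (simp add: abs_le_iff field_simps)
    from this[OF sgn_flux_Lipschitz[of "{0..1}" f L a a' b, OF fL that] fL[OF that(1,2)]]
    show ?thesis by (simp add: F_def)
  qed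
  have F_bound: "\<bar>F a b\<bar> \<le> L * N a b" if "a \<in> {0..1}" "b \<in> {0..1}" for a b
  proof (cases "b < a")
    case True
    then have "F a b = f a - f b" "N a b = \<bar>a - b\<bar>"
      unfolding F_def N_def sgn_flux_def by (simp_all del: right_diff_distrib_numeral)
    then show ?thesis using fL[OF that] by simp
  next
    case False
    then have "F a b = 0" "N a b = 0" unfolding F_def N_def sgn_flux_def by (auto simp: sgn_if)
    then show ?thesis by simp
  qed
  have NL: "L * N a b \<le> L" if "a \<in> {0..1}" "b \<in> {0..1}" for a b
    using N[OF that] L by (simp add: mult_left_le)
  have LB: "x \<le> L * y \<Longrightarrow> 0 \<le> y \<Longrightarrow> x \<le> B * y" "x \<le> y \<Longrightarrow> 0 \<le> y \<Longrightarrow> x \<le> B * y" for x y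
  proof -
    assume y: "0 \<le> y"
    have "L * y \<le> B * y" "1 * y \<le> B * y" using y L by (intro mult_right_mono; simp add: B_def)+
    then show "x \<le> L * y \<Longrightarrow> x \<le> B * y" "x \<le> y \<Longrightarrow> x \<le> B * y" by auto
  qed
  have v'r: "v' z \<in> {0..1}" and v'm: "v' \<in> borel_measurable borel" for z
    using v(2) unfolding borel_version_def by blast+
  have diss: "dissipates (\<lambda>z. N (w z) (v' z)) (\<lambda>z. F (w z) (v' z))"
  proof (rule dissipates_doubling[OF wm wr v'm v'r Nm _ _ _ _ du dv, where B = B])
    show "\<bar>N a b\<bar> \<le> B" "\<bar>F a b\<bar> \<le> B" if "a \<in> {0..1}" "b \<in> {0..1}" for a b
      using N[OF that] F_bound[OF that] NL[OF that] L by (auto simp: B_def)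
    show "\<bar>N a b - N a' b\<bar> \<le> B * \<bar>a - a'\<bar>" for a a' b
      using N_lip[of a b a' b] by (intro LB(2)) auto
    show "\<bar>F a b - F a' b\<bar> \<le> B * \<bar>a - a'\<bar>" if "a \<in> {0..1}" "a' \<in> {0..1}" "b \<in> {0..1}" for a a' b
      using F_lip[OF that] by (intro LB(1)) auto
  qed
  have est: "(LINT x|lebesgue. N (u t x) (v t x) * cone_weight L R t x) \<le> (LINT x|lebesgue. N (u 0 x) (v 0 x) * cone_weight L R 0 x)"
    if t: "0 \<le> t" for t R
    using cone_estimate[OF curve w v Nm N N_lip _ _ L diss, of "\<lambda>_. 0" 0 0 t R] F_bound t by (simp add: cone_energy_def)
  have ae0: "AE x in lebesgue. u 0 x = u0 x" "AE x in lebesgue. v 0 x = u0 (x + h)"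
  proof -
    have ae: "AE x in lborel. u 0 x = u0 x"
      by (rule entropy_solution_initial_trace[OF es \<Lambda> borel_measurable_mono[OF u0(1)] u0(2)])
    then show "AE x in lebesgue. u 0 x = u0 x" by (rule AE_completion)
    have "AE x in lborel. v 0 x = u0 (x + h)" using AE_lborel_shift[OF ae, of h] by (simp add: v_def add.commute)
    then show "AE x in lebesgue. v 0 x = u0 (x + h)" by (rule AE_completion)
  qed
  have E0: "(LINT x|lebesgue. N (u 0 x) (v 0 x) * cone_weight L R 0 x) = 0" for R
  proof (rule integral_eq_zero_AE)
    show "AE x in lebesgue. N (u 0 x) (v 0 x) * cone_weight L R 0 x = 0"
      using ae0
    proof eventually_elim
      case (elim x)
      have "u0 x \<le> u0 (x + h)" using u0(1) h by (simp add: mono_def)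
      then show ?case using elim by (simp add: N_def)
    qed
  qed
  have slice: "AE x in lborel. u t x \<le> v t x" if t: "0 \<le> t" for t
  proof -
    have vr: "v t x \<in> {0..1}" for x using ur[OF t] by (simp add: v_def)
    have "AE x in lebesgue. N (u t x) (v t x) * cone_weight L (real n) t x = 0" for n
    proof -
      have nn: "0 \<le> N (u t x) (v t x) * cone_weight L (real n) t x" for x
        using N[OF ur[OF t, of x] vr[of x]] cone_weight_bounds(1) by simp
      have int: "integrable lebesgue (\<lambda>x. N (u t x) (v t x) * cone_weight L (real n) t x)"
        by (rule cone_energy_integrand_integrable[OF curve v(1) Nm(1) _ L t]) (rule N)
      have "0 \<le> (LINT x|lebesgue. N (u t x) (v t x) * cone_weight L (real n) t x)"
        by (rule Bochner_Integration.integral_nonneg[OF nn])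
      then have "(LINT x|lebesgue. N (u t x) (v t x) * cone_weight L (real n) t x) = 0"
        using est[OF t, of "real n"] E0[of "real n"] by linarith
      then show ?thesis using integral_nonneg_eq_0_iff_AE[OF int] nn by simp
    qed
    \<comment> \<open>A point lies inside the cone of size \<open>n\<close> for all large \<open>n\<close>.\<close>
    then have "AE x in lebesgue. \<forall>n. N (u t x) (v t x) * cone_weight L (real n) t x = 0"
      unfolding AE_all_countable by blast
    then have "AE x in lebesgue. u t x \<le> v t x"
    proof eventually_elim
      case (elim x)
      obtain n where n: "L * t + \<bar>x\<bar> < real n" using reals_Archimedean2 by blast
      then have "0 < cone_weight L (real n) t x" by (simp add: cone_weight_def)
      then have "N (u t x) (v t x) = 0" using elim[rule_format, of n] by simp
      then show ?case by (simp add: N_def)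
    qed
    then show ?thesis by (simp add: AE_completion_iff)
  qed
  have "AE t in lborel. AE x in lborel. w (t, x) \<le> v' (t, x)"
    using borel_version_slices[OF w] borel_version_slices[OF v(2)]
  proof eventually_elim
    case (elim t)
    show ?case
    proof (cases "0 \<le> t")
      case True
      then have "AE x in lborel. u t x = w (t, x)" "AE x in lborel. v t x = v' (t, x)" using elim by auto
      then show ?thesis using slice[OF True] by eventually_elim simp
    next
      case False
      then show ?thesis using w v(2) by (simp add: borel_version_def)
    qed
  qed
  then have "AE z in lborel \<Otimes>\<^sub>M lborel. w z \<le> v' z"
  proof (rule lborel_pair.AE_pair_measure[rotated])
    have "{z. w z \<le> v' z} \<in> sets borel" using v'm by measurable
    then show "{x \<in> space (lborel \<Otimes>\<^sub>M lborel). w x \<le> v' x} \<in> sets (lborel \<Otimes>\<^sub>M lborel :: (real \<times> real) measure)"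
      unfolding lborel_prod by simp
  qed
  then show ?thesis unfolding lborel_prod v'_def .
qed

section \<open>Stability with respect to the flux\<close>

lemma C1_imp_Lipschitz:
  fixes f f' :: "real \<Rightarrow> real"
  assumes "\<And>w. w \<in> {0..1} \<Longrightarrow> (f has_real_derivative f' w) (at w within {0..1})" and "continuous_on {0..1} f'"
  obtains L where "0 \<le> L" "\<And>a b. a \<in> {0..1} \<Longrightarrow> b \<in> {0..1} \<Longrightarrow> \<bar>f a - f b\<bar> \<le> L * \<bar>a - b\<bar>"
proof -
  have "compact (f' ` {0..1})" using assms(2) by (intro compact_continuous_image compact_Icc)
  then obtain L where L: "\<And>y. y \<in> f' ` {0..1} \<Longrightarrow> norm y \<le> L"
    using compact_imp_bounded bounded_iff by metis
  show thesis
  proof (rule that)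
    show "0 \<le> L" using L[of "f' 0"] norm_ge_zero[of "f' 0"] by (auto intro: order_trans)
    show "\<bar>f a - f b\<bar> \<le> L * \<bar>a - b\<bar>" if "a \<in> {0..1}" "b \<in> {0..1}" for a b
      using field_differentiable_bound[of "{0..1}" f f' L, OF _ assms(1) L] that by (auto simp: real_norm_def)
  qed
qed

text \<open>
  By the fundamental theorem of calculus the left side is \<open>\<bar>\<integral> g\<bar>\<close> over \<open>[a, b]\<close>.
\<close>

lemma increment_le_integral_abs_deriv:
  fixes G g :: "real \<Rightarrow> real"
  assumes G: "\<And>w. w \<in> {0..1} \<Longrightarrow> (G has_real_derivative g w) (at w within {0..1})" and g: "continuous_on {0..1} g"
    and ab: "0 \<le> a" "a \<le> b" "b \<le> 1"
  shows "\<bar>G b - G a\<bar> \<le> integral {0..b} (\<lambda>w. \<bar>g w\<bar>) - integral {0..a} (\<lambda>w. \<bar>g w\<bar>)"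
proof -
  have sub: "{a..b} \<subseteq> {0..1}" using ab by auto
  have "(g has_integral (G b - G a)) {a..b}"
  proof (rule fundamental_theorem_of_calculus[OF ab(2)])
    show "(G has_vector_derivative g x) (at x within {a..b})" if "x \<in> {a..b}" for x
      using has_field_derivative_subset[OF G sub] that sub by (auto simp: has_real_derivative_iff_has_vector_derivative)
  qed
  then have "G b - G a = integral {a..b} g" by (simp add: integral_unique)
  also have "\<bar>\<dots>\<bar> \<le> integral {a..b} (\<lambda>w. \<bar>g w\<bar>)"
    using integral_norm_bound_integral[of g "{a..b}" "\<lambda>w. \<bar>g w\<bar>"] continuous_on_subset[OF g sub]
    by (auto intro!: integrable_continuous_interval continuous_intros)
  also have "\<dots> = integral {0..b} (\<lambda>w. \<bar>g w\<bar>) - integral {0..a} (\<lambda>w. \<bar>g w\<bar>)"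
  proof -
    have "(\<lambda>w. \<bar>g w\<bar>) integrable_on {0..b}"
      using ab by (intro integrable_continuous_interval continuous_intros continuous_on_subset[OF g]) auto
    then show ?thesis using Henstock_Kurzweil_Integration.integral_combine[of 0 a b "\<lambda>w. \<bar>g w\<bar>"] ab by simp
  qed
  finally show ?thesis .
qed

text \<open>
  Away from \<open>c\<close> the derivative of \<open>sgn_flux G a c\<close> in \<open>a\<close> is that of \<open>\<plusminus> G\<close>, which \<open>H\<close> dominates. This is
  the step in which \<open>H\<close> appears once, and not twice.
\<close>

lemma monotone_perturbed_sgn_flux:
  assumes var: "\<And>a b. 0 \<le> a \<Longrightarrow> a \<le> b \<Longrightarrow> b \<le> 1 \<Longrightarrow> \<bar>G b - G a\<bar> \<le> H b - H a"
    and "0 \<le> a" "a \<le> b" "b \<le> 1" and c: "c \<in> {0..1::real}"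
  shows "H a + sgn_flux G a c \<le> H b + sgn_flux G b c"
proof -
  have above: "sgn_flux G x c = G x - G c" if "c \<le> x" for x
    using that by (cases "c = x") (auto simp: sgn_flux_def)
  have below: "sgn_flux G x c = G c - G x" if "x \<le> c" for x
    using that by (cases "c = x") (auto simp: sgn_flux_def)
  consider "c \<le> a" | "b \<le> c" | "a < c" "c < b" by linarith
  then show ?thesis
  proof cases
    case 1
    then show ?thesis using var[OF assms(2-4)] assms(3) by (simp add: above)
  next
    case 2
    then show ?thesis using var[OF assms(2-4)] assms(3) by (simp add: below)
  next
    case 3
    have "\<bar>G c - G a\<bar> \<le> H c - H a" "\<bar>G b - G c\<bar> \<le> H b - H c"
      using 3 assms by (auto intro!: var)
    then show ?thesis using 3 by (simp add: above below)
  qed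
qed

text \<open>
  The cone weights tend to \<open>1\<close> as \<open>R\<close> grows, and Fatou's lemma passes to the limit, whether or not the
  norms are finite.
\<close>

lemma L1_norm_le_if_truncations_le:
  fixes f g :: "real \<Rightarrow> real"
  assumes [measurable]: "f \<in> borel_measurable lebesgue" "g \<in> borel_measurable lebesgue"
    and f: "\<And>x. \<bar>f x\<bar> \<le> 1" and g: "\<And>x. \<bar>g x\<bar> \<le> 1" and L: "0 \<le> L" and st: "0 \<le> s" "0 \<le> t" and C: "0 \<le> C"
    and le: "\<And>R. (LINT x|lebesgue. \<bar>f x\<bar> * cone_weight L R t x) \<le> (LINT x|lebesgue. \<bar>g x\<bar> * cone_weight L R s x) + C"
  shows "L1_norm f \<le> L1_norm g + ennreal C"
proof -
  have [measurable]: "cone_weight L R \<tau> \<in> borel_measurable lebesgue" for R \<tau>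
    by (intro measurable_completion) simp
  have eq: "(\<integral>\<^sup>+x. ennreal (\<bar>q x\<bar> * cone_weight L R \<tau> x) \<partial>lebesgue) = ennreal (LINT x|lebesgue. \<bar>q x\<bar> * cone_weight L R \<tau> x)"
    if [measurable]: "q \<in> borel_measurable lebesgue" and q: "\<And>x. \<bar>q x\<bar> \<le> 1" and \<tau>: "0 \<le> \<tau>" for q R \<tau>
  proof (rule nn_integral_eq_integral)
    show "integrable lebesgue (\<lambda>x. \<bar>q x\<bar> * cone_weight L R \<tau> x)"
    proof (rule integrable_lebesgue_bounded_support[of _ "{-R..R}" 1])
      show "\<bar>\<bar>q x\<bar> * cone_weight L R \<tau> x\<bar> \<le> 1" for x
        using q[of x] cone_weight_bounds[of L R \<tau> x] by (simp add: abs_mult mult_le_one)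
    qed (simp_all add: cone_weight_support[OF L \<tau>] del: atLeastAtMost_iff)
  qed (simp add: cone_weight_bounds)
  have bound: "(\<integral>\<^sup>+x. ennreal (\<bar>f x\<bar> * cone_weight L R t x) \<partial>lebesgue) \<le> L1_norm g + ennreal C" for R
  proof -
    have "(\<integral>\<^sup>+x. ennreal (\<bar>f x\<bar> * cone_weight L R t x) \<partial>lebesgue) \<le> ennreal ((LINT x|lebesgue. \<bar>g x\<bar> * cone_weight L R s x) + C)"
      unfolding eq[OF assms(1) f st(2)] by (intro ennreal_leI le)
    also have "\<dots> = ennreal (LINT x|lebesgue. \<bar>g x\<bar> * cone_weight L R s x) + ennreal C"
      using C by (intro ennreal_plus Bochner_Integration.integral_nonneg) (simp_all add: cone_weight_bounds)
    also have "ennreal (LINT x|lebesgue. \<bar>g x\<bar> * cone_weight L R s x) = (\<integral>\<^sup>+x. ennreal (\<bar>g x\<bar> * cone_weight L R s x) \<partial>lebesgue)"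
      by (rule eq[OF assms(2) g st(1), symmetric])
    also have "\<dots> \<le> L1_norm g"
      unfolding L1_norm_def by (intro nn_integral_mono ennreal_leI) (simp add: mult_left_le cone_weight_bounds)
    finally show ?thesis by (simp add: add_right_mono)
  qed
  have lim: "(\<lambda>n. ennreal (\<bar>f x\<bar> * cone_weight L (real n) t x)) \<longlonglongrightarrow> ennreal \<bar>f x\<bar>" for x
  proof -
    have "(\<lambda>n. ramp (real n - L * t - x)) \<longlonglongrightarrow> 1" "(\<lambda>n. ramp (real n - L * t + x)) \<longlonglongrightarrow> 1"
      by (rule filterlim_compose[OF ramp_tendsto_1], real_asymp)+
    then have "(\<lambda>n. \<bar>f x\<bar> * cone_weight L (real n) t x) \<longlonglongrightarrow> \<bar>f x\<bar> * (1 * 1)"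
      unfolding cone_weight_def by (intro tendsto_intros)
    then show ?thesis by (intro tendsto_ennrealI) simp
  qed
  have "L1_norm f = (\<integral>\<^sup>+x. liminf (\<lambda>n. ennreal (\<bar>f x\<bar> * cone_weight L (real n) t x)) \<partial>lebesgue)"
    unfolding L1_norm_def using lim_imp_Liminf[OF _ lim] by simp
  also have "\<dots> \<le> liminf (\<lambda>n. \<integral>\<^sup>+x. ennreal (\<bar>f x\<bar> * cone_weight L (real n) t x) \<partial>lebesgue)"
    by (rule nn_integral_liminf) measurable
  also have "\<dots> \<le> liminf (\<lambda>n::nat. L1_norm g + ennreal C)"
    by (rule Liminf_mono) (simp add: bound)
  also have "\<dots> = L1_norm g + ennreal C" by (simp add: Liminf_const)
  finally show ?thesis .
qed

theorem proposition1p4: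
  fixes \<Lambda> M \<Lambda>' M' :: "real \<Rightarrow> real"
    and P Q :: "real measure"
    and u v :: "real \<Rightarrow> real \<Rightarrow> real"
    and s t :: real
  assumes "\<And>w. w \<in> {0..1} \<Longrightarrow> (\<Lambda> has_real_derivative \<Lambda>' w) (at w within {0..1})"
    and "continuous_on {0..1} \<Lambda>'"
    and "\<And>w. w \<in> {0..1} \<Longrightarrow> (M has_real_derivative M' w) (at w within {0..1})"
    and "continuous_on {0..1} M'"
    and "real_distribution P" and "real_distribution Q"
    and "entropy_solution \<Lambda> (cdf P) u"
    and "entropy_solution M (cdf Q) v"
    and "0 \<le> s" and "s \<le> t"
  shows "L1_norm (\<lambda>x. u t x - v t x)
         \<le> L1_norm (\<lambda>x. u s x - v s x)
           + ennreal ((t - s) * (LINT w:{0..1}|lebesgue. \<bar>\<Lambda>' w - M' w\<bar>))"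
proof -
  obtain L\<^sub>1 where L\<^sub>1: "0 \<le> L\<^sub>1" "\<And>a b. a \<in> {0..1} \<Longrightarrow> b \<in> {0..1} \<Longrightarrow> \<bar>\<Lambda> a - \<Lambda> b\<bar> \<le> L\<^sub>1 * \<bar>a - b\<bar>"
    using C1_imp_Lipschitz[OF assms(1,2)] by blast
  obtain L where L: "0 \<le> L" "\<And>a b. a \<in> {0..1} \<Longrightarrow> b \<in> {0..1} \<Longrightarrow> \<bar>M a - M b\<bar> \<le> L * \<bar>a - b\<bar>"
    using C1_imp_Lipschitz[OF assms(3,4)] by blast
  have cont: "continuous_on {0..1} \<Lambda>" "continuous_on {0..1} M"
    using DERIV_continuous_on[OF assms(1)] DERIV_continuous_on[OF assms(3)] by blast+
  define g where "g w = \<bar>\<Lambda>' w - M' w\<bar>" for w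
  have g: "continuous_on {0..1} g" unfolding g_def[abs_def] by (intro continuous_intros assms)
  define h where "h = integral {0..1} g"
  define H where "H a = integral {0..clamp01 a} g" for a
  define f where "f a = \<Lambda> (clamp01 a)" for a
  define m where "m a = M (clamp01 a)" for a
  have dH: "((\<lambda>a. integral {0..a} g) has_real_derivative g a) (at a within {0..1})" if "a \<in> {0..1}" for a
    by (rule integral_has_real_derivative[OF g that])
  obtain K where K: "0 \<le> K" "\<And>a b. a \<in> {0..1} \<Longrightarrow> b \<in> {0..1} \<Longrightarrow> \<bar>integral {0..a} g - integral {0..b} g\<bar> \<le> K * \<bar>a - b\<bar>"
    using C1_imp_Lipschitz[OF dH g] by blast
  have cont_H: "continuous_on {0..1} (\<lambda>a. integral {0..a} g)"
    by (rule DERIV_continuous_on[OF dH])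
  have clamped: "(\<lambda>a. q (clamp01 a)) \<in> borel_measurable borel" if "continuous_on {0..1} q" for q :: "real \<Rightarrow> real"
    by (intro borel_measurable_continuous_onI continuous_on_compose2[OF that continuous_clamp01])
      (use clamp01_in in blast)
  have [measurable]: "f \<in> borel_measurable borel" "m \<in> borel_measurable borel" "H \<in> borel_measurable borel"
    unfolding f_def[abs_def] m_def[abs_def] H_def[abs_def] by (intro clamped cont cont_H)+
  have fL: "\<bar>f a - f b\<bar> \<le> L\<^sub>1 * \<bar>a - b\<bar>" and mL: "\<bar>m a - m b\<bar> \<le> L * \<bar>a - b\<bar>" and HL: "\<bar>H a - H b\<bar> \<le> K * \<bar>a - b\<bar>"
    if "a \<in> {0..1}" "b \<in> {0..1}" for a b
    using L\<^sub>1(2)[OF that] L(2)[OF that] K(2)[OF that] by (simp_all add: f_def m_def H_def clamp01_id[OF that(1)] clamp01_id[OF that(2)])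
  have var: "\<bar>(f b - m b) - (f a - m a)\<bar> \<le> H b - H a" if "0 \<le> a" "a \<le> b" "b \<le> 1" for a b
  proof -
    have "((\<lambda>w. \<Lambda> w - M w) has_real_derivative \<Lambda>' w - M' w) (at w within {0..1})" if "w \<in> {0..1}" for w
      using assms(1,3) that by (intro DERIV_diff)
    from increment_le_integral_abs_deriv[OF this _ that]
    have "\<bar>(\<Lambda> b - M b) - (\<Lambda> a - M a)\<bar> \<le> integral {0..b} g - integral {0..a} g"
      unfolding g_def[abs_def] using assms(2,4) by (auto intro: continuous_intros)
    then show ?thesis using that by (simp add: f_def m_def H_def clamp01_id)
  qed
  have H: "H a \<in> {0..h}" if "a \<in> {0..1}" for a
  proof -
    have "H 0 = 0" "H 1 = h" by (simp_all add: H_def h_def clamp01_id)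
    then show ?thesis using var[of 0 a] var[of a 1] that by auto
  qed
  have h0: "0 \<le> h" using H[of 0] by simp
  obtain w\<^sub>1 where w\<^sub>1: "borel_version u w\<^sub>1" using exists_borel_version[OF assms(7)] .
  obtain w\<^sub>2 where w\<^sub>2: "borel_version v w\<^sub>2" using exists_borel_version[OF assms(8)] .
  have wm[measurable]: "w\<^sub>1 \<in> borel_measurable borel" "w\<^sub>2 \<in> borel_measurable borel"
    and wr: "w\<^sub>1 z \<in> {0..1}" "w\<^sub>2 z \<in> {0..1}" for z
    using w\<^sub>1 w\<^sub>2 unfolding borel_version_def by blast+
  have incr: "AE z in lborel. w\<^sub>1 z \<le> w\<^sub>1 ((0, d) + z)" if "0 < d" for d
  proof (rule entropy_solution_increasing[OF assms(7) w\<^sub>1 L\<^sub>1(2) _ _ that])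
    interpret real_distribution P by fact
    show "mono (cdf P)" by (rule monoI) (rule cdf_nondecreasing)
    show "cdf P x \<in> {0..1}" for x using cdf_nonneg cdf_bounded_prob by simp
  qed
  define N where "N a b = \<bar>a - b\<bar>" for a b :: real
  \<comment> \<open>The common flux of the two entropy inequalities.\<close>
  define F where "F a b = sgn_flux m a b - H a" for a b
  have Nm: "case_prod N \<in> borel_measurable borel" unfolding N_def[abs_def] split_beta' by measurable
  have Fm: "case_prod F \<in> borel_measurable borel"
  proof -
    note [measurable] = borel_measurable_sgn_flux[OF \<open>m \<in> borel_measurable borel\<close>, unfolded split_beta']
    show ?thesis unfolding F_def[abs_def] split_beta' by measurable
  qed
  \<comment> \<open>A crude common bound for the sizes of all entropies and fluxes below and for the Lipschitz constants of \<open>N\<close> and \<open>F\<close>.\<close>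
  define B where "B = 1 + L + L\<^sub>1 + K + h"
  have sB: "\<bar>sgn_flux f a b\<bar> \<le> L\<^sub>1" "\<bar>sgn_flux m a b\<bar> \<le> L" if "a \<in> {0..1}" "b \<in> {0..1}" for a b
  proof -
    have "L\<^sub>1 * \<bar>a - b\<bar> \<le> L\<^sub>1 * 1" "L * \<bar>a - b\<bar> \<le> L * 1"
      using abs_diff_le_1[OF that] L(1) L\<^sub>1(1) by (intro mult_left_mono; simp)+
    then show "\<bar>sgn_flux f a b\<bar> \<le> L\<^sub>1" "\<bar>sgn_flux m a b\<bar> \<le> L"
      using sgn_flux_bound[of f a b, OF fL[OF that]] sgn_flux_bound[of m a b, OF mL[OF that]] by auto
  qed
  have du: "dissipates (\<lambda>z. N (w\<^sub>1 z) c) (\<lambda>z. F (w\<^sub>1 z) c)" if c: "c \<in> {0..1}" for c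
  proof -
    \<comment> \<open>The increasing function whose subtraction exchanges \<open>\<Lambda>\<close> for \<open>M\<close> in the flux of \<open>u\<close>.\<close>
    define q where "q a = H a + sgn_flux (\<lambda>a. f a - m a) a c" for a
    have qF: "sgn_flux f a c + - q a = F a c" for a by (simp add: q_def F_def sgn_flux_def algebra_simps)
    have [measurable]: "q \<in> borel_measurable borel" unfolding q_def[abs_def] sgn_flux_def by measurable
    have qB: "\<bar>q (w\<^sub>1 z)\<bar> \<le> B" for z
    proof -
      have "q a = H a + (sgn_flux f a c - sgn_flux m a c)" for a by (simp add: q_def sgn_flux_def algebra_simps)
      then show ?thesis using H[OF wr(1)[of z]] sB[OF wr(1)[of z] c] L L\<^sub>1 K(1) by (auto simp: B_def)
    qed
    have D: "dissipates (\<lambda>z. \<bar>w\<^sub>1 z - c\<bar>) (\<lambda>z. sgn_flux f (w\<^sub>1 z) c)"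
      using entropy_solution_dissipates[OF assms(7) w\<^sub>1 cont(1) c] by (simp add: sgn_flux_def f_def)
    have Z: "dissipates (\<lambda>_. 0) (\<lambda>z. - q (w\<^sub>1 z))"
    proof (rule dissipates_minus_increasing[OF _ qB])
      show "AE z in lborel. q (w\<^sub>1 z) \<le> q (w\<^sub>1 ((0, d) + z))" if "0 < d" for d
        using incr[OF that]
      proof eventually_elim
        case (elim z)
        then show ?case unfolding q_def
          using wr(1)[of z] wr(1)[of "(0, d) + z"] by (intro monotone_perturbed_sgn_flux[OF _ _ _ _ c]) (auto intro: var)
      qed
    qed measurable
    have [measurable]: "(\<lambda>z. sgn_flux f (w\<^sub>1 z) c) \<in> borel_measurable borel" unfolding sgn_flux_def by measurable
    have "dissipates (\<lambda>z. \<bar>w\<^sub>1 z - c\<bar> + 0) (\<lambda>z. sgn_flux f (w\<^sub>1 z) c + - q (w\<^sub>1 z))"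
    proof (rule dissipates_add[OF D Z, where B = B])
      show "\<bar>\<bar>w\<^sub>1 z - c\<bar>\<bar> \<le> B" for z using abs_diff_le_1[OF wr(1)[of z] c] L(1) L\<^sub>1(1) K(1) h0 by (simp add: B_def)
      show "\<bar>sgn_flux f (w\<^sub>1 z) c\<bar> \<le> B" for z using sB(1)[OF wr(1)[of z] c] L(1) K(1) h0 by (simp add: B_def)
      show "\<bar>- q (w\<^sub>1 z)\<bar> \<le> B" for z using qB by simp
    qed (use L(1) L\<^sub>1(1) K(1) h0 in \<open>simp_all add: B_def\<close>)
    then show ?thesis unfolding qF by (simp add: N_def)
  qed
  have dv: "dissipates (\<lambda>z. N c (w\<^sub>2 z)) (\<lambda>z. F c (w\<^sub>2 z))" if c: "c \<in> {0..1}" for c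
  proof -
    \<comment> \<open>Here \<open>- H c\<close> is a constant flux, which dissipates nothing.\<close>
    have D: "dissipates (\<lambda>z. \<bar>w\<^sub>2 z - c\<bar>) (\<lambda>z. sgn_flux m (w\<^sub>2 z) c)"
      using entropy_solution_dissipates[OF assms(8) w\<^sub>2 cont(2) c] by (simp add: sgn_flux_def m_def)
    have [measurable]: "(\<lambda>z. sgn_flux m (w\<^sub>2 z) c) \<in> borel_measurable borel" unfolding sgn_flux_def by measurable
    have "dissipates (\<lambda>z. \<bar>w\<^sub>2 z - c\<bar> + 0) (\<lambda>z. sgn_flux m (w\<^sub>2 z) c + - H c)"
    proof (rule dissipates_add[OF D dissipates_const, where B = B])
      show "\<bar>\<bar>w\<^sub>2 z - c\<bar>\<bar> \<le> B" for z using abs_diff_le_1[OF wr(2)[of z] c] L(1) L\<^sub>1(1) K(1) h0 by (simp add: B_def)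
      show "\<bar>sgn_flux m (w\<^sub>2 z) c\<bar> \<le> B" for z using sB(2)[OF wr(2)[of z] c] L\<^sub>1(1) K(1) h0 by (simp add: B_def)
      show "\<bar>- H c\<bar> \<le> B" using H[OF c] L(1) L\<^sub>1(1) K(1) by (simp add: B_def)
    qed (use L(1) L\<^sub>1(1) K(1) h0 in \<open>simp_all add: B_def\<close>)
    then show ?thesis by (simp add: N_def F_def sgn_flux_commute[of m _ c] abs_minus_commute)
  qed
  have NB: "x \<le> y \<Longrightarrow> 0 \<le> y \<Longrightarrow> x \<le> B * y" "x \<le> (L + K) * y \<Longrightarrow> 0 \<le> y \<Longrightarrow> x \<le> B * y" for x y
  proof -
    assume y: "0 \<le> y"
    have "1 * y \<le> B * y" "(L + K) * y \<le> B * y" using y L(1) L\<^sub>1(1) K(1) h0 by (intro mult_right_mono; simp add: B_def)+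
    then show "x \<le> y \<Longrightarrow> x \<le> B * y" "x \<le> (L + K) * y \<Longrightarrow> x \<le> B * y" by auto
  qed
  have diss: "dissipates (\<lambda>z. N (w\<^sub>1 z) (w\<^sub>2 z)) (\<lambda>z. F (w\<^sub>1 z) (w\<^sub>2 z))"
  proof (rule dissipates_doubling[OF wm(1) wr(1) wm(2) wr(2) Nm Fm _ _ _ _ du dv, where B = B])
    show "\<bar>N a b\<bar> \<le> B" "\<bar>F a b\<bar> \<le> B" if "a \<in> {0..1}" "b \<in> {0..1}" for a b
      using abs_diff_le_1[OF that] sB(2)[OF that] H[OF that(1)] L(1) L\<^sub>1(1) K(1) h0 by (auto simp: B_def N_def F_def)
    show "\<bar>N a b - N a' b\<bar> \<le> B * \<bar>a - a'\<bar>" for a a' b by (intro NB(1)) (auto simp: N_def)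
    show "\<bar>F a b - F a' b\<bar> \<le> B * \<bar>a - a'\<bar>" if "a \<in> {0..1}" "a' \<in> {0..1}" "b \<in> {0..1}" for a a' b
      using sgn_flux_Lipschitz[of "{0..1}" m L a a' b, OF mL that] HL[OF that(1,2)]
      by (intro NB(2)) (auto simp: F_def distrib_right)
  qed
  have curve: "L1_loc_curve u" "L1_loc_curve v"
    using assms(7,8) by (auto intro: entropy_solution_L1_loc_curve)
  have t0: "0 \<le> t" using assms(9,10) by simp
  have est: "(LINT x|lebesgue. N (u t x) (v t x) * cone_weight L R t x)
      \<le> (LINT x|lebesgue. N (u s x) (v s x) * cone_weight L R s x) + (t - s) * h" for R
    unfolding cone_energy_def[symmetric]
  proof (rule cone_estimate[OF curve(1) w\<^sub>1 curve(2) w\<^sub>2 Nm Fm _ _ _ H L(1) diss assms(9,10)])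
    show "N a b \<in> {0..1}" if "a \<in> {0..1}" "b \<in> {0..1}" for a b using abs_diff_le_1[OF that] by (simp add: N_def)
    show "\<bar>N a b - N a' b'\<bar> \<le> \<bar>a - a'\<bar> + \<bar>b - b'\<bar>" for a b a' b' by (simp add: N_def)
    show "\<bar>F a b + H a\<bar> \<le> L * N a b" if "a \<in> {0..1}" "b \<in> {0..1}" for a b
      using sgn_flux_bound[of m a b, OF mL[OF that]] by (simp add: F_def N_def)
  qed
  have slice: "(\<lambda>x. u \<tau> x - v \<tau> x) \<in> borel_measurable lebesgue" "\<bar>u \<tau> x - v \<tau> x\<bar> \<le> 1" if "0 \<le> \<tau>" for \<tau> x
  proof -
    have "u \<tau> \<in> borel_measurable lebesgue" "v \<tau> \<in> borel_measurable lebesgue"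
      using curve that by (auto simp: L1_loc_curve_def)
    then show "(\<lambda>x. u \<tau> x - v \<tau> x) \<in> borel_measurable lebesgue" by (rule borel_measurable_diff)
    show "\<bar>u \<tau> x - v \<tau> x\<bar> \<le> 1" using curve that by (intro abs_diff_le_1) (auto simp: L1_loc_curve_def)
  qed
  have "L1_norm (\<lambda>x. u t x - v t x) \<le> L1_norm (\<lambda>x. u s x - v s x) + ennreal ((t - s) * h)"
    using assms(9,10) h0 est unfolding N_def
    by (intro L1_norm_le_if_truncations_le[OF slice(1)[OF t0] slice(1)[OF assms(9)]
          slice(2)[OF t0] slice(2)[OF assms(9)] L(1) assms(9) t0]) auto
  also have "h = (LINT w:{0..1}|lebesgue. \<bar>\<Lambda>' w - M' w\<bar>)"
    unfolding h_def using set_lebesgue_integral_eq_integral(2)[OF absolutely_integrable_continuous_real[OF g]]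
    by (simp add: g_def)
  finally show ?thesis .
qed

end
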